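(* **(1)** If $p=3$, $0<a<1/\Lambda$ and $\lambda<b\lambda_1$, then $N_3$, $W_3^+$, $W_3^-$ are nonempty, and (i) for every $u\in S$ there exists a unique number $\sigma_u>0$, namely $$\sigma_u=\left(\frac{b\|\nabla u\|_2^2-\lambda\|u\|_2^2}{\|u\|_4^4-a\|\nabla u\|_2^4}\right)^{1/2},$$ such that $\sigma_u u\in N_3$, $J(\sigma_u u)=\sup_{\tau>0}J(\tau u)$, $\tau u\in N_3^+$ for $\tau\in(0,\sigma_u)$, and $\tau u\in N_3^-$ for $\tau\in(\sigma_u,+\infty)$; (ii) for any $u\in S^c$, $\tau u\in N_3^+$ for all $\tau>0$; (iii) $J$ is bounded below on $N_3$, so that $d_3$ is well defined; moreover $d_3>0$. **(2)** If $p=3$, $0<a<1/\Lambda$, $\|\psi_1\|_4^4-a\|\nabla\psi_1\|_2^4<0$ and $b\lambda_1<\lambda<b\lambda_1+\delta$ (with $\delta$ as in the context), then, with $\sigma_u>0$ given by the same formula as in (i) for $u\in S\cup L^-$: (iv) $N_3\cap L^0=\emptyset$, and $N_3\cap L^+$ and $N_3\cap L^-$ are nonempty; (v) for every $u\in S$: $\sigma_u u\in N_3\cap L^+$, $\tau u\in N_3^+$ for $\tau\in(0,\sigma_u)$ and $\tau u\in N_3^-$ for $\tau\in(\sigma_u,+\infty)$; (vi) for every $u\in L^-$: $\sigma_u u\in N_3\cap L^-$, $\tau u\in N_3^-$ for $\tau\in(0,\sigma_u)$ and $\tau u\in N_3^+$ for $\tau\in(\sigma_u,+\infty)$; (vii)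 $J$ is bounded below on $N_3\cap L^-$, so that $d_3^-=\inf_{u\in N_3\cap L^-}J(u)$ is well defined; furthermore $d_3^-<0$. **(3)** If $3<p<5$ and $\lambda\le b\lambda_1$, then $N_p$, $W_p^+$, $W_p^-$ are nonempty, and (viii) for every $u\in H_0^1(\Omega)\setminus\{0\}$ there exists a unique number $\tau_u>0$ such that $J(\tau_u u)=\sup_{\tau>0}J(\tau u)$, $\tau_u u\in N_p$, $\tau u\in N_p^+$ for $\tau\in(0,\tau_u)$ and $\tau u\in N_p^-$ for $\tau\in(\tau_u,+\infty)$; (ix) $J$ is bounded below on $N_p$, so that $d_p$ is well defined; moreover $d_p>0$.
   Context: $\Omega\subset\mathbb{R}^3$ is a bounded open set with smooth boundary; $a,b>0$, $\lambda\in\mathbb{R}$. $\|\cdot\|_q$ is the $L^q(\Omega)$ norm. $\lambda_1>0$ is the principal Dirichlet eigenvalue of $-\Delta$ on $\Omega$, with positive principal eigenfunction $\psi_1$. $\Lambda=\inf\{\|\nabla u\|_2^4:\ u\in H_0^1(\Omega),\ \|u\|_4=1\}>0$. For $u\in H_0^1(\Omega)$ put $$J(u)=\frac a4\|\nabla u\|_2^4+\frac b2\|\nabla u\|_2^2-\frac\lambda2\|u\|_2^2-\frac1{p+1}\|u\|_{p+1}^{p+1},\qquad I(u)=a\|\nabla u\|_2^4+b\|\nabla u\|_2^2-\lambda\|u\|_2^2-\|u\|_{p+1}^{p+1}.$$ For $3\le p<5$: $N_p=\{u\in H_0^1(\Omega)\setminus\{0\}: I(u)=0\}$, $N_p^+=\{u\in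 H_0^1(\Omega): I(u)>0\}\cup\{0\}$, $N_p^-=\{u\in H_0^1(\Omega): I(u)<0\}$, $d_p=\inf_{u\in N_p}J(u)$, $J^{d}=\{u\in H_0^1(\Omega):J(u)<d\}$, $W_p^{+}=J^{d_p}\cap N_p^{+}$, $W_p^{-}=J^{d_p}\cap N_p^{-}$. $L^+=\{u\in H_0^1(\Omega): b\|\nabla u\|_2^2-\lambda\|u\|_2^2>0\}$; $L^0$ and $L^-$ are defined in the same way with $>0$ replaced by $=0$ and $<0$ respectively. $S=\{u\in H_0^1(\Omega):\|u\|_4^4-a\|\nabla u\|_2^4>0\}$, and $S^c$ is its complement in $H_0^1(\Omega)$. In part (2), $\delta>0$ is a number such that $\overline{L^-}\cap\overline{S}=\{0\}$ (closures in $H_0^1(\Omega)$) for every $\lambda\in(b\lambda_1,b\lambda_1+\delta)$; such $\delta$ exists when $0<a<1/\Lambda$ and $\|\psi_1\|_4^4-a\|\nabla\psi_1\|_2^4<0$.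
   Formalization: In part (2), δ is also required to satisfy ‖u‖₄⁴ − a‖∇u‖₂⁴ ≠ 0 for all u in L⁻ and every λ in (bλ₁, bλ₁+δ); the closure condition alone allows zeros, where σ_u is undefined and (iv) can fail. *)

theory Defs
  imports "HOL-Analysis.Analysis"
begin

(* Functions on Omega are total functions on real^3 of which only the values on Omega matter
   (all integrals are over lebesgue_on Omega).  Elements of the Sobolev spaces are
   representatives; the zero element is the set of all representatives vanishing a.e. on Omega. *)

type_synonym pt = "real ^ 3"

subsection \<open>Smooth functions and smooth boundaries\<close>

(* Intended for open U, where this is the usual space of k times continuously
   differentiable functions. *)
primrec Ck_on :: "nat \<Rightarrow> pt set \<Rightarrow> (pt \<Rightarrow> real) \<Rightarrow> bool" where
  "Ck_on 0 U f \<longleftrightarrow> continuous_on U f"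
| "Ck_on (Suc k) U f \<longleftrightarrow>
     f differentiable_on U \<and> (\<forall>v. Ck_on k U (\<lambda>x. frechet_derivative f (at x) v))"

definition smooth_on :: "pt set \<Rightarrow> (pt \<Rightarrow> real) \<Rightarrow> bool" where
  "smooth_on U f \<longleftrightarrow> (\<forall>k. Ck_on k U f)"

(* Near each boundary point, Omega is the sublevel set of a smooth function without
   critical points. *)
definition smooth_boundary :: "pt set \<Rightarrow> bool" where
  "smooth_boundary \<Omega> \<longleftrightarrow>
     (\<forall>x\<in>frontier \<Omega>. \<exists>U r. open U \<and> x \<in> U \<and> smooth_on U r \<and>
        (\<forall>y\<in>U. \<exists>v. frechet_derivative r (at y) v \<noteq> 0) \<and>
        \<Omega> \<inter> U = {y \<in> U. r y < 0})"

subsection \<open>Lebesgue and Sobolev spaces\<close>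

definition Lnorm :: "real \<Rightarrow> pt set \<Rightarrow> (pt \<Rightarrow> 'b::real_normed_vector) \<Rightarrow> real" where
  "Lnorm q \<Omega> f = (LINT x|lebesgue_on \<Omega>. norm (f x) powr q) powr (1 / q)"

definition L2_on :: "pt set \<Rightarrow> (pt \<Rightarrow> 'b::euclidean_space) \<Rightarrow> bool" where
  "L2_on \<Omega> f \<longleftrightarrow> f \<in> borel_measurable (lebesgue_on \<Omega>) \<and>
     integrable (lebesgue_on \<Omega>) (\<lambda>x. (norm (f x))\<^sup>2)"

definition test_functions :: "pt set \<Rightarrow> (pt \<Rightarrow> real) set" where
  "test_functions \<Omega> = {\<phi>. smooth_on UNIV \<phi> \<and> (\<exists>K. compact K \<and> K \<subseteq> \<Omega> \<and> (\<forall>x. x \<notin> K \<longrightarrow> \<phi> x = 0))}"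

definition weak_gradient :: "pt set \<Rightarrow> (pt \<Rightarrow> real) \<Rightarrow> (pt \<Rightarrow> pt) \<Rightarrow> bool" where
  "weak_gradient \<Omega> u g \<longleftrightarrow> L2_on \<Omega> g \<and>
     (\<forall>\<phi>\<in>test_functions \<Omega>. \<forall>i.
        (LINT x|lebesgue_on \<Omega>. u x * frechet_derivative \<phi> (at x) (axis i 1)) =
        - (LINT x|lebesgue_on \<Omega>. g x $ i * \<phi> x))"

definition H1 :: "pt set \<Rightarrow> (pt \<Rightarrow> real) set" where
  "H1 \<Omega> = {u. L2_on \<Omega> u \<and> (\<exists>g. weak_gradient \<Omega> u g)}"

(* Determined up to equality a.e. on Omega for u in H1. *)
definition grad :: "pt set \<Rightarrow> (pt \<Rightarrow> real) \<Rightarrow> pt \<Rightarrow> pt" where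
  "grad \<Omega> u = (SOME g. weak_gradient \<Omega> u g)"

definition H1_norm :: "pt set \<Rightarrow> (pt \<Rightarrow> real) \<Rightarrow> real" where
  "H1_norm \<Omega> u = sqrt ((Lnorm 2 \<Omega> u)\<^sup>2 + (Lnorm 2 \<Omega> (grad \<Omega> u))\<^sup>2)"

(* For subsets of H01, which is closed in H1, this is also the closure in H01. *)
definition H1_closure :: "pt set \<Rightarrow> (pt \<Rightarrow> real) set \<Rightarrow> (pt \<Rightarrow> real) set" where
  "H1_closure \<Omega> A = {u \<in> H1 \<Omega>. \<forall>e>0. \<exists>v\<in>A. H1_norm \<Omega> (\<lambda>x. u x - v x) < e}"

definition H01 :: "pt set \<Rightarrow> (pt \<Rightarrow> real) set" where
  "H01 \<Omega> = H1_closure \<Omega> (test_functions \<Omega>)"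

definition zero_H01 :: "pt set \<Rightarrow> (pt \<Rightarrow> real) set" where
  "zero_H01 \<Omega> = {u \<in> H01 \<Omega>. AE x in lebesgue_on \<Omega>. u x = 0}"

subsection \<open>The principal Dirichlet eigenvalue and the constant \<open>\<Lambda>\<close>\<close>

(* Eigenfunctions in the weak sense: - Laplace u = mu u in Omega, u = 0 on the boundary. *)
definition dirichlet_eigenfunction :: "pt set \<Rightarrow> real \<Rightarrow> (pt \<Rightarrow> real) \<Rightarrow> bool" where
  "dirichlet_eigenfunction \<Omega> \<mu> u \<longleftrightarrow> u \<in> H01 \<Omega> - zero_H01 \<Omega> \<and>
     (\<forall>v\<in>H01 \<Omega>. (LINT x|lebesgue_on \<Omega>. grad \<Omega> u x \<bullet> grad \<Omega> v x) =
                 \<mu> * (LINT x|lebesgue_on \<Omega>. u x * v x))"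

definition principal_eigenvalue :: "pt set \<Rightarrow> real" where
  "principal_eigenvalue \<Omega> = (LEAST \<mu>. \<exists>u. dirichlet_eigenfunction \<Omega> \<mu> u)"

definition Lambda_const :: "pt set \<Rightarrow> real" where
  "Lambda_const \<Omega> = (INF u\<in>{u \<in> H01 \<Omega>. Lnorm 4 \<Omega> u = 1}. (Lnorm 2 \<Omega> (grad \<Omega> u)) ^ 4)"

subsection \<open>The functionals and the Nehari sets\<close>

definition J_fun :: "pt set \<Rightarrow> real \<Rightarrow> real \<Rightarrow> real \<Rightarrow> real \<Rightarrow> (pt \<Rightarrow> real) \<Rightarrow> real" where
  "J_fun \<Omega> a b l p u =
     a / 4 * (Lnorm 2 \<Omega> (grad \<Omega> u)) ^ 4 + b / 2 * (Lnorm 2 \<Omega> (grad \<Omega> u))\<^sup>2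
     - l / 2 * (Lnorm 2 \<Omega> u)\<^sup>2 - 1 / (p + 1) * (Lnorm (p + 1) \<Omega> u) powr (p + 1)"

definition I_fun :: "pt set \<Rightarrow> real \<Rightarrow> real \<Rightarrow> real \<Rightarrow> real \<Rightarrow> (pt \<Rightarrow> real) \<Rightarrow> real" where
  "I_fun \<Omega> a b l p u =
     a * (Lnorm 2 \<Omega> (grad \<Omega> u)) ^ 4 + b * (Lnorm 2 \<Omega> (grad \<Omega> u))\<^sup>2
     - l * (Lnorm 2 \<Omega> u)\<^sup>2 - (Lnorm (p + 1) \<Omega> u) powr (p + 1)"

definition N_set :: "pt set \<Rightarrow> real \<Rightarrow> real \<Rightarrow> real \<Rightarrow> real \<Rightarrow> (pt \<Rightarrow> real) set" where
  "N_set \<Omega> a b l p = {u \<in> H01 \<Omega> - zero_H01 \<Omega>. I_fun \<Omega> a b l p u = 0}"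

definition N_plus :: "pt set \<Rightarrow> real \<Rightarrow> real \<Rightarrow> real \<Rightarrow> real \<Rightarrow> (pt \<Rightarrow> real) set" where
  "N_plus \<Omega> a b l p = {u \<in> H01 \<Omega>. I_fun \<Omega> a b l p u > 0} \<union> zero_H01 \<Omega>"

definition N_minus :: "pt set \<Rightarrow> real \<Rightarrow> real \<Rightarrow> real \<Rightarrow> real \<Rightarrow> (pt \<Rightarrow> real) set" where
  "N_minus \<Omega> a b l p = {u \<in> H01 \<Omega>. I_fun \<Omega> a b l p u < 0}"

definition d_const :: "pt set \<Rightarrow> real \<Rightarrow> real \<Rightarrow> real \<Rightarrow> real \<Rightarrow> real" where
  "d_const \<Omega> a b l p = (INF u\<in>N_set \<Omega> a b l p. J_fun \<Omega> a b l p u)"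

definition J_sublevel :: "pt set \<Rightarrow> real \<Rightarrow> real \<Rightarrow> real \<Rightarrow> real \<Rightarrow> real \<Rightarrow> (pt \<Rightarrow> real) set" where
  "J_sublevel \<Omega> a b l p d = {u \<in> H01 \<Omega>. J_fun \<Omega> a b l p u < d}"

definition W_plus :: "pt set \<Rightarrow> real \<Rightarrow> real \<Rightarrow> real \<Rightarrow> real \<Rightarrow> (pt \<Rightarrow> real) set" where
  "W_plus \<Omega> a b l p = J_sublevel \<Omega> a b l p (d_const \<Omega> a b l p) \<inter> N_plus \<Omega> a b l p"

definition W_minus :: "pt set \<Rightarrow> real \<Rightarrow> real \<Rightarrow> real \<Rightarrow> real \<Rightarrow> (pt \<Rightarrow> real) set" where
  "W_minus \<Omega> a b l p = J_sublevel \<Omega> a b l p (d_const \<Omega> a b l p) \<inter> N_minus \<Omega> a b l p"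

definition L_plus :: "pt set \<Rightarrow> real \<Rightarrow> real \<Rightarrow> (pt \<Rightarrow> real) set" where
  "L_plus \<Omega> b l = {u \<in> H01 \<Omega>. b * (Lnorm 2 \<Omega> (grad \<Omega> u))\<^sup>2 - l * (Lnorm 2 \<Omega> u)\<^sup>2 > 0}"

definition L_zero :: "pt set \<Rightarrow> real \<Rightarrow> real \<Rightarrow> (pt \<Rightarrow> real) set" where
  "L_zero \<Omega> b l = {u \<in> H01 \<Omega>. b * (Lnorm 2 \<Omega> (grad \<Omega> u))\<^sup>2 - l * (Lnorm 2 \<Omega> u)\<^sup>2 = 0}"

definition L_minus :: "pt set \<Rightarrow> real \<Rightarrow> real \<Rightarrow> (pt \<Rightarrow> real) set" where
  "L_minus \<Omega> b l = {u \<in> H01 \<Omega>. b * (Lnorm 2 \<Omega> (grad \<Omega> u))\<^sup>2 - l * (Lnorm 2 \<Omega> u)\<^sup>2 < 0}"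

definition S_set :: "pt set \<Rightarrow> real \<Rightarrow> (pt \<Rightarrow> real) set" where
  "S_set \<Omega> a = {u \<in> H01 \<Omega>. (Lnorm 4 \<Omega> u) ^ 4 - a * (Lnorm 2 \<Omega> (grad \<Omega> u)) ^ 4 > 0}"

definition sigma_coeff :: "pt set \<Rightarrow> real \<Rightarrow> real \<Rightarrow> real \<Rightarrow> (pt \<Rightarrow> real) \<Rightarrow> real" where
  "sigma_coeff \<Omega> a b l u =
     sqrt ((b * (Lnorm 2 \<Omega> (grad \<Omega> u))\<^sup>2 - l * (Lnorm 2 \<Omega> u)\<^sup>2) /
           ((Lnorm 4 \<Omega> u) ^ 4 - a * (Lnorm 2 \<Omega> (grad \<Omega> u)) ^ 4))"

definition rescale :: "real \<Rightarrow> (pt \<Rightarrow> real) \<Rightarrow> pt \<Rightarrow> real" where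
  "rescale t u = (\<lambda>x. t * u x)"

(* bdd_above makes the real-valued SUP a genuine supremum. *)
definition fibering_max ::
  "pt set \<Rightarrow> real \<Rightarrow> real \<Rightarrow> real \<Rightarrow> real \<Rightarrow> (pt \<Rightarrow> real) \<Rightarrow> real \<Rightarrow> bool" where
  "fibering_max \<Omega> a b l p u s \<longleftrightarrow> 0 < s \<and>
     rescale s u \<in> N_set \<Omega> a b l p \<and>
     bdd_above ((\<lambda>t. J_fun \<Omega> a b l p (rescale t u)) ` {0<..}) \<and>
     J_fun \<Omega> a b l p (rescale s u) = (SUP t\<in>{0<..}. J_fun \<Omega> a b l p (rescale t u)) \<and>
     (\<forall>t. 0 < t \<and> t < s \<longrightarrow> rescale t u \<in> N_plus \<Omega> a b l p) \<and>
     (\<forall>t>s. rescale t u \<in> N_minus \<Omega> a b l p)"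

(* The formula defining sigma_coeff is used for u in L_minus, where it is meaningful only if its
   denominator does not vanish.  The first condition forces the denominator to be <= 0 on
   L_minus but does not exclude zeros: at a strict local, non-global maximum u of
   |u|_4^4 / |grad u|_2^4 with maximal value a the denominator vanishes although u is not in the
   closure of S.  Hence the second condition. *)
definition delta_admissible :: "pt set \<Rightarrow> real \<Rightarrow> real \<Rightarrow> real \<Rightarrow> bool" where
  "delta_admissible \<Omega> a b \<delta> \<longleftrightarrow> 0 < \<delta> \<and>
     (\<forall>l. b * principal_eigenvalue \<Omega> < l \<and> l < b * principal_eigenvalue \<Omega> + \<delta> \<longrightarrow>
        H1_closure \<Omega> (L_minus \<Omega> b l) \<inter> H1_closure \<Omega> (S_set \<Omega> a) = zero_H01 \<Omega> \<and>
        (\<forall>u\<in>L_minus \<Omega> b l. (Lnorm 4 \<Omega> u) ^ 4 - a * (Lnorm 2 \<Omega> (grad \<Omega> u)) ^ 4 \<noteq> 0))"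

end

theory Submission
  imports Defs "HOL-Complex_Analysis.Great_Picard" "HOL-Computational_Algebra.Polynomial"
begin

text \<open>Along a ray \<open>t \<mapsto> t u\<close> the functional \<open>I\<close> is explicit: for \<open>p = 3\<close> it equals
  \<open>t\<^sup>2 D(u) (\<sigma>\<^sub>u\<^sup>2 - t\<^sup>2)\<close> with \<open>D(u) = \<parallel>u\<parallel>\<^sub>4\<^sup>4 - a \<parallel>\<nabla>u\<parallel>\<^sub>2\<^sup>4\<close>, and for \<open>p > 3\<close> it is \<open>t\<^sup>4\<close> times a
  strictly decreasing function of \<open>t\<close>; since \<open>I(t u)\<close> is \<open>t\<close> times the derivative of \<open>J(t u)\<close> in \<open>t\<close>, the fibering statements follow from the sign
  of the quadratic form \<open>b \<parallel>\<nabla>u\<parallel>\<^sub>2\<^sup>2 - \<lambda> \<parallel>u\<parallel>\<^sub>2\<^sup>2\<close>. That sign is governed by \<open>\<lambda>\<^sub>1\<close>, which is the minimum of the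
  Rayleigh quotient by Rellich's theorem, and the lower bounds for \<open>J\<close> use the definition of \<open>\<Lambda>\<close> or the Sobolev inequality.
  For \<open>\<lambda> > b \<lambda>\<^sub>1\<close>, an element of \<open>L\<^sup>0\<close> or \<open>L\<^sup>-\<close> lies in the cone \<open>L\<^sup>-\<close> of a slightly larger
  admissible \<open>\<lambda>\<close>, where \<open>D < 0\<close>; by compactness \<open>D(u) \<le> - c \<parallel>\<nabla>u\<parallel>\<^sub>2\<^sup>4\<close> there, which bounds
  \<open>\<parallel>\<nabla>u\<parallel>\<^sub>2\<close> and hence \<open>J\<close> from below on \<open>N \<inter> L\<^sup>-\<close>.\<close>

subsection \<open>Square-integrable functions\<close>

text \<open>The analytic estimates are proved for test functions, where the gradient is classical
  and integrals can be taken over the whole space, and pass to \<open>H01\<close> by density, with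
  Fatou's lemma where the limit is not yet known to be integrable. The Sobolev inequality comes from
  an endpoint inequality for \<phi>^4, which itself combines three one-dimensional bounds by the
  Loomis-Whitney inequality. Compactness is quantitative: with bounded gradient, a function is
  determined up to a small L2 error by finitely many averages over grid cells. The delicate point
  for \<lambda> > b \<lambda>_1 is that \<open>L_minus\<close> is defined by a strict inequality, so
  limits of normalized sequences may leave it. Raising \<lambda> restores strictness, and the
  condition on \<delta>, imposed on a whole open interval of \<lambda>, leaves room for that. For p
  > 3 the value \<lambda> = b \<lambda>_1 is allowed, where the quadratic form is nonnegative but no
  longer coercive; positivity of d_p then comes from the quartic term.\<close>

lemma Lnorm_nonneg: "0 \<le> Lnorm q \<Omega> f"
  by (simp add: Lnorm_def)

lemma Lnorm_scaleR:
  assumes "0 < q"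
  shows "Lnorm q \<Omega> (\<lambda>x. c *\<^sub>R f x) = \<bar>c\<bar> * Lnorm q \<Omega> f"
proof -
  have "(LINT x|lebesgue_on \<Omega>. norm (c *\<^sub>R f x) powr q) = \<bar>c\<bar> powr q * (LINT x|lebesgue_on \<Omega>. norm (f x) powr q)"
    by (simp add: powr_mult)
  then show ?thesis
    using assms by (simp add: Lnorm_def powr_mult powr_powr)
qed

lemma Lnorm_powr:
  assumes "0 < q"
  shows "Lnorm q \<Omega> f powr q = (LINT x|lebesgue_on \<Omega>. norm (f x) powr q)"
  using assms by (simp add: Lnorm_def powr_powr)

lemma Lnorm_2: "Lnorm 2 \<Omega> f = sqrt (LINT x|lebesgue_on \<Omega>. (norm (f x))\<^sup>2)"
  by (simp add: Lnorm_def powr_half_sqrt)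

lemma Lnorm_2_sq: "(Lnorm 2 \<Omega> f)\<^sup>2 = (LINT x|lebesgue_on \<Omega>. (norm (f x))\<^sup>2)"
  by (simp add: Lnorm_2)

lemma Lnorm_4_pow: "(Lnorm 4 \<Omega> f) ^ 4 = (LINT x|lebesgue_on \<Omega>. (norm (f x)) ^ 4)"
  using Lnorm_powr[of 4 \<Omega> f] by (simp add: Lnorm_nonneg)

lemma Lnorm_cong_AE:
  assumes "AE x in lebesgue_on \<Omega>. f x = g x"
    "f \<in> borel_measurable (lebesgue_on \<Omega>)" "g \<in> borel_measurable (lebesgue_on \<Omega>)"
  shows "Lnorm q \<Omega> f = Lnorm q \<Omega> g"
proof -
  have "(LINT x|lebesgue_on \<Omega>. norm (f x) powr q) = (LINT x|lebesgue_on \<Omega>. norm (g x) powr q)"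
    using assms by (intro integral_cong_AE) auto
  then show ?thesis by (simp add: Lnorm_def)
qed

lemma L2_onD:
  assumes "L2_on \<Omega> f"
  shows "f \<in> borel_measurable (lebesgue_on \<Omega>)" "integrable (lebesgue_on \<Omega>) (\<lambda>x. (norm (f x))\<^sup>2)"
  using assms by (auto simp: L2_on_def)

lemma L2_on_integrable_inner:
  assumes "L2_on \<Omega> f" "L2_on \<Omega> g"
  shows "integrable (lebesgue_on \<Omega>) (\<lambda>x. f x \<bullet> g x)"
proof (rule Bochner_Integration.integrable_bound)
  show "integrable (lebesgue_on \<Omega>) (\<lambda>x. (norm (f x))\<^sup>2 + (norm (g x))\<^sup>2)"
    using assms by (intro Bochner_Integration.integrable_add L2_onD)
  show "(\<lambda>x. f x \<bullet> g x) \<in> borel_measurable (lebesgue_on \<Omega>)"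
    using assms by (intro borel_measurable_inner L2_onD)
  have "\<bar>f x \<bullet> g x\<bar> \<le> (norm (f x))\<^sup>2 + (norm (g x))\<^sup>2" for x
  proof -
    have "\<bar>f x \<bullet> g x\<bar> \<le> norm (f x) * norm (g x)" by (rule Cauchy_Schwarz_ineq2)
    moreover have "2 * norm (f x) * norm (g x) \<le> (norm (f x))\<^sup>2 + (norm (g x))\<^sup>2"
      by (rule sum_squares_bound)
    moreover have "0 \<le> norm (f x) * norm (g x)" by simp
    ultimately show ?thesis by linarith
  qed
  then show "AE x in lebesgue_on \<Omega>. norm (f x \<bullet> g x) \<le> norm ((norm (f x))\<^sup>2 + (norm (g x))\<^sup>2)"
    by simp
qed

lemma L2_on_scaleR:
  assumes "L2_on \<Omega> f"
  shows "L2_on \<Omega> (\<lambda>x. c *\<^sub>R f x)"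
  using L2_onD[OF assms] by (auto simp: L2_on_def power_mult_distrib)

lemma L2_on_add:
  assumes "L2_on \<Omega> f" "L2_on \<Omega> g"
  shows "L2_on \<Omega> (\<lambda>x. f x + g x)"
proof -
  have "integrable (lebesgue_on \<Omega>) (\<lambda>x. (norm (f x))\<^sup>2 + 2 * (f x \<bullet> g x) + (norm (g x))\<^sup>2)"
    by (intro Bochner_Integration.integrable_add integrable_mult_right L2_onD(2)
        L2_on_integrable_inner assms)
  moreover have "(norm (f x + g x))\<^sup>2 = (norm (f x))\<^sup>2 + 2 * (f x \<bullet> g x) + (norm (g x))\<^sup>2" for x
    by (simp add: power2_norm_eq_inner inner_simps inner_commute)
  ultimately show ?thesis
    using assms by (auto simp: L2_on_def)
qed

lemma L2_on_diff:
  assumes "L2_on \<Omega> f" "L2_on \<Omega> g"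
  shows "L2_on \<Omega> (\<lambda>x. f x - g x)"
  using L2_on_add[OF assms(1) L2_on_scaleR[OF assms(2), of "-1"]] by simp

text \<open>As a polynomial in \<open>c\<close> this identity yields Cauchy-Schwarz, the
  parallelogram laws and the first variation of the Rayleigh quotient.\<close>

lemma L2_on_integral_add_scaled:
  assumes "L2_on \<Omega> f" "L2_on \<Omega> g"
  shows "(Lnorm 2 \<Omega> (\<lambda>x. f x + c *\<^sub>R g x))\<^sup>2 =
    (Lnorm 2 \<Omega> f)\<^sup>2 + 2 * c * (LINT x|lebesgue_on \<Omega>. f x \<bullet> g x) + c\<^sup>2 * (Lnorm 2 \<Omega> g)\<^sup>2"
proof -
  have "(norm (f x + c *\<^sub>R g x))\<^sup>2 = (norm (f x))\<^sup>2 + 2 * c * (f x \<bullet> g x) + c\<^sup>2 * (norm (g x))\<^sup>2" for x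
    by (simp add: power2_norm_eq_inner inner_simps inner_commute power2_eq_square[of c] algebra_simps)
  then show ?thesis
    using assms L2_on_integrable_inner[OF assms] by (simp add: Lnorm_2_sq L2_onD)
qed

text \<open>The quadratic polynomial above is nonnegative for every \<open>c\<close>. If
  \<open>?G\<close> is nonzero, it is evaluated at its minimum \<open>- ?P / ?G\<close>; if
  \<open>?G = 0\<close> it is affine in \<open>c\<close>, and a nonzero slope would let it reach
  -1.\<close>

lemma L2_on_Cauchy_Schwarz:
  assumes "L2_on \<Omega> f" "L2_on \<Omega> g"
  shows "\<bar>LINT x|lebesgue_on \<Omega>. f x \<bullet> g x\<bar> \<le> Lnorm 2 \<Omega> f * Lnorm 2 \<Omega> g"
proof -
  let ?P = "LINT x|lebesgue_on \<Omega>. f x \<bullet> g x"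
  let ?F = "(Lnorm 2 \<Omega> f)\<^sup>2" and ?G = "(Lnorm 2 \<Omega> g)\<^sup>2"
  have ge: "0 \<le> ?F + 2 * c * ?P + c\<^sup>2 * ?G" for c
    using L2_on_integral_add_scaled[OF assms, of c] by (metis zero_le_power2)
  have "?P\<^sup>2 \<le> ?F * ?G"
  proof (cases "?G = 0")
    case True
    have "?P = 0"
    proof (rule ccontr)
      assume "?P \<noteq> 0"
      then have "?F + 2 * (- (?F + 1) / (2 * ?P)) * ?P = - 1" by (simp add: field_simps)
      then show False using ge[of "- (?F + 1) / (2 * ?P)"] unfolding True by linarith
    qed
    then show ?thesis using True by simp
  next
    case False
    then have "0 < ?G" by (simp add: less_le)
    moreover have "0 \<le> ?F + 2 * (- ?P / ?G) * ?P + (- ?P / ?G)\<^sup>2 * ?G" by (rule ge)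
    moreover have "?F + 2 * (- ?P / ?G) * ?P + (- ?P / ?G)\<^sup>2 * ?G = ?F - ?P\<^sup>2 / ?G"
      using False by (simp add: power2_eq_square divide_simps)
    ultimately show ?thesis by (simp add: field_simps)
  qed
  then have "?P\<^sup>2 \<le> (Lnorm 2 \<Omega> f * Lnorm 2 \<Omega> g)\<^sup>2"
    by (simp add: power_mult_distrib)
  then show ?thesis
    by (rule power2_le_imp_le[of "\<bar>?P\<bar>", simplified]) (simp add: Lnorm_nonneg)
qed

lemma Lnorm_2_triangle:
  assumes "L2_on \<Omega> f" "L2_on \<Omega> g"
  shows "Lnorm 2 \<Omega> (\<lambda>x. f x + g x) \<le> Lnorm 2 \<Omega> f + Lnorm 2 \<Omega> g"
proof (rule power2_le_imp_le)
  have "(LINT x|lebesgue_on \<Omega>. f x \<bullet> g x) \<le> Lnorm 2 \<Omega> f * Lnorm 2 \<Omega> g"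
    using L2_on_Cauchy_Schwarz[OF assms] by linarith
  then show "(Lnorm 2 \<Omega> (\<lambda>x. f x + g x))\<^sup>2 \<le> (Lnorm 2 \<Omega> f + Lnorm 2 \<Omega> g)\<^sup>2"
    using L2_on_integral_add_scaled[OF assms, of 1] by (simp add: power2_eq_square algebra_simps)
qed (simp add: Lnorm_nonneg)

lemma Lnorm_2_minus: "Lnorm 2 \<Omega> (\<lambda>x. f x - g x) = Lnorm 2 \<Omega> (\<lambda>x. g x - f x)"
  by (simp add: Lnorm_2 norm_minus_commute)

lemma Lnorm_2_triangle_diff:
  assumes "L2_on \<Omega> f" "L2_on \<Omega> g" "L2_on \<Omega> h"
  shows "Lnorm 2 \<Omega> (\<lambda>x. f x - h x) \<le> Lnorm 2 \<Omega> (\<lambda>x. f x - g x) + Lnorm 2 \<Omega> (\<lambda>x. g x - h x)"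
  using Lnorm_2_triangle[OF L2_on_diff[OF assms(1,2)] L2_on_diff[OF assms(2,3)]] by simp

lemma Lnorm_2_diff_le:
  assumes "L2_on \<Omega> f" "L2_on \<Omega> g"
  shows "\<bar>Lnorm 2 \<Omega> f - Lnorm 2 \<Omega> g\<bar> \<le> Lnorm 2 \<Omega> (\<lambda>x. f x - g x)"
  using Lnorm_2_triangle[OF L2_on_diff[OF assms] assms(2)]
    Lnorm_2_triangle[OF L2_on_diff[OF assms(2,1)] assms(1)] Lnorm_2_minus[of \<Omega> f g]
  by simp

lemma Lnorm_2_eq_0_iff:
  assumes "L2_on \<Omega> f"
  shows "Lnorm 2 \<Omega> f = 0 \<longleftrightarrow> (AE x in lebesgue_on \<Omega>. f x = 0)"
  using integral_nonneg_eq_0_iff_AE[OF L2_onD(2)[OF assms]] by (simp add: Lnorm_2)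

lemma nn_integral_eq_Lnorm_2:
  assumes "L2_on \<Omega> f"
  shows "(\<integral>\<^sup>+x. ennreal ((norm (f x))\<^sup>2) \<partial>lebesgue_on \<Omega>) = ennreal ((Lnorm 2 \<Omega> f)\<^sup>2)"
  unfolding Lnorm_2_sq by (intro nn_integral_eq_integral L2_onD assms) simp

text \<open>Fatou's lemma in the form used for limits whose integrability is still to be shown:
  everything stays in \<open>ennreal\<close>, and a bound from some index on is enough.\<close>

lemma nn_integral_Fatou_bound:
  fixes F :: "nat \<Rightarrow> 'a \<Rightarrow> real"
  assumes "\<And>n. F n \<in> borel_measurable M" "AE x in M. (\<lambda>n. F n x) \<longlonglongrightarrow> f x"
    "\<And>n. N \<le> n \<Longrightarrow> (\<integral>\<^sup>+x. ennreal (F n x) \<partial>M) \<le> C"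
  shows "(\<integral>\<^sup>+x. ennreal (f x) \<partial>M) \<le> C"
proof -
  have "(\<integral>\<^sup>+x. ennreal (f x) \<partial>M) = (\<integral>\<^sup>+x. liminf (\<lambda>n. ennreal (F n x)) \<partial>M)"
  proof (rule nn_integral_cong_AE)
    show "AE x in M. ennreal (f x) = liminf (\<lambda>n. ennreal (F n x))"
      using assms(2)
    proof eventually_elim
      case (elim x)
      then have "(\<lambda>n. ennreal (F n x)) \<longlonglongrightarrow> ennreal (f x)" by (intro tendsto_ennrealI)
      then show ?case by (simp add: lim_imp_Liminf)
    qed
  qed
  also have "\<dots> \<le> liminf (\<lambda>n. \<integral>\<^sup>+x. ennreal (F n x) \<partial>M)"
    by (rule nn_integral_liminf) (use assms(1) in measurable)
  also have "\<dots> \<le> liminf (\<lambda>n. C)"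
    by (rule Liminf_mono) (use assms(3) eventually_sequentially in blast)
  also have "\<dots> = C" by (simp add: Liminf_const)
  finally show ?thesis .
qed

text \<open>\<open>d\<close> is an arbitrary two-index array, so the lemma applies directly to L2
  distances of representatives, which form only a pseudometric.\<close>

lemma Cauchy_fast_subseq:
  fixes d :: "nat \<Rightarrow> nat \<Rightarrow> real"
  assumes "\<And>e. 0 < e \<Longrightarrow> \<exists>N. \<forall>m\<ge>N. \<forall>n\<ge>N. d m n < e"
  obtains r where "strict_mono r" "\<And>k. d (r (Suc k)) (r k) < (1/2) ^ k"
proof -
  have "\<exists>N. \<forall>m\<ge>N. \<forall>n\<ge>N. d m n < (1/2) ^ k" for k
    by (rule assms) simp
  then obtain N where N: "\<And>k m n. m \<ge> N k \<Longrightarrow> n \<ge> N k \<Longrightarrow> d m n < (1/2) ^ k"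
    by metis
  \<comment> \<open>Summing makes \<open>r\<close> strictly increasing and keeps
    \<open>N k \<le> r k\<close>, so both \<open>r k\<close> and \<open>r (Suc k)\<close> are beyond
    \<open>N k\<close>.\<close>
  define r where "r k = (\<Sum>i\<le>k. Suc (N i))" for k
  have "strict_mono r" by (rule strict_mono_Suc_iff[THEN iffD2]) (simp add: r_def)
  moreover have "N k \<le> r k" for k
    unfolding r_def by (rule order_trans[OF _ member_le_sum[of k]]) auto
  moreover have "r k \<le> r (Suc k)" for k by (simp add: r_def)
  ultimately show thesis
    by (intro that[of r] N) (auto intro: order_trans)
qed

text \<open>Cauchy-Schwarz against the constant 1, which is square-integrable because the measure of
  \<Omega> is finite.\<close>

lemma integral_norm_le_Lnorm_2:
  assumes "L2_on \<Omega> f" "\<Omega> \<in> lmeasurable"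
  shows "integrable (lebesgue_on \<Omega>) f"
    "(LINT x|lebesgue_on \<Omega>. norm (f x)) \<le> sqrt (measure lebesgue \<Omega>) * Lnorm 2 \<Omega> f"
proof -
  have 1: "L2_on \<Omega> (\<lambda>x. 1::real)"
    using assms(2) by (auto simp: L2_on_def integrable_restrict_space fmeasurable_def)
  have 2: "L2_on \<Omega> (\<lambda>x. norm (f x))"
    using L2_onD[OF assms(1)] by (auto simp: L2_on_def)
  have "integrable (lebesgue_on \<Omega>) (\<lambda>x. norm (f x))"
    using L2_on_integrable_inner[OF 2 1] by simp
  then show "integrable (lebesgue_on \<Omega>) f"
    using L2_onD(1)[OF assms(1)] integrable_norm_iff by blast
  have [simp]: "Lnorm 2 \<Omega> (\<lambda>x. 1::real) = sqrt (measure lebesgue \<Omega>)"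
    using assms(2) by (simp add: Lnorm_2 measure_restrict_space)
  have [simp]: "Lnorm 2 \<Omega> (\<lambda>x. norm (f x)) = Lnorm 2 \<Omega> f" by (simp add: Lnorm_2)
  show "(LINT x|lebesgue_on \<Omega>. norm (f x)) \<le> sqrt (measure lebesgue \<Omega>) * Lnorm 2 \<Omega> f"
    using L2_on_Cauchy_Schwarz[OF 2 1] by (simp add: mult.commute)
qed

text \<open>On a domain of finite measure the geometric L2 bounds give geometric bounds on the L1
  norms of the increments. Their sum is therefore integrable, hence finite almost everywhere, and
  the telescoping series converges there.\<close>

lemma AE_convergent_of_fast_Cauchy:
  fixes f :: "nat \<Rightarrow> pt \<Rightarrow> 'b::euclidean_space"
  assumes f: "\<And>n. L2_on \<Omega> (f n)" and \<Omega>: "\<Omega> \<in> lmeasurable"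
    and fast: "\<And>k. Lnorm 2 \<Omega> (\<lambda>x. f (Suc k) x - f k x) \<le> (1/2) ^ k"
  shows "AE x in lebesgue_on \<Omega>. convergent (\<lambda>k. f k x)"
proof -
  let ?M = "lebesgue_on \<Omega>"
  have [measurable]: "\<And>n. f n \<in> borel_measurable ?M" using f by (auto dest: L2_onD)
  have "(\<integral>\<^sup>+x. (\<Sum>k. ennreal (norm (f (Suc k) x - f k x))) \<partial>?M) =
    (\<Sum>k. \<integral>\<^sup>+x. ennreal (norm (f (Suc k) x - f k x)) \<partial>?M)"
    by (rule nn_integral_suminf) measurable
  also have "\<dots> \<le> (\<Sum>k. ennreal (sqrt (measure lebesgue \<Omega>) * (1/2) ^ k))"
  proof (intro suminf_le)
    fix k
    have d: "L2_on \<Omega> (\<lambda>x. f (Suc k) x - f k x)" by (intro L2_on_diff f)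
    have "(\<integral>\<^sup>+x. ennreal (norm (f (Suc k) x - f k x)) \<partial>?M) = ennreal (LINT x|?M. norm (f (Suc k) x - f k x))"
      using integral_norm_le_Lnorm_2(1)[OF d \<Omega>] by (intro nn_integral_eq_integral) auto
    also have "\<dots> \<le> ennreal (sqrt (measure lebesgue \<Omega>) * (1/2) ^ k)"
      by (intro ennreal_leI order_trans[OF integral_norm_le_Lnorm_2(2)[OF d \<Omega>]] mult_left_mono fast) simp
    finally show "(\<integral>\<^sup>+x. ennreal (norm (f (Suc k) x - f k x)) \<partial>?M) \<le> ennreal (sqrt (measure lebesgue \<Omega>) * (1/2) ^ k)" .
  qed auto
  also have "\<dots> = ennreal (\<Sum>k. sqrt (measure lebesgue \<Omega>) * (1/2) ^ k)"
    by (intro suminf_ennreal2) (auto intro!: summable_mult summable_geometric)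
  finally have "(\<integral>\<^sup>+x. (\<Sum>k. ennreal (norm (f (Suc k) x - f k x))) \<partial>?M) \<noteq> \<infinity>"
    by (auto simp: top_unique)
  then have "AE x in ?M. (\<Sum>k. ennreal (norm (f (Suc k) x - f k x))) \<noteq> \<infinity>"
    by (intro nn_integral_PInf_AE) measurable
  then show ?thesis
  proof eventually_elim
    case (elim x)
    have "summable (\<lambda>k. norm (f (Suc k) x - f k x))"
      by (rule summable_suminf_not_top) (use elim in auto)
    then have "summable (\<lambda>k. f (Suc k) x - f k x)" by (rule summable_norm_cancel)
    then have "convergent (\<lambda>n. \<Sum>k<n. f (Suc k) x - f k x)"
      by (simp add: summable_iff_convergent)
    then have "convergent (\<lambda>n. f n x - f 0 x)"
      using sum_lessThan_telescope[of "\<lambda>n. f n x"] by simp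
    then have "convergent (\<lambda>n. (f n x - f 0 x) + f 0 x)"
      by (intro convergent_add convergent_const)
    then show ?case by simp
  qed
qed

text \<open>Riesz-Fischer: \<open>g\<close> is the pointwise limit of a fast subsequence, and Fatou
  carries the Cauchy bounds over to \<open>f n - g\<close> for the full sequence. The almost
  everywhere convergent subsequence is part of the conclusion because the Sobolev inequality is
  later extended by Fatou.\<close>

lemma L2_complete:
  fixes f :: "nat \<Rightarrow> pt \<Rightarrow> 'b::euclidean_space"
  assumes f: "\<And>n. L2_on \<Omega> (f n)" and \<Omega>: "\<Omega> \<in> lmeasurable"
    and Cauchy: "\<And>e. 0 < e \<Longrightarrow> \<exists>N. \<forall>m\<ge>N. \<forall>n\<ge>N. Lnorm 2 \<Omega> (\<lambda>x. f m x - f n x) < e"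
  obtains g r where "L2_on \<Omega> g" "(\<lambda>n. Lnorm 2 \<Omega> (\<lambda>x. f n x - g x)) \<longlonglongrightarrow> 0"
    "strict_mono r" "AE x in lebesgue_on \<Omega>. (\<lambda>k. f (r k) x) \<longlonglongrightarrow> g x"
proof -
  let ?M = "lebesgue_on \<Omega>"
  have [measurable]: "\<And>n. f n \<in> borel_measurable ?M" using f by (auto dest: L2_onD)
  obtain r where r: "strict_mono r" and fast: "\<And>k. Lnorm 2 \<Omega> (\<lambda>x. f (r (Suc k)) x - f (r k) x) < (1/2) ^ k"
    by (rule Cauchy_fast_subseq[OF Cauchy]) auto
  define g where "g x = lim (\<lambda>k. f (r k) x)" for x
  have [measurable]: "g \<in> borel_measurable ?M" unfolding g_def by measurable
  have AE: "AE x in ?M. (\<lambda>k. f (r k) x) \<longlonglongrightarrow> g x"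
    using AE_convergent_of_fast_Cauchy[of \<Omega> "\<lambda>k. f (r k)", OF f \<Omega> less_imp_le[OF fast]]
    by eventually_elim (simp add: g_def convergent_LIMSEQ_iff)
  have key: "\<exists>N. \<forall>n\<ge>N. (\<integral>\<^sup>+x. ennreal ((norm (f n x - g x))\<^sup>2) \<partial>?M) \<le> ennreal (e\<^sup>2)" if e: "0 < e" for e
  proof -
    obtain N where N: "\<And>m n. m \<ge> N \<Longrightarrow> n \<ge> N \<Longrightarrow> Lnorm 2 \<Omega> (\<lambda>x. f m x - f n x) < e"
      using Cauchy[OF e] by blast
    have "(\<integral>\<^sup>+x. ennreal ((norm (f n x - g x))\<^sup>2) \<partial>?M) \<le> ennreal (e\<^sup>2)" if n: "n \<ge> N" for n
    proof (rule nn_integral_Fatou_bound[where N=N and F="\<lambda>k x. (norm (f n x - f (r k) x))\<^sup>2"])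
      show "AE x in ?M. (\<lambda>k. (norm (f n x - f (r k) x))\<^sup>2) \<longlonglongrightarrow> (norm (f n x - g x))\<^sup>2"
        using AE by eventually_elim (intro tendsto_intros)
      fix k assume "N \<le> k"
      then have "N \<le> r k" using seq_suble[OF r, of k] by linarith
      then have "Lnorm 2 \<Omega> (\<lambda>x. f n x - f (r k) x) \<le> e" using N[OF n, of "r k"] by simp
      then show "(\<integral>\<^sup>+x. ennreal ((norm (f n x - f (r k) x))\<^sup>2) \<partial>?M) \<le> ennreal (e\<^sup>2)"
        by (subst nn_integral_eq_Lnorm_2[OF L2_on_diff[OF f f]])
          (intro ennreal_leI power_mono Lnorm_nonneg)
    qed measurable
    then show ?thesis by blast
  qed
  have L2: "L2_on \<Omega> (\<lambda>x. f n x - g x)" if "(\<integral>\<^sup>+x. ennreal ((norm (f n x - g x))\<^sup>2) \<partial>?M) \<le> ennreal (e\<^sup>2)" for n e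
    unfolding L2_on_def
  proof (intro conjI)
    show "integrable ?M (\<lambda>x. (norm (f n x - g x))\<^sup>2)"
      by (rule integrableI_nonneg) (use that le_less_trans in fastforce)+
  qed measurable
  obtain N where "(\<integral>\<^sup>+x. ennreal ((norm (f N x - g x))\<^sup>2) \<partial>?M) \<le> ennreal (1\<^sup>2)"
    using key[of 1] by auto
  from L2_on_diff[OF f L2[OF this], of N] have g: "L2_on \<Omega> g" by simp
  have "(\<lambda>n. Lnorm 2 \<Omega> (\<lambda>x. f n x - g x)) \<longlonglongrightarrow> 0"
  proof (rule LIMSEQ_I)
    fix e :: real assume "0 < e"
    then obtain N where N: "\<And>n. n \<ge> N \<Longrightarrow> (\<integral>\<^sup>+x. ennreal ((norm (f n x - g x))\<^sup>2) \<partial>?M) \<le> ennreal ((e/2)\<^sup>2)"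
      using key[of "e/2"] by auto
    have "norm (Lnorm 2 \<Omega> (\<lambda>x. f n x - g x) - 0) < e" if "n \<ge> N" for n
    proof -
      have "(Lnorm 2 \<Omega> (\<lambda>x. f n x - g x))\<^sup>2 \<le> (e/2)\<^sup>2"
        using N[OF that] by (subst (asm) nn_integral_eq_Lnorm_2[OF L2_on_diff[OF f g]]) simp
      then have "Lnorm 2 \<Omega> (\<lambda>x. f n x - g x) \<le> e/2"
        by (rule power2_le_imp_le) (use \<open>0 < e\<close> in simp)
      then show ?thesis using \<open>0 < e\<close> Lnorm_nonneg[of 2 \<Omega> "\<lambda>x. f n x - g x"] by simp
    qed
    then show "\<exists>no. \<forall>n\<ge>no. norm (Lnorm 2 \<Omega> (\<lambda>x. f n x - g x) - 0) < e" by blast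
  qed
  then show thesis by (intro that[OF g _ r AE])
qed

subsection \<open>Smooth functions and test functions\<close>

lemma Ck_on_SucD: "Ck_on (Suc k) UNIV f \<Longrightarrow> Ck_on k UNIV f"
proof (induction k arbitrary: f)
  case 0
  then show ?case by (simp add: differentiable_imp_continuous_on)
next
  case (Suc k)
  then show ?case by (metis Ck_on.simps(2))
qed

lemma differentiable_has_frechet_derivative:
  "f differentiable_on UNIV \<Longrightarrow> (f has_derivative frechet_derivative f (at x)) (at x)"
  using frechet_derivative_works by (auto simp: differentiable_on_def)

lemma Ck_on_derivI:
  assumes "\<And>x. (f has_derivative f' x) (at x)" "\<And>v. Ck_on k UNIV (\<lambda>x. f' x v)"
  shows "Ck_on (Suc k) UNIV f"
proof -
  have "frechet_derivative f (at x) = f' x" for x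
    using frechet_derivative_at[OF assms(1)] by simp
  then show ?thesis
    using assms by (auto simp: differentiable_on_def differentiable_def)
qed

lemma Ck_on_add: "Ck_on k UNIV f \<Longrightarrow> Ck_on k UNIV g \<Longrightarrow> Ck_on k UNIV (\<lambda>x. f x + g x)"
proof (induction k arbitrary: f g)
  case 0
  then show ?case by (simp add: continuous_on_add)
next
  case (Suc k)
  show ?case
    by (rule Ck_on_derivI[OF has_derivative_add[OF differentiable_has_frechet_derivative
            differentiable_has_frechet_derivative]])
      (use Suc in auto)
qed

lemma Ck_on_const: "Ck_on k UNIV (\<lambda>x. c)"
proof (induction k arbitrary: c)
  case (Suc k)
  show ?case by (rule Ck_on_derivI[OF has_derivative_const]) (rule Suc)
qed simp

lemma Ck_on_mult: "Ck_on k UNIV f \<Longrightarrow> Ck_on k UNIV g \<Longrightarrow> Ck_on k UNIV (\<lambda>x. f x * g x)"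
proof (induction k arbitrary: f g)
  case 0
  then show ?case by (simp add: continuous_on_mult)
next
  case (Suc k)
  show ?case
  proof (rule Ck_on_derivI[OF has_derivative_mult[OF differentiable_has_frechet_derivative
            differentiable_has_frechet_derivative]])
    fix v
    show "Ck_on k UNIV (\<lambda>x. f x * frechet_derivative g (at x) v + frechet_derivative f (at x) v * g x)"
      using Suc Ck_on_SucD by (intro Ck_on_add Suc.IH) auto
  qed (use Suc in auto)
qed

lemma smooth_on_add: "smooth_on UNIV f \<Longrightarrow> smooth_on UNIV g \<Longrightarrow> smooth_on UNIV (\<lambda>x. f x + g x)"
  by (simp add: smooth_on_def Ck_on_add)

lemma smooth_on_mult: "smooth_on UNIV f \<Longrightarrow> smooth_on UNIV g \<Longrightarrow> smooth_on UNIV (\<lambda>x. f x * g x)"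
  by (simp add: smooth_on_def Ck_on_mult)

lemma smooth_on_const: "smooth_on UNIV (\<lambda>x. c)"
  by (simp add: smooth_on_def Ck_on_const)

lemma smooth_on_prod:
  "finite I \<Longrightarrow> (\<And>i. i \<in> I \<Longrightarrow> smooth_on UNIV (f i)) \<Longrightarrow> smooth_on UNIV (\<lambda>x. \<Prod>i\<in>I. f i x)"
  by (induction I rule: finite_induct) (auto simp: smooth_on_const intro: smooth_on_mult)

text \<open>Since the family \<open>F\<close> is closed under directional derivatives, the induction
  on \<open>k\<close> runs for all its members at once.\<close>

lemma smooth_on_of_derivative_closed:
  assumes "\<And>f. f \<in> F \<Longrightarrow> \<exists>f'. (\<forall>x. (f has_derivative f' x) (at x)) \<and> (\<forall>v. (\<lambda>x. f' x v) \<in> F)"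
    and "f \<in> F"
  shows "smooth_on UNIV f"
proof -
  have "\<forall>f\<in>F. Ck_on k UNIV f" for k
  proof (induction k)
    case 0
    show ?case
    proof
      fix f assume "f \<in> F"
      then obtain f' where "\<forall>x. (f has_derivative f' x) (at x)" using assms(1) by blast
      then have "f differentiable_on UNIV"
        unfolding differentiable_on_def differentiable_def by blast
      then show "Ck_on 0 UNIV f" by (simp add: differentiable_imp_continuous_on)
    qed
  next
    case (Suc k)
    show ?case
    proof
      fix f assume "f \<in> F"
      then obtain f' where "\<forall>x. (f has_derivative f' x) (at x)" "\<forall>v. (\<lambda>x. f' x v) \<in> F"
        using assms(1) by blast
      then show "Ck_on (Suc k) UNIV f" using Suc by (intro Ck_on_derivI[of f f']) auto
    qed
  qed
  then show ?thesis using assms(2) by (simp add: smooth_on_def)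
qed

section \<open>Smooth cutoff functions built from exp (- 1 / t)\<close>

definition flat_exp :: "real poly \<Rightarrow> real \<Rightarrow> real" where
  "flat_exp P t = (if 0 < t then poly P (1 / t) * exp (- (1 / t)) else 0)"

lemma tendsto_poly_times_exp_neg: "((\<lambda>s. poly P s * exp (- s)) \<longlongrightarrow> (0::real)) at_top"
proof -
  have "((\<lambda>s::real. \<Sum>i\<le>degree P. coeff P i * (s ^ i / exp s)) \<longlongrightarrow> (\<Sum>i\<le>degree P. coeff P i * 0)) at_top"
    by (intro tendsto_sum tendsto_mult tendsto_const tendsto_power_div_exp_0)
  then show ?thesis
    by (simp add: poly_altdef exp_minus field_simps sum_distrib_left sum_divide_distrib)
qed

lemma flat_exp_tendsto_0: "(flat_exp P \<longlongrightarrow> 0) (at_right 0)"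
proof -
  have "((\<lambda>t. poly P (inverse t) * exp (- inverse t)) \<longlongrightarrow> 0) (at_right 0)"
    by (rule filterlim_compose[OF tendsto_poly_times_exp_neg filterlim_inverse_at_top_right])
  moreover have "eventually (\<lambda>t. poly P (inverse t) * exp (- inverse t) = flat_exp P t) (at_right 0)"
    unfolding eventually_at_right_field by (auto simp: flat_exp_def inverse_eq_divide intro!: exI[of _ 1])
  ultimately show ?thesis by (rule Lim_transform_eventually)
qed

text \<open>With s = 1 / t one has d/dt = - s^2 d/ds, which sends P(s) exp (- s) to s^2 (P - P')(s)
  exp (- s). Carrying a polynomial factor in \<open>flat_exp\<close> therefore makes the family
  closed under differentiation.\<close>

lemma flat_exp_DERIV:
  "(flat_exp P has_real_derivative flat_exp (monom 1 2 * (P - pderiv P)) t) (at t)"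
proof -
  consider "t < 0" | "t = 0" | "0 < t" by linarith
  then show ?thesis
  proof cases
    case 1
    have "((\<lambda>x. 0::real) has_real_derivative 0) (at t)" by simp
    then have "(flat_exp P has_real_derivative 0) (at t)"
      by (rule has_field_derivative_transform_within_open[of _ _ _ "{..<0}"])
        (use 1 in \<open>auto simp: flat_exp_def\<close>)
    then show ?thesis using 1 by (simp add: flat_exp_def)
  next
    case 2
    have "((\<lambda>y. flat_exp P y / y) \<longlongrightarrow> 0) (at_left 0)"
      by (rule tendsto_eventually)
        (auto simp: eventually_at_left_field flat_exp_def intro!: exI[of _ "-1"])
    moreover have "((\<lambda>y. flat_exp P y / y) \<longlongrightarrow> 0) (at_right 0)"
    \<comment> \<open>Dividing by y multiplies the polynomial by its variable 1 / y, that is, passes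
      to \<open>pCons 0 P\<close>; the difference quotient at 0 is again a flat function.\<close>
    proof (rule Lim_transform_eventually[OF flat_exp_tendsto_0[of "pCons 0 P"]])
      show "eventually (\<lambda>y. flat_exp (pCons 0 P) y = flat_exp P y / y) (at_right 0)"
        unfolding eventually_at_right_field by (auto simp: flat_exp_def intro!: exI[of _ 1])
    qed
    ultimately have "((\<lambda>y. flat_exp P y / y) \<longlongrightarrow> 0) (at 0)"
      by (rule filterlim_split_at)
    then show ?thesis using 2 by (simp add: has_field_derivative_iff flat_exp_def)
  next
    case 3
    have "((\<lambda>t. poly P (1 / t) * exp (- (1 / t))) has_real_derivative
        poly P (1 / t) * (exp (- (1 / t)) * (1 / t\<^sup>2)) + (poly (pderiv P) (1 / t) * (- 1 / t\<^sup>2)) * exp (- (1 / t))) (at t)"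
      using 3 by (auto intro!: derivative_eq_intros DERIV_chain2[OF poly_DERIV] simp: power2_eq_square field_simps)
    also have "poly P (1 / t) * (exp (- (1 / t)) * (1 / t\<^sup>2)) + (poly (pderiv P) (1 / t) * (- 1 / t\<^sup>2)) * exp (- (1 / t))
       = flat_exp (monom 1 2 * (P - pderiv P)) t"
      using 3 by (simp add: flat_exp_def poly_monom field_simps)
    finally show ?thesis
      by (rule has_field_derivative_transform_within_open[of _ _ _ "{0<..}"])
        (use 3 in \<open>auto simp: flat_exp_def\<close>)
  qed
qed

text \<open>The chain rule factor \<open>w \<bullet> v\<close> is constant and is absorbed into the
  polynomial, so the family indexed by \<open>P\<close>, \<open>w\<close> and \<open>c\<close> is
  closed under directional derivatives.\<close>

lemma smooth_on_flat_exp: "smooth_on UNIV (\<lambda>x. flat_exp P (w \<bullet> x + c))"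
proof (rule smooth_on_of_derivative_closed[where F="{\<lambda>x. flat_exp P (w \<bullet> x + c) | P w c. True}"])
  fix f :: "pt \<Rightarrow> real" assume "f \<in> {\<lambda>x. flat_exp P (w \<bullet> x + c) | P w c. True}"
  then obtain P w c where f: "f = (\<lambda>x. flat_exp P (w \<bullet> x + c))" by blast
  let ?Q = "monom 1 2 * (P - pderiv P)"
  show "\<exists>f'. (\<forall>x. (f has_derivative f' x) (at x)) \<and>
      (\<forall>v. (\<lambda>x. f' x v) \<in> {\<lambda>x. flat_exp P (w \<bullet> x + c) | P w c. True})"
  proof (intro exI[of _ "\<lambda>x v. flat_exp ?Q (w \<bullet> x + c) * (w \<bullet> v)"] conjI allI)
    fix x
    have "((\<lambda>x. w \<bullet> x + c) has_derivative (\<lambda>v. w \<bullet> v)) (at x)"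
      by (auto intro!: derivative_eq_intros)
    from has_derivative_compose[OF this flat_exp_DERIV[unfolded has_field_derivative_def]]
    show "(f has_derivative (\<lambda>v. flat_exp ?Q (w \<bullet> x + c) * (w \<bullet> v))) (at x)"
      unfolding f by simp
  next
    fix v
    have "(\<lambda>x. flat_exp ?Q (w \<bullet> x + c) * (w \<bullet> v)) = (\<lambda>x. flat_exp (smult (w \<bullet> v) ?Q) (w \<bullet> x + c))"
      by (auto simp: flat_exp_def)
    then show "(\<lambda>x. flat_exp ?Q (w \<bullet> x + c) * (w \<bullet> v)) \<in> {\<lambda>x. flat_exp P (w \<bullet> x + c) | P w c. True}"
      by blast
  qed
qed blast

text \<open>As \<open>n\<close> grows, these smooth functions increase to the indicator of the open box.\<close>

definition box_bump :: "pt \<Rightarrow> pt \<Rightarrow> nat \<Rightarrow> pt \<Rightarrow> real" where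
  "box_bump l u n x = (\<Prod>b\<in>Basis. flat_exp 1 (real (Suc n) * ((x - l) \<bullet> b)) * flat_exp 1 (real (Suc n) * ((u - x) \<bullet> b)))"

lemma flat_exp_1: "0 \<le> flat_exp 1 t" "flat_exp 1 t \<le> 1"
  by (auto simp: flat_exp_def)

lemma flat_exp_1_tendsto:
  assumes "0 < s" shows "(\<lambda>n. flat_exp 1 (real (Suc n) * s)) \<longlonglongrightarrow> 1"
proof -
  have "(\<lambda>n. exp (- (inverse s * inverse (real (Suc n))))) \<longlonglongrightarrow> exp (- (inverse s * 0))"
    by (intro tendsto_intros LIMSEQ_inverse_real_of_nat)
  moreover have "flat_exp 1 (N * s) = exp (- (inverse s * inverse N))" if "0 < N" for N
    using assms that by (simp add: flat_exp_def field_simps)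
  ultimately show ?thesis by simp
qed

lemma box_bump_bounds: "0 \<le> box_bump l u n x" "box_bump l u n x \<le> 1"
  unfolding box_bump_def
  by (auto intro!: prod_nonneg prod_le_1 mult_le_one simp: flat_exp_1)

lemma box_bump_pos_iff: "0 < box_bump l u n x \<longleftrightarrow> x \<in> box l u"
proof
  assume "0 < box_bump l u n x"
  then have nz: "\<forall>b\<in>Basis. flat_exp 1 (real (Suc n) * ((x - l) \<bullet> b)) \<noteq> 0 \<and> flat_exp 1 (real (Suc n) * ((u - x) \<bullet> b)) \<noteq> 0"
    by (auto simp: box_bump_def less_le)
  have pos: "0 < y" if "flat_exp 1 (real (Suc n) * y) \<noteq> 0" for y
    using that by (auto simp: flat_exp_def zero_less_mult_iff split: if_splits)
  show "x \<in> box l u"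
    unfolding mem_box
  proof
    fix b :: pt assume "b \<in> Basis"
    with nz have "0 < (x - l) \<bullet> b" "0 < (u - x) \<bullet> b" by (auto intro: pos)
    then show "l \<bullet> b < x \<bullet> b \<and> x \<bullet> b < u \<bullet> b" by (simp add: inner_diff_left)
  qed
next
  assume "x \<in> box l u"
  then show "0 < box_bump l u n x"
    by (auto simp: box_bump_def mem_box flat_exp_def inner_diff_left zero_less_mult_iff intro!: prod_pos)
qed

lemma box_bump_outside: "x \<notin> box l u \<Longrightarrow> box_bump l u n x = 0"
  using box_bump_pos_iff[of l u n x] box_bump_bounds(1)[of l u n x] by linarith

lemma box_bump_tendsto: "(\<lambda>n. box_bump l u n x) \<longlonglongrightarrow> indicator (box l u) x"
proof (cases "x \<in> box l u")
  case True
  have "(\<lambda>n. box_bump l u n x) \<longlonglongrightarrow> (\<Prod>b\<in>(Basis::pt set). 1 * 1)"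
    unfolding box_bump_def
    by (intro tendsto_prod tendsto_mult flat_exp_1_tendsto)
      (use True in \<open>auto simp: mem_box inner_diff_left\<close>)
  then show ?thesis using True by simp
next
  case False
  then show ?thesis by (simp add: box_bump_outside)
qed

lemma smooth_on_box_bump: "smooth_on UNIV (box_bump l u n)"
proof -
  have 1: "(\<lambda>x. flat_exp 1 (real (Suc n) * ((x - l) \<bullet> b))) = (\<lambda>x. flat_exp 1 ((real (Suc n) *\<^sub>R b) \<bullet> x + - (real (Suc n) * (l \<bullet> b))))"
   and 2: "(\<lambda>x. flat_exp 1 (real (Suc n) * ((u - x) \<bullet> b))) = (\<lambda>x. flat_exp 1 ((- real (Suc n) *\<^sub>R b) \<bullet> x + (real (Suc n) * (u \<bullet> b))))" for b
    by (auto simp: inner_diff_left inner_commute algebra_simps)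
  have 3: "smooth_on UNIV (\<lambda>x. flat_exp 1 (real (Suc n) * ((x - l) \<bullet> b)) * flat_exp 1 (real (Suc n) * ((u - x) \<bullet> b)))" for b
    by (intro smooth_on_mult) (simp_all only: 1 2 smooth_on_flat_exp)
  show ?thesis
    unfolding box_bump_def[abs_def] by (intro smooth_on_prod 3) auto
qed

lemma box_bump_test_function:
  assumes "cbox l u \<subseteq> \<Omega>"
  shows "box_bump l u n \<in> test_functions \<Omega>"
proof -
  have "box_bump l u n x = 0" if "x \<notin> cbox l u" for x
    using that box_subset_cbox[of l u] by (intro box_bump_outside) auto
  then show ?thesis
    using assms smooth_on_box_bump
    unfolding test_functions_def by (intro CollectI conjI exI[of _ "cbox l u"]) auto
qed

section \<open>Algebra and classical calculus of test functions\<close>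

lemma test_functions_add:
  assumes "f \<in> test_functions \<Omega>" "g \<in> test_functions \<Omega>"
  shows "(\<lambda>x. f x + g x) \<in> test_functions \<Omega>"
proof -
  obtain K L where "compact K" "K \<subseteq> \<Omega>" "\<And>x. x \<notin> K \<Longrightarrow> f x = 0" "compact L" "L \<subseteq> \<Omega>" "\<And>x. x \<notin> L \<Longrightarrow> g x = 0"
    using assms by (auto simp: test_functions_def)
  then have "compact (K \<union> L) \<and> K \<union> L \<subseteq> \<Omega> \<and> (\<forall>x. x \<notin> K \<union> L \<longrightarrow> f x + g x = 0)" by auto
  then show ?thesis
    using assms by (auto simp: test_functions_def intro: smooth_on_add)
qed

lemma test_functions_mult:
  assumes "f \<in> test_functions \<Omega>" "smooth_on UNIV g"
  shows "(\<lambda>x. f x * g x) \<in> test_functions \<Omega>"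
  using assms by (force simp: test_functions_def intro: smooth_on_mult)

lemma test_functions_scale:
  assumes "f \<in> test_functions \<Omega>"
  shows "(\<lambda>x. c * f x) \<in> test_functions \<Omega>"
  using test_functions_mult[OF assms smooth_on_const[of c]] by (simp add: mult.commute)

text \<open>The classical gradient, in contrast to \<open>grad\<close>, which is a chosen weak
  gradient and is determined only almost everywhere.\<close>

definition cgrad :: "(pt \<Rightarrow> real) \<Rightarrow> pt \<Rightarrow> pt" where
  "cgrad f x = (\<chi> i. frechet_derivative f (at x) (axis i 1))"

lemma test_function_has_derivative:
  assumes "f \<in> test_functions \<Omega>"
  shows "(f has_derivative (\<lambda>v. cgrad f x \<bullet> v)) (at x)"
proof -
  have "Ck_on (Suc 0) UNIV f" using assms by (simp add: test_functions_def smooth_on_def del: Ck_on.simps)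
  then have d: "(f has_derivative frechet_derivative f (at x)) (at x)"
    by (intro differentiable_has_frechet_derivative) simp
  have "frechet_derivative f (at x) = (\<lambda>v. cgrad f x \<bullet> v)"
  proof
    fix v
    have lin: "linear (frechet_derivative f (at x))" by (rule has_derivative_linear[OF d])
    have "frechet_derivative f (at x) v = frechet_derivative f (at x) (\<Sum>i\<in>UNIV. v $ i *\<^sub>R axis i 1)"
      using basis_expansion[of v] by (simp add: scalar_mult_eq_scaleR)
    also have "\<dots> = (\<Sum>i\<in>UNIV. v $ i * frechet_derivative f (at x) (axis i 1))"
      by (simp add: linear_sum[OF lin] linear_scale[OF lin])
    also have "\<dots> = cgrad f x \<bullet> v" by (simp add: cgrad_def inner_vec_def mult.commute)
    finally show "frechet_derivative f (at x) v = cgrad f x \<bullet> v" .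
  qed
  with d show ?thesis by simp
qed

lemma frechet_derivative_test_function:
  assumes "f \<in> test_functions \<Omega>"
  shows "frechet_derivative f (at x) v = cgrad f x \<bullet> v"
  using frechet_derivative_at[OF test_function_has_derivative[OF assms]] by metis

lemma continuous_on_test_function:
  assumes "f \<in> test_functions \<Omega>"
  shows "continuous_on UNIV f" "continuous_on UNIV (cgrad f)"
proof -
  have "Ck_on 0 UNIV f" "Ck_on (Suc 0) UNIV f"
    using assms by (simp_all add: test_functions_def smooth_on_def del: Ck_on.simps)
  then show "continuous_on UNIV f" "continuous_on UNIV (cgrad f)"
    unfolding cgrad_def[abs_def] by (auto intro!: continuous_on_vec_lambda)
qed

lemma test_function_support:
  assumes "f \<in> test_functions \<Omega>"
  shows "\<exists>K. compact K \<and> K \<subseteq> \<Omega> \<and> (\<forall>x. x \<notin> K \<longrightarrow> f x = 0 \<and> cgrad f x = 0)"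
proof -
  obtain K where K: "compact K" "K \<subseteq> \<Omega>" "\<And>x. x \<notin> K \<Longrightarrow> f x = 0"
    using assms by (auto simp: test_functions_def)
  have "cgrad f x = 0" if "x \<notin> K" for x
  proof -
    have "((\<lambda>x. 0) has_derivative (\<lambda>v. 0)) (at x)" by simp
    then have "(f has_derivative (\<lambda>v. 0)) (at x)"
      by (rule has_derivative_transform_within_open[of _ _ _ _ "- K"])
        (use K that compact_imp_closed in auto)
    then have "(\<lambda>v. cgrad f x \<bullet> v) = (\<lambda>v. 0)"
      using test_function_has_derivative[OF assms] has_derivative_unique by blast
    then show ?thesis by (metis inner_eq_zero_iff)
  qed
  with K show ?thesis by blast
qed

lemma compact_support_integrable:
  fixes f :: "pt \<Rightarrow> 'b::euclidean_space"
  assumes "continuous_on UNIV f" "compact K" "\<And>x. x \<notin> K \<Longrightarrow> f x = 0"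
  shows "integrable lborel f"
proof -
  have "integrable lborel (\<lambda>x. indicator K x *\<^sub>R f x)"
    by (intro borel_integrable_compact assms continuous_on_subset[OF assms(1)]) auto
  moreover have "(\<lambda>x. indicator K x *\<^sub>R f x) = f"
    using assms(3) by (auto simp: indicator_def)
  ultimately show ?thesis by simp
qed

text \<open>Moves integrals from \<Omega> to the whole space, where translation invariance and
  Fubini are available.\<close>

lemma compact_support_lebesgue_on:
  fixes f :: "pt \<Rightarrow> 'b::euclidean_space"
  assumes "continuous_on UNIV f" "compact K" "K \<subseteq> \<Omega>" "\<And>x. x \<notin> K \<Longrightarrow> f x = 0"
    and "\<Omega> \<in> sets lebesgue"
  shows "integrable (lebesgue_on \<Omega>) f" "integral\<^sup>L (lebesgue_on \<Omega>) f = integral\<^sup>L lborel f"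
    "f \<in> borel_measurable (lebesgue_on \<Omega>)"
proof -
  have m: "f \<in> borel_measurable lborel" using assms(1) by (simp add: borel_measurable_continuous_onI)
  have i: "integrable lborel f" using compact_support_integrable assms by blast
  have e: "(\<lambda>x. indicator \<Omega> x *\<^sub>R f x) = f"
  proof
    fix x
    show "indicator \<Omega> x *\<^sub>R f x = f x" by (cases "x \<in> \<Omega>") (use assms(3,4) in auto)
  qed
  show "integrable (lebesgue_on \<Omega>) f"
    using assms(5) i m by (subst integrable_restrict_space) (auto simp: e integrable_completion)
  show "integral\<^sup>L (lebesgue_on \<Omega>) f = integral\<^sup>L lborel f"
    using assms(5) m by (subst integral_restrict_space) (auto simp: e integral_completion)
  show "f \<in> borel_measurable (lebesgue_on \<Omega>)"
    using m by (intro measurable_restrict_space1 measurable_completion)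
qed

lemma test_function_L2:
  assumes "f \<in> test_functions \<Omega>" "\<Omega> \<in> sets lebesgue"
  shows "L2_on \<Omega> f" "L2_on \<Omega> (cgrad f)"
    "(Lnorm 2 \<Omega> f)\<^sup>2 = (LINT x|lborel. (f x)\<^sup>2)"
    "(Lnorm 2 \<Omega> (cgrad f))\<^sup>2 = (LINT x|lborel. (norm (cgrad f x))\<^sup>2)"
proof -
  obtain K where K: "compact K" "K \<subseteq> \<Omega>" "\<And>x. x \<notin> K \<Longrightarrow> f x = 0" "\<And>x. x \<notin> K \<Longrightarrow> cgrad f x = 0"
    using test_function_support[OF assms(1)] by blast
  note c = continuous_on_test_function[OF assms(1)]
  have c2: "continuous_on UNIV (\<lambda>x. (norm (f x))\<^sup>2)" "continuous_on UNIV (\<lambda>x. (norm (cgrad f x))\<^sup>2)"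
    by (intro continuous_intros c)+
  note 1 = compact_support_lebesgue_on[OF c2(1) K(1,2) _ assms(2)]
    and 2 = compact_support_lebesgue_on[OF c2(2) K(1,2) _ assms(2)]
    and 3 = compact_support_lebesgue_on(3)[OF c(1) K(1,2) _ assms(2)]
    and 4 = compact_support_lebesgue_on(3)[OF c(2) K(1,2) _ assms(2)]
  show "L2_on \<Omega> f" "L2_on \<Omega> (cgrad f)"
    using 1 2 3 4 K by (auto simp: L2_on_def)
  show "(Lnorm 2 \<Omega> f)\<^sup>2 = (LINT x|lborel. (f x)\<^sup>2)"
    "(Lnorm 2 \<Omega> (cgrad f))\<^sup>2 = (LINT x|lborel. (norm (cgrad f x))\<^sup>2)"
    using 1(2) 2(2) K by (auto simp: Lnorm_2_sq)
qed

lemma test_function_bounded_gradient: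
  assumes "f \<in> test_functions \<Omega>"
  shows "\<exists>B\<ge>0. (\<forall>x. norm (cgrad f x) \<le> B) \<and> (\<forall>x y. \<bar>f x - f y\<bar> \<le> B * norm (x - y))"
proof -
  obtain K where K: "compact K" "K \<subseteq> \<Omega>" "\<And>x. x \<notin> K \<Longrightarrow> f x = 0" "\<And>x. x \<notin> K \<Longrightarrow> cgrad f x = 0"
    using test_function_support[OF assms] by blast
  have "bounded (cgrad f ` K)"
    using K(1) continuous_on_test_function(2)[OF assms]
    by (intro compact_imp_bounded compact_continuous_image) (auto intro: continuous_on_subset)
  then obtain B0 where "\<And>x. x \<in> K \<Longrightarrow> norm (cgrad f x) \<le> B0" unfolding bounded_iff by blast
  then have B: "norm (cgrad f x) \<le> max B0 0" for x using K(4) by (cases "x \<in> K") force+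
  have "\<bar>f x - f y\<bar> \<le> max B0 0 * norm (x - y)" for x y
  proof -
    have "norm (f x - f y) \<le> max B0 0 * norm (x - y)"
    proof (rule differentiable_bound[of UNIV f "\<lambda>x v. cgrad f x \<bullet> v"])
      show "onorm (\<lambda>v. cgrad f x \<bullet> v) \<le> max B0 0" for x
        by (rule onorm_le) (auto intro!: order_trans[OF Cauchy_Schwarz_ineq2] mult_right_mono B)
    qed (use test_function_has_derivative[OF assms] in auto)
    then show ?thesis by simp
  qed
  with B show ?thesis by (intro exI[of _ "max B0 0"]) auto
qed

text \<open>The integral of every difference quotient vanishes by translation invariance. The
  quotients are bounded by \<open>B * norm v\<close> and supported in a fixed ball, so dominated
  convergence carries this over to the derivative.\<close>

lemma integral_derivative_test_function:
  assumes "f \<in> test_functions \<Omega>"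
  shows "(LINT x|lborel. cgrad f x \<bullet> v) = 0"
proof -
  obtain K where K: "compact K" "K \<subseteq> \<Omega>" "\<And>x. x \<notin> K \<Longrightarrow> f x = 0" "\<And>x. x \<notin> K \<Longrightarrow> cgrad f x = 0"
    using test_function_support[OF assms] by blast
  obtain B where B: "0 \<le> B" "\<And>x. norm (cgrad f x) \<le> B" "\<And>x y. \<bar>f x - f y\<bar> \<le> B * norm (x - y)"
    using test_function_bounded_gradient[OF assms] by blast
  obtain R where R: "\<And>x. x \<in> K \<Longrightarrow> norm x \<le> R"
    using compact_imp_bounded[OF K(1)] by (auto simp: bounded_iff)
  note c = continuous_on_test_function[OF assms]
  have [measurable]: "f \<in> borel_measurable borel" "cgrad f \<in> borel_measurable borel"
    using c by (auto intro: borel_measurable_continuous_onI)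
  have int: "integrable lborel f" using compact_support_integrable[OF c(1) K(1,3)] .
  define s where "s n x = real (Suc n) * (f (x + inverse (real (Suc n)) *\<^sub>R v) - f x)" for n x
  have s0: "(LINT x|lborel. s n x) = 0" for n
  proof -
    let ?w = "inverse (real (Suc n)) *\<^sub>R v"
    have i: "integrable lborel (\<lambda>x. f (x + ?w))" "(LINT x|lborel. f (x + ?w)) = (LINT x|lborel. f x)"
      using int lborel_distr_plus[of ?w]
        integrable_distr_eq[of "(+) ?w" lborel borel f] integral_distr[of "(+) ?w" lborel borel f]
      by (simp_all add: add.commute)
    then show ?thesis unfolding s_def by (simp add: int)
  qed
  have "(\<lambda>n. LINT x|lborel. s n x) \<longlonglongrightarrow> (LINT x|lborel. cgrad f x \<bullet> v)"
  proof (rule integral_dominated_convergence)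
    \<comment> \<open>The steps have length at most \<open>norm v\<close>, so enlarging the radius
      \<open>R\<close> of the support by \<open>norm v\<close> covers both values in the
      quotient.\<close>
    show "integrable lborel (\<lambda>x. indicator (cball 0 (R + norm v)) x *\<^sub>R (B * norm v))"
      by (intro borel_integrable_compact) auto
    show "AE x in lborel. (\<lambda>n. s n x) \<longlonglongrightarrow> cgrad f x \<bullet> v"
    proof (rule AE_I2)
      fix x
      have "((\<lambda>t. f (x + t *\<^sub>R v)) has_real_derivative (cgrad f x \<bullet> v)) (at 0)"
      proof -
        have "((\<lambda>t. x + t *\<^sub>R v) has_derivative (\<lambda>t. t *\<^sub>R v)) (at 0)"
          by (auto intro!: derivative_eq_intros)
        moreover have "(f has_derivative (\<lambda>v. cgrad f x \<bullet> v)) (at (x + 0 *\<^sub>R v))"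
          using test_function_has_derivative[OF assms, of x] by simp
        ultimately have "((\<lambda>t. f (x + t *\<^sub>R v)) has_derivative (\<lambda>t. cgrad f x \<bullet> (t *\<^sub>R v))) (at 0)"
          by (rule has_derivative_compose)
        moreover have "(\<lambda>t. cgrad f x \<bullet> (t *\<^sub>R v)) = (*) (cgrad f x \<bullet> v)" by auto
        ultimately show ?thesis by (simp only: has_field_derivative_def)
      qed
      then have "((\<lambda>h. (f (x + h *\<^sub>R v) - f x) / h) \<longlongrightarrow> cgrad f x \<bullet> v) (at 0)"
        by (simp add: DERIV_def)
      moreover have "filterlim (\<lambda>n. inverse (real (Suc n))) (at 0) sequentially"
        using LIMSEQ_inverse_real_of_nat by (simp add: filterlim_at del: of_nat_Suc)
      ultimately have "(\<lambda>n. (f (x + inverse (real (Suc n)) *\<^sub>R v) - f x) / inverse (real (Suc n))) \<longlonglongrightarrow> cgrad f x \<bullet> v"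
        by (rule filterlim_compose)
      then show "(\<lambda>n. s n x) \<longlonglongrightarrow> cgrad f x \<bullet> v"
        by (simp add: s_def field_simps)
    qed
    fix n
    show "AE x in lborel. norm (s n x) \<le> indicator (cball 0 (R + norm v)) x *\<^sub>R (B * norm v)"
    proof (rule AE_I2)
      fix x
      let ?w = "inverse (real (Suc n)) *\<^sub>R v"
      have w: "norm ?w \<le> norm v" by (simp add: field_simps)
      show "norm (s n x) \<le> indicator (cball 0 (R + norm v)) x *\<^sub>R (B * norm v)"
      proof (cases "x \<in> cball 0 (R + norm v)")
        case True
        have "\<bar>f (x + ?w) - f x\<bar> \<le> B * norm ?w"
          using B(3)[of "x + ?w" x] by simp
        then have "norm (s n x) \<le> real (Suc n) * (B * norm ?w)"
          unfolding s_def real_norm_def abs_mult by (intro mult_mono) auto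
        also have "\<dots> = B * norm v" by simp
        finally show ?thesis using True by simp
      next
        case False
        then have "x \<notin> K" using R[of x] norm_ge_zero[of v] by fastforce
        moreover have "x + ?w \<notin> K"
        proof
          assume "x + ?w \<in> K"
          then have "norm (x + ?w) \<le> R" by (rule R)
          then have "norm x \<le> R + norm v" using w norm_diff_ineq[of x ?w] by linarith
          then show False using False by simp
        qed
        ultimately show ?thesis using K(3) False by (simp add: s_def)
      qed
    qed
  qed (unfold s_def, measurable)
  then show ?thesis unfolding s0 by (simp add: LIMSEQ_const_iff)
qed

text \<open>Integration by parts: the product of \<open>f\<close> and \<phi> is a test function, so
  the integral of its directional derivative vanishes, and the product rule splits that integral
  into the two sides.\<close>

lemma weak_gradient_test_function:
  assumes "f \<in> test_functions \<Omega>" "\<Omega> \<in> sets lebesgue"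
  shows "weak_gradient \<Omega> f (cgrad f)"
  unfolding weak_gradient_def
proof (intro conjI ballI allI)
  show "L2_on \<Omega> (cgrad f)" using test_function_L2[OF assms] by blast
  fix \<phi> i assume \<phi>: "\<phi> \<in> test_functions \<Omega>"
  let ?e = "axis i (1::real) :: pt"
  obtain K where K: "compact K" "K \<subseteq> \<Omega>" "\<And>x. x \<notin> K \<Longrightarrow> f x = 0" "\<And>x. x \<notin> K \<Longrightarrow> cgrad f x = 0"
    using test_function_support[OF assms(1)] by blast
  note c = continuous_on_test_function[OF assms(1)] continuous_on_test_function[OF \<phi>]
  have fp: "(\<lambda>x. f x * \<phi> x) \<in> test_functions \<Omega>"
    using \<phi> by (intro test_functions_mult assms) (simp add: test_functions_def)
  have 1: "cgrad (\<lambda>x. f x * \<phi> x) x \<bullet> ?e = f x * (cgrad \<phi> x \<bullet> ?e) + cgrad f x $ i * \<phi> x" for x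
    using fun_cong[OF has_derivative_unique[OF test_function_has_derivative[OF fp]
          has_derivative_mult[OF test_function_has_derivative[OF assms(1)] test_function_has_derivative[OF \<phi>]]], of x ?e]
    by (simp add: inner_axis)
  have c1: "continuous_on UNIV (\<lambda>x. f x * (cgrad \<phi> x \<bullet> ?e))" "continuous_on UNIV (\<lambda>x. cgrad f x $ i * \<phi> x)"
    by (intro continuous_intros c)+
  have z: "\<And>x. x \<notin> K \<Longrightarrow> f x * (cgrad \<phi> x \<bullet> ?e) = 0" "\<And>x. x \<notin> K \<Longrightarrow> cgrad f x $ i * \<phi> x = 0"
    using K by auto
  note A = compact_support_lebesgue_on(2)[OF c1(1) K(1,2) z(1) assms(2)]
    compact_support_lebesgue_on(2)[OF c1(2) K(1,2) z(2) assms(2)]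
  have "(LINT x|lborel. f x * (cgrad \<phi> x \<bullet> ?e)) + (LINT x|lborel. cgrad f x $ i * \<phi> x) = 0"
    using integral_derivative_test_function[OF fp, of ?e] compact_support_integrable[OF c1(1) K(1) z(1)]
      compact_support_integrable[OF c1(2) K(1) z(2)]
    by (simp add: 1)
  then show "(LINT x|lebesgue_on \<Omega>. f x * frechet_derivative \<phi> (at x) ?e) = - (LINT x|lebesgue_on \<Omega>. cgrad f x $ i * \<phi> x)"
    by (simp add: frechet_derivative_test_function[OF \<phi>] A)
qed

subsection \<open>Weak gradients and the space \<open>H\<^sub>0\<^sup>1\<close>\<close>

text \<open>Boxes are an intersection-stable generator of the Borel sets, so Dynkin induction
  extends the vanishing to all Borel sets. The whole space is not a box; \<open>total\<close>
  supplies the step for complements.\<close>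

lemma lborel_AE_zero_of_box_integrals:
  fixes h :: "pt \<Rightarrow> real"
  assumes h: "integrable lborel h"
    and box: "\<And>a b. (LINT x:box a b|lborel. h x) = 0"
    and total: "(LINT x|lborel. h x) = 0"
  shows "AE x in lborel. h x = 0"
proof (rule sigma_finite_measure.density_zero[OF sigma_finite_lborel h])
  have si: "set_integrable lborel A h" if "A \<in> sets borel" for A
    unfolding set_integrable_def using h that by (intro integrable_mult_indicator) auto
  fix A :: "pt set" assume "A \<in> sets lborel"
  then have A: "A \<in> sigma_sets UNIV (range (\<lambda>(a, b). box a b))"
    unfolding sets_lborel borel_eq_box by simp
  have "Int_stable (range (\<lambda>(a, b). box a b :: pt set))"
    by (auto simp: Int_stable_def box_Int_box)
  moreover have "range (\<lambda>(a, b). box a b) \<subseteq> Pow (UNIV :: pt set)" by auto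
  moreover note A
  ultimately show "(LINT x:A|lborel. h x) = 0"
  proof (induction rule: sigma_sets_induct_disjoint)
    case (basic A)
    then show ?case using box by auto
  next
    case empty
    then show ?case by (simp add: set_lebesgue_integral_def)
  next
    case (compl A)
    then have A: "A \<in> sets borel" unfolding borel_eq_box by simp
    have "(LINT x:UNIV|lborel. h x) = (LINT x:A|lborel. h x) + (LINT x:UNIV - A|lborel. h x)"
      using set_integral_Un[of A "UNIV - A" lborel h] si A by simp
    then show ?case using total compl by (simp add: set_lebesgue_integral_def)
  next
    case (union A)
    then have A: "\<And>i. A i \<in> sets borel" unfolding borel_eq_box by auto
    have "(LINT x:(\<Union>i. A i)|lborel. h x) = (\<Sum>i. (LINT x:(A i)|lborel. h x))"
      using A union.hyps(1) by (intro lebesgue_integral_countable_add si) (auto simp: disjoint_family_on_def)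
    then show ?case using union by simp
  qed
qed

section \<open>The fundamental lemma of the calculus of variations and weak gradients\<close>

locale bounded_open =
  fixes \<Omega> :: "pt set"
  assumes open_dom: "open \<Omega>" and bounded_dom: "bounded \<Omega>"
begin

lemma dom_lmeasurable: "\<Omega> \<in> lmeasurable"
  using open_dom bounded_dom by (simp add: lmeasurable_open)

lemma dom_sets: "\<Omega> \<in> sets lebesgue"
  using dom_lmeasurable by (rule fmeasurableD)

text \<open>Testing with \<open>box_bump\<close> and passing to the limit shows that
  \<open>g\<close> has zero integral over every box whose closure lies in \<Omega>. Cutting
  \<open>g\<close> off to one box and extending by zero reduces the claim to a function on the whole
  space.\<close>

lemma AE_zero_on_box_of_test_integrals:
  assumes g: "integrable (lebesgue_on \<Omega>) g"
    and test: "\<And>\<phi>. \<phi> \<in> test_functions \<Omega> \<Longrightarrow> (LINT x|lebesgue_on \<Omega>. g x * \<phi> x) = (0::real)"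
    and lu: "cbox l u \<subseteq> \<Omega>"
  shows "AE x in lebesgue. x \<in> box l u \<longrightarrow> g x = 0"
proof -
  have boxes: "(LINT x|lebesgue_on \<Omega>. g x * indicator (box a b) x) = 0" if ab: "cbox a b \<subseteq> \<Omega>" for a b
  proof -
    have [measurable]: "g \<in> borel_measurable (lebesgue_on \<Omega>)" using g by auto
    have [measurable]: "box_bump a b n \<in> borel_measurable (lebesgue_on \<Omega>)" for n
      using test_function_L2(1)[OF box_bump_test_function[OF ab] dom_sets] by (rule L2_onD)
    have "box a b \<in> sets lebesgue" by simp
    then have [measurable]: "(indicator (box a b) :: pt \<Rightarrow> real) \<in> borel_measurable (lebesgue_on \<Omega>)"
      by (intro measurable_restrict_space1 borel_measurable_indicator)
    have "(\<lambda>n. LINT x|lebesgue_on \<Omega>. g x * box_bump a b n x) \<longlonglongrightarrow> (LINT x|lebesgue_on \<Omega>. g x * indicator (box a b) x)"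
    proof (rule integral_dominated_convergence)
      show "integrable (lebesgue_on \<Omega>) (\<lambda>x. \<bar>g x\<bar>)" using g by simp
      show "AE x in lebesgue_on \<Omega>. (\<lambda>n. g x * box_bump a b n x) \<longlonglongrightarrow> g x * indicator (box a b) x"
        by (intro AE_I2 tendsto_mult tendsto_const box_bump_tendsto)
      show "AE x in lebesgue_on \<Omega>. norm (g x * box_bump a b n x) \<le> \<bar>g x\<bar>" for n
        using box_bump_bounds[of a b n] by (intro AE_I2) (simp add: abs_mult mult_left_le)
    qed measurable
    then show ?thesis
      using test[OF box_bump_test_function[OF ab]] by (simp add: LIMSEQ_const_iff)
  qed
  define h where "h x = indicator \<Omega> x * (g x * indicator (box l u) x)" for x
  have h: "integrable lebesgue h"
  proof -
    have "integrable lebesgue (\<lambda>x. indicator (box l u) x *\<^sub>R (indicator \<Omega> x *\<^sub>R g x))"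
      by (rule integrable_mult_indicator) (use g dom_sets in \<open>auto simp: integrable_restrict_space\<close>)
    then show ?thesis by (simp add: h_def[abs_def] mult_ac)
  qed
  \<comment> \<open>\<open>h\<close> is only Lebesgue measurable, whereas the Dynkin argument works
    with Borel sets; hence the Borel representative.\<close>
  obtain h' where h': "h' \<in> borel_measurable lborel" "AE x in lborel. h x = h' x"
    using completion_ex_borel_measurable_real[of h lborel] h by auto
  have AE: "AE x in lebesgue. h x = h' x" using h'(2) by (rule AE_completion)
  have m: "h' \<in> borel_measurable lebesgue" using h'(1) by (rule measurable_completion)
  have "integrable lebesgue h'"
    using h AE m by (subst integrable_cong_AE[of _ _ h]) auto
  then have i': "integrable lborel h'" using h'(1) by (simp add: integrable_completion)
  have eq: "(LINT x:A|lborel. h' x) = (LINT x|lebesgue_on \<Omega>. g x * (indicator (box l u \<inter> A) x))"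
    if A: "A \<in> sets borel" for A
  proof -
    have [measurable]: "A \<in> sets lebesgue" using A by simp
    note m[measurable]
    have [measurable]: "h \<in> borel_measurable lebesgue" using h by auto
    have "(LINT x:A|lborel. h' x) = (LINT x|lebesgue. indicator A x * h' x)"
      using h'(1) A unfolding set_lebesgue_integral_def by (subst integral_completion) auto
    also have "\<dots> = (LINT x|lebesgue. indicator A x * h x)"
      by (intro integral_cong_AE) (use AE in auto)
    also have "\<dots> = (LINT x|lebesgue_on \<Omega>. g x * (indicator (box l u \<inter> A) x))"
      using dom_sets by (subst integral_restrict_space)
        (auto intro!: Bochner_Integration.integral_cong simp: h_def indicator_def)
    finally show ?thesis .
  qed
  have "AE x in lborel. h' x = 0"
  proof (rule lborel_AE_zero_of_box_integrals[OF i'])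
    \<comment> \<open>The intersection of \<open>box l u\<close> with any box is a box again, and
      its closed version lies in \<open>cbox l u\<close>, so \<open>boxes\<close> applies to
      it.\<close>
    fix a b
    have sub: "cbox (\<Sum>i\<in>Basis. max (l \<bullet> i) (a \<bullet> i) *\<^sub>R i) (\<Sum>i\<in>Basis. min (u \<bullet> i) (b \<bullet> i) *\<^sub>R i) \<subseteq> \<Omega>"
      using lu by (auto simp: mem_box subset_eq)
    show "(LINT x:box a b|lborel. h' x) = 0"
      using boxes[OF sub] by (simp add: eq box_Int_box)
  next
    show "(LINT x|lborel. h' x) = 0"
      using eq[of UNIV] boxes[OF lu] by (simp add: set_lebesgue_integral_def)
  qed
  then have "AE x in lebesgue. h' x = 0" by (rule AE_completion)
  with AE show ?thesis
  proof eventually_elim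
    case (elim x)
    then show ?case using lu box_subset_cbox[of l u] by (auto simp: h_def)
  qed
qed

text \<open>Countably many closed boxes cover \<Omega>, and the difference between each closed box
  and its interior is a null set.\<close>

lemma AE_zero_of_test_integrals:
  assumes "integrable (lebesgue_on \<Omega>) g"
    and "\<And>\<phi>. \<phi> \<in> test_functions \<Omega> \<Longrightarrow> (LINT x|lebesgue_on \<Omega>. g x * \<phi> x) = (0::real)"
  shows "AE x in lebesgue_on \<Omega>. g x = 0"
proof -
  obtain D where D: "countable D" "D \<subseteq> Pow \<Omega>" "\<And>X. X \<in> D \<Longrightarrow> \<exists>a b. X = cbox a b" "\<Union>D = \<Omega>"
    using open_countable_Union_open_cbox[OF open_dom] by metis
  have "AE x in lebesgue. x \<in> X \<longrightarrow> g x = 0" if X: "X \<in> D" for X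
  proof -
    obtain a b where ab: "X = cbox a b" using D(3)[OF X] by blast
    then have "cbox a b \<subseteq> \<Omega>" using D(2) X by blast
    then have "AE x in lebesgue. x \<in> box a b \<longrightarrow> g x = 0"
      using AE_zero_on_box_of_test_integrals assms by blast
    moreover have "AE x in lebesgue. x \<notin> cbox a b - box a b"
      by (intro AE_not_in) (simp flip: negligible_iff_null_sets add: negligible_frontier_interval)
    ultimately show ?thesis by eventually_elim (use ab in auto)
  qed
  then have "AE x in lebesgue. \<forall>X\<in>D. x \<in> X \<longrightarrow> g x = 0"
    by (subst AE_ball_countable[OF D(1)]) auto
  then have "AE x in lebesgue. x \<in> \<Omega> \<longrightarrow> g x = 0"
    by eventually_elim (use D(4) in auto)
  then show ?thesis using dom_sets by (simp add: AE_restrict_space_iff)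
qed

lemma L2_on_component:
  assumes "L2_on \<Omega> (g :: pt \<Rightarrow> pt)"
  shows "L2_on \<Omega> (\<lambda>x. g x $ i)" "Lnorm 2 \<Omega> (\<lambda>x. g x $ i) \<le> Lnorm 2 \<Omega> g"
proof -
  have [measurable]: "g \<in> borel_measurable (lebesgue_on \<Omega>)" using assms by (rule L2_onD)
  have m: "(\<lambda>x. g x $ i) \<in> borel_measurable (lebesgue_on \<Omega>)"
    using borel_measurable_inner[of g "lebesgue_on \<Omega>" "\<lambda>_. axis i 1"] by (simp add: inner_axis)
  have le: "(norm (g x $ i))\<^sup>2 \<le> (norm (g x))\<^sup>2" for x
    using Finite_Cartesian_Product.norm_nth_le[of "g x" i] by (intro power_mono) auto
  have int: "integrable (lebesgue_on \<Omega>) (\<lambda>x. (norm (g x $ i))\<^sup>2)"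
    by (rule Bochner_Integration.integrable_bound[OF L2_onD(2)[OF assms]]) (use m le in auto)
  then show "L2_on \<Omega> (\<lambda>x. g x $ i)" using m by (simp add: L2_on_def)
  show "Lnorm 2 \<Omega> (\<lambda>x. g x $ i) \<le> Lnorm 2 \<Omega> g"
    unfolding Lnorm_2 by (intro real_sqrt_le_mono integral_mono int L2_onD(2)[OF assms] le)
qed

lemma test_L2:
  assumes "\<phi> \<in> test_functions \<Omega>"
  shows "L2_on \<Omega> \<phi>" "L2_on \<Omega> (cgrad \<phi>)" "weak_gradient \<Omega> \<phi> (cgrad \<phi>)"
  using test_function_L2[OF assms dom_sets] weak_gradient_test_function[OF assms dom_sets] by auto

lemma weak_gradientD:
  assumes "weak_gradient \<Omega> u g" "\<phi> \<in> test_functions \<Omega>"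
  shows "(LINT x|lebesgue_on \<Omega>. u x \<bullet> (cgrad \<phi> x $ i)) = - (LINT x|lebesgue_on \<Omega>. (g x $ i) \<bullet> \<phi> x)"
  using assms by (simp add: weak_gradient_def cgrad_def)

lemma weak_gradientI:
  assumes "L2_on \<Omega> g" "\<And>\<phi> i. \<phi> \<in> test_functions \<Omega> \<Longrightarrow>
    (LINT x|lebesgue_on \<Omega>. u x \<bullet> (cgrad \<phi> x $ i)) = - (LINT x|lebesgue_on \<Omega>. (g x $ i) \<bullet> \<phi> x)"
  shows "weak_gradient \<Omega> u g"
  using assms by (simp add: weak_gradient_def cgrad_def)

lemma weak_gradient_L2: "weak_gradient \<Omega> u g \<Longrightarrow> L2_on \<Omega> g"
  by (simp add: weak_gradient_def)

text \<open>Each component of the difference is annihilated by all test functions, so the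
  fundamental lemma applies componentwise.\<close>

lemma weak_gradient_unique:
  assumes "weak_gradient \<Omega> u g" "weak_gradient \<Omega> u h"
  shows "AE x in lebesgue_on \<Omega>. g x = h x"
proof -
  note L2 = weak_gradient_L2[OF assms(1)] weak_gradient_L2[OF assms(2)]
  have "AE x in lebesgue_on \<Omega>. g x $ i - h x $ i = 0" for i
  proof (rule AE_zero_of_test_integrals)
    show "integrable (lebesgue_on \<Omega>) (\<lambda>x. g x $ i - h x $ i)"
      by (rule integral_norm_le_Lnorm_2(1)[OF L2_on_diff dom_lmeasurable]) (intro L2_on_component L2)+
    fix \<phi> assume \<phi>: "\<phi> \<in> test_functions \<Omega>"
    have "integrable (lebesgue_on \<Omega>) (\<lambda>x. (g x $ i) \<bullet> \<phi> x)" "integrable (lebesgue_on \<Omega>) (\<lambda>x. (h x $ i) \<bullet> \<phi> x)"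
      by (intro L2_on_integrable_inner L2_on_component L2 test_L2 \<phi>)+
    moreover have "(LINT x|lebesgue_on \<Omega>. (g x $ i) \<bullet> \<phi> x) = (LINT x|lebesgue_on \<Omega>. (h x $ i) \<bullet> \<phi> x)"
      using weak_gradientD[OF assms(1) \<phi>, of i] weak_gradientD[OF assms(2) \<phi>, of i] by linarith
    ultimately show "(LINT x|lebesgue_on \<Omega>. (g x $ i - h x $ i) * \<phi> x) = 0"
      by (simp add: left_diff_distrib)
  qed
  then have "AE x in lebesgue_on \<Omega>. \<forall>i. g x $ i - h x $ i = 0"
    by (simp add: AE_all_countable)
  then show ?thesis by eventually_elim (simp add: vec_eq_iff)
qed

lemma weak_gradient_add_scaled:
  assumes "weak_gradient \<Omega> u g" "weak_gradient \<Omega> v h" "L2_on \<Omega> u" "L2_on \<Omega> v"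
  shows "weak_gradient \<Omega> (\<lambda>x. u x + c * v x) (\<lambda>x. g x + c *\<^sub>R h x)"
proof (rule weak_gradientI)
  note L2 = weak_gradient_L2[OF assms(1)] weak_gradient_L2[OF assms(2)]
  show "L2_on \<Omega> (\<lambda>x. g x + c *\<^sub>R h x)" by (intro L2_on_add L2_on_scaleR L2)
  fix \<phi> i assume \<phi>: "\<phi> \<in> test_functions \<Omega>"
  note T = L2_on_component(1)[OF test_L2(2)[OF \<phi>], of i] test_L2(1)[OF \<phi>]
  have "integrable (lebesgue_on \<Omega>) (\<lambda>x. u x \<bullet> (cgrad \<phi> x $ i))" "integrable (lebesgue_on \<Omega>) (\<lambda>x. v x \<bullet> (cgrad \<phi> x $ i))"
    "integrable (lebesgue_on \<Omega>) (\<lambda>x. (g x $ i) \<bullet> \<phi> x)" "integrable (lebesgue_on \<Omega>) (\<lambda>x. (h x $ i) \<bullet> \<phi> x)"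
    by (intro L2_on_integrable_inner L2_on_component L2 T assms)+
  then show "(LINT x|lebesgue_on \<Omega>. (u x + c * v x) \<bullet> (cgrad \<phi> x $ i)) = - (LINT x|lebesgue_on \<Omega>. ((g x + c *\<^sub>R h x) $ i) \<bullet> \<phi> x)"
    using weak_gradientD[OF assms(1) \<phi>, of i] weak_gradientD[OF assms(2) \<phi>, of i]
    by (simp add: distrib_right mult.assoc)
qed

section \<open>The spaces \<open>H1\<close> and \<open>H01\<close>\<close>

lemma H1_L2:
  assumes "u \<in> H1 \<Omega>"
  shows "L2_on \<Omega> u" "weak_gradient \<Omega> u (grad \<Omega> u)" "L2_on \<Omega> (grad \<Omega> u)"
proof -
  show "L2_on \<Omega> u" using assms by (simp add: H1_def)
  show "weak_gradient \<Omega> u (grad \<Omega> u)" unfolding grad_def using assms someI_ex[of "weak_gradient \<Omega> u"] by (auto simp: H1_def)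
  then show "L2_on \<Omega> (grad \<Omega> u)" by (rule weak_gradient_L2)
qed

text \<open>The passage from an explicitly known weak gradient to the one chosen by
  \<open>grad\<close>: values can be compared only almost everywhere, but norms agree
  exactly.\<close>

lemma grad_eq:
  assumes "weak_gradient \<Omega> u g" "L2_on \<Omega> u"
  shows "u \<in> H1 \<Omega>" "AE x in lebesgue_on \<Omega>. grad \<Omega> u x = g x" "Lnorm 2 \<Omega> (grad \<Omega> u) = Lnorm 2 \<Omega> g"
proof -
  show u: "u \<in> H1 \<Omega>" using assms by (auto simp: H1_def)
  show AE: "AE x in lebesgue_on \<Omega>. grad \<Omega> u x = g x"
    using H1_L2(2)[OF u] assms(1) by (rule weak_gradient_unique)
  show "Lnorm 2 \<Omega> (grad \<Omega> u) = Lnorm 2 \<Omega> g"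
    using weak_gradient_L2[OF assms(1)] H1_L2(3)[OF u] by (intro Lnorm_cong_AE AE L2_onD)
qed

lemma grad_test_function:
  assumes "\<phi> \<in> test_functions \<Omega>"
  shows "\<phi> \<in> H1 \<Omega>" "AE x in lebesgue_on \<Omega>. grad \<Omega> \<phi> x = cgrad \<phi> x" "Lnorm 2 \<Omega> (grad \<Omega> \<phi>) = Lnorm 2 \<Omega> (cgrad \<phi>)"
  using grad_eq[OF test_L2(3)[OF assms] test_L2(1)[OF assms]] .

lemma H1_add_scaled:
  assumes "u \<in> H1 \<Omega>" "v \<in> H1 \<Omega>"
  shows "(\<lambda>x. u x + c * v x) \<in> H1 \<Omega>"
    "AE x in lebesgue_on \<Omega>. grad \<Omega> (\<lambda>x. u x + c * v x) x = grad \<Omega> u x + c *\<^sub>R grad \<Omega> v x"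
    "Lnorm 2 \<Omega> (grad \<Omega> (\<lambda>x. u x + c * v x)) = Lnorm 2 \<Omega> (\<lambda>x. grad \<Omega> u x + c *\<^sub>R grad \<Omega> v x)"
proof -
  have w: "weak_gradient \<Omega> (\<lambda>x. u x + c * v x) (\<lambda>x. grad \<Omega> u x + c *\<^sub>R grad \<Omega> v x)"
    by (intro weak_gradient_add_scaled H1_L2 assms)
  have L: "L2_on \<Omega> (\<lambda>x. u x + c * v x)"
    using L2_on_add[OF H1_L2(1)[OF assms(1)] L2_on_scaleR[OF H1_L2(1)[OF assms(2)]]] by simp
  show "(\<lambda>x. u x + c * v x) \<in> H1 \<Omega>"
    "AE x in lebesgue_on \<Omega>. grad \<Omega> (\<lambda>x. u x + c * v x) x = grad \<Omega> u x + c *\<^sub>R grad \<Omega> v x"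
    "Lnorm 2 \<Omega> (grad \<Omega> (\<lambda>x. u x + c * v x)) = Lnorm 2 \<Omega> (\<lambda>x. grad \<Omega> u x + c *\<^sub>R grad \<Omega> v x)"
    using grad_eq[OF w L] by auto
qed

lemma H1_diff:
  assumes "u \<in> H1 \<Omega>" "v \<in> H1 \<Omega>"
  shows "(\<lambda>x. u x - v x) \<in> H1 \<Omega>"
    "Lnorm 2 \<Omega> (grad \<Omega> (\<lambda>x. u x - v x)) = Lnorm 2 \<Omega> (\<lambda>x. grad \<Omega> u x - grad \<Omega> v x)"
  using H1_add_scaled[OF assms, of "-1"] by auto

lemma H1_norm_le: "H1_norm \<Omega> u \<le> Lnorm 2 \<Omega> u + Lnorm 2 \<Omega> (grad \<Omega> u)"
  unfolding H1_norm_def by (rule sqrt_sum_squares_le_sum) (auto simp: Lnorm_nonneg)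

lemma H1_norm_ge: "Lnorm 2 \<Omega> u \<le> H1_norm \<Omega> u" "Lnorm 2 \<Omega> (grad \<Omega> u) \<le> H1_norm \<Omega> u"
  unfolding H1_norm_def by (auto intro: real_le_rsqrt)

lemma H01_H1: "u \<in> H01 \<Omega> \<Longrightarrow> u \<in> H1 \<Omega>"
  by (simp add: H01_def H1_closure_def)

lemma test_function_H01: "\<phi> \<in> test_functions \<Omega> \<Longrightarrow> \<phi> \<in> H01 \<Omega>"
proof -
  assume \<phi>: "\<phi> \<in> test_functions \<Omega>"
  have "weak_gradient \<Omega> (\<lambda>x. \<phi> x - \<phi> x) (\<lambda>x. cgrad \<phi> x - cgrad \<phi> x)"
    using weak_gradient_add_scaled[OF test_L2(3)[OF \<phi>] test_L2(3)[OF \<phi>] test_L2(1)[OF \<phi>] test_L2(1)[OF \<phi>], of "-1"] by simp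
  then have "Lnorm 2 \<Omega> (grad \<Omega> (\<lambda>x. 0)) = Lnorm 2 \<Omega> (\<lambda>x. 0::pt)"
    using grad_eq(3)[of "\<lambda>x. 0" "\<lambda>x. 0"] by (simp add: L2_on_def)
  then have "H1_norm \<Omega> (\<lambda>x. \<phi> x - \<phi> x) = 0"
    by (simp add: H1_norm_def Lnorm_2)
  then show "\<phi> \<in> H01 \<Omega>"
    using \<phi> grad_test_function(1)[OF \<phi>] unfolding H01_def H1_closure_def by force
qed

lemma subset_H1_closure:
  assumes "A \<subseteq> H1 \<Omega>"
  shows "A \<subseteq> H1_closure \<Omega> A"
proof
  fix u assume u: "u \<in> A"
  then have "u \<in> H1 \<Omega>" using assms by blast
  then have "Lnorm 2 \<Omega> (grad \<Omega> (\<lambda>x. u x - u x)) = Lnorm 2 \<Omega> (\<lambda>x. grad \<Omega> u x - grad \<Omega> u x)"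
    by (intro H1_diff)
  then have "H1_norm \<Omega> (\<lambda>x. u x - u x) = 0"
    by (simp add: H1_norm_def Lnorm_2)
  then show "u \<in> H1_closure \<Omega> A"
    using u \<open>u \<in> H1 \<Omega>\<close> unfolding H1_closure_def by force
qed

lemma H01_approx:
  assumes "u \<in> H01 \<Omega>" "0 < e"
  obtains \<phi> where "\<phi> \<in> test_functions \<Omega>" "Lnorm 2 \<Omega> (\<lambda>x. u x - \<phi> x) < e"
    "Lnorm 2 \<Omega> (\<lambda>x. grad \<Omega> u x - grad \<Omega> \<phi> x) < e"
proof -
  obtain \<phi> where \<phi>: "\<phi> \<in> test_functions \<Omega>" "H1_norm \<Omega> (\<lambda>x. u x - \<phi> x) < e"
    using assms by (auto simp: H01_def H1_closure_def)
  have "Lnorm 2 \<Omega> (\<lambda>x. grad \<Omega> u x - grad \<Omega> \<phi> x) = Lnorm 2 \<Omega> (grad \<Omega> (\<lambda>x. u x - \<phi> x))"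
    using H1_diff(2)[OF H01_H1[OF assms(1)] grad_test_function(1)[OF \<phi>(1)]] by simp
  then show thesis
    using \<phi> H1_norm_ge[of "\<lambda>x. u x - \<phi> x"] by (intro that[of \<phi>]) auto
qed

lemma H01_I:
  assumes "u \<in> H1 \<Omega>"
    and "\<And>e. 0 < e \<Longrightarrow> \<exists>\<phi>\<in>test_functions \<Omega>. Lnorm 2 \<Omega> (\<lambda>x. u x - \<phi> x) < e \<and>
      Lnorm 2 \<Omega> (\<lambda>x. grad \<Omega> u x - grad \<Omega> \<phi> x) < e"
  shows "u \<in> H01 \<Omega>"
proof -
  have "\<exists>\<phi>\<in>test_functions \<Omega>. H1_norm \<Omega> (\<lambda>x. u x - \<phi> x) < e" if e: "0 < e" for e
  proof -
    obtain \<phi> where \<phi>: "\<phi> \<in> test_functions \<Omega>" "Lnorm 2 \<Omega> (\<lambda>x. u x - \<phi> x) < e/2"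
      "Lnorm 2 \<Omega> (\<lambda>x. grad \<Omega> u x - grad \<Omega> \<phi> x) < e/2"
      using assms(2)[of "e/2"] e by auto
    then have "H1_norm \<Omega> (\<lambda>x. u x - \<phi> x) < e"
      using H1_norm_le[of "\<lambda>x. u x - \<phi> x"] H1_diff(2)[OF assms(1) grad_test_function(1)[OF \<phi>(1)]] by simp
    then show ?thesis using \<phi>(1) by blast
  qed
  then show ?thesis using assms(1) by (auto simp: H01_def H1_closure_def)
qed

text \<open>Both sides of the defining identity are L2 pairings with a fixed function, so by
  Cauchy-Schwarz they pass to the limit.\<close>

lemma weak_gradient_closed:
  assumes v: "\<And>n. v n \<in> H1 \<Omega>" and u: "L2_on \<Omega> u" and g: "L2_on \<Omega> g"
    and conv: "(\<lambda>n. Lnorm 2 \<Omega> (\<lambda>x. v n x - u x)) \<longlonglongrightarrow> 0"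
      "(\<lambda>n. Lnorm 2 \<Omega> (\<lambda>x. grad \<Omega> (v n) x - g x)) \<longlonglongrightarrow> 0"
  shows "weak_gradient \<Omega> u g"
proof (rule weak_gradientI[OF g])
  have lim: "(\<lambda>n. LINT x|lebesgue_on \<Omega>. f n x \<bullet> h x) \<longlonglongrightarrow> (LINT x|lebesgue_on \<Omega>. F x \<bullet> h x)"
    if "\<And>n. L2_on \<Omega> (f n)" "L2_on \<Omega> F" "L2_on \<Omega> h" "(\<lambda>n. Lnorm 2 \<Omega> (\<lambda>x. f n x - F x)) \<longlonglongrightarrow> 0"
    for f :: "nat \<Rightarrow> pt \<Rightarrow> real" and F h
  proof (rule LIM_zero_cancel, rule Lim_null_comparison)
    show "(\<lambda>n. Lnorm 2 \<Omega> (\<lambda>x. f n x - F x) * Lnorm 2 \<Omega> h) \<longlonglongrightarrow> 0"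
      by (rule tendsto_mult_left_zero[OF that(4)])
    have "norm ((LINT x|lebesgue_on \<Omega>. f n x \<bullet> h x) - (LINT x|lebesgue_on \<Omega>. F x \<bullet> h x)) \<le> Lnorm 2 \<Omega> (\<lambda>x. f n x - F x) * Lnorm 2 \<Omega> h" for n
    proof -
      have "(LINT x|lebesgue_on \<Omega>. f n x \<bullet> h x) - (LINT x|lebesgue_on \<Omega>. F x \<bullet> h x) = (LINT x|lebesgue_on \<Omega>. (f n x - F x) \<bullet> h x)"
        unfolding inner_diff_left
        by (rule Bochner_Integration.integral_diff[symmetric]; intro L2_on_integrable_inner that)
      then show ?thesis
        using L2_on_Cauchy_Schwarz[OF L2_on_diff[OF that(1,2)] that(3)] by simp
    qed
    then show "\<forall>\<^sub>F n in sequentially. norm ((LINT x|lebesgue_on \<Omega>. f n x \<bullet> h x) - (LINT x|lebesgue_on \<Omega>. F x \<bullet> h x)) \<le> Lnorm 2 \<Omega> (\<lambda>x. f n x - F x) * Lnorm 2 \<Omega> h"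
      by simp
  qed
  fix \<phi> i assume \<phi>: "\<phi> \<in> test_functions \<Omega>"
  have "(\<lambda>n. LINT x|lebesgue_on \<Omega>. v n x \<bullet> (cgrad \<phi> x $ i)) \<longlonglongrightarrow> (LINT x|lebesgue_on \<Omega>. u x \<bullet> (cgrad \<phi> x $ i))"
    by (intro lim H1_L2 v u conv L2_on_component test_L2 \<phi>)
  moreover have "(\<lambda>n. LINT x|lebesgue_on \<Omega>. (grad \<Omega> (v n) x $ i) \<bullet> \<phi> x) \<longlonglongrightarrow> (LINT x|lebesgue_on \<Omega>. (g x $ i) \<bullet> \<phi> x)"
  proof (rule lim)
    show "(\<lambda>n. Lnorm 2 \<Omega> (\<lambda>x. grad \<Omega> (v n) x $ i - g x $ i)) \<longlonglongrightarrow> 0"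
      by (rule tendsto_sandwich[OF _ _ tendsto_const conv(2)])
        (use L2_on_component(2)[OF L2_on_diff[OF H1_L2(3)[OF v] g]] in \<open>auto simp: Lnorm_nonneg\<close>)
  qed (intro H1_L2 v L2_on_component g test_L2 \<phi>)+
  then have "(\<lambda>n. - (LINT x|lebesgue_on \<Omega>. (grad \<Omega> (v n) x $ i) \<bullet> \<phi> x)) \<longlonglongrightarrow> - (LINT x|lebesgue_on \<Omega>. (g x $ i) \<bullet> \<phi> x)"
    by (rule tendsto_minus)
  ultimately show "(LINT x|lebesgue_on \<Omega>. u x \<bullet> (cgrad \<phi> x $ i)) = - (LINT x|lebesgue_on \<Omega>. (g x $ i) \<bullet> \<phi> x)"
    unfolding weak_gradientD[OF H1_L2(2)[OF v] \<phi>] by (rule LIMSEQ_unique)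
qed

text \<open>Functions and gradients converge separately in L2. Closedness of the weak gradient
  identifies the second limit as the gradient of the first, and test functions close to some
  \<open>v n\<close> are close to the limit.\<close>

lemma H01_complete:
  assumes v: "\<And>n. v n \<in> H01 \<Omega>"
    and CM: "\<And>e. 0 < e \<Longrightarrow> \<exists>N. \<forall>m\<ge>N. \<forall>n\<ge>N. Lnorm 2 \<Omega> (\<lambda>x. v m x - v n x) < e"
    and CG: "\<And>e. 0 < e \<Longrightarrow> \<exists>N. \<forall>m\<ge>N. \<forall>n\<ge>N. Lnorm 2 \<Omega> (\<lambda>x. grad \<Omega> (v m) x - grad \<Omega> (v n) x) < e"
  obtains u where "u \<in> H01 \<Omega>" "(\<lambda>n. Lnorm 2 \<Omega> (\<lambda>x. v n x - u x)) \<longlonglongrightarrow> 0"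
    "(\<lambda>n. Lnorm 2 \<Omega> (\<lambda>x. grad \<Omega> (v n) x - grad \<Omega> u x)) \<longlonglongrightarrow> 0"
proof -
  note vL = H1_L2[OF H01_H1[OF v]]
  obtain u where u: "L2_on \<Omega> u" "(\<lambda>n. Lnorm 2 \<Omega> (\<lambda>x. v n x - u x)) \<longlonglongrightarrow> 0"
    by (rule L2_complete[OF vL(1) dom_lmeasurable CM])
  obtain g where g: "L2_on \<Omega> g" "(\<lambda>n. Lnorm 2 \<Omega> (\<lambda>x. grad \<Omega> (v n) x - g x)) \<longlonglongrightarrow> 0"
    by (rule L2_complete[OF vL(3) dom_lmeasurable CG])
  have w: "weak_gradient \<Omega> u g"
    by (rule weak_gradient_closed[OF H01_H1[OF v] u(1) g(1) u(2) g(2)])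
  note uH = grad_eq[OF w u(1)]
  have eq: "Lnorm 2 \<Omega> (\<lambda>x. f x - grad \<Omega> u x) = Lnorm 2 \<Omega> (\<lambda>x. f x - g x)" if "L2_on \<Omega> f" for f
    using uH(2) by (intro Lnorm_cong_AE L2_onD(1) L2_on_diff that g H1_L2(3) uH) auto
  have g': "(\<lambda>n. Lnorm 2 \<Omega> (\<lambda>x. grad \<Omega> (v n) x - grad \<Omega> u x)) \<longlonglongrightarrow> 0"
    using g(2) by (simp add: eq[OF vL(3)])
  have "u \<in> H01 \<Omega>"
  proof (rule H01_I[OF uH(1)])
    fix e :: real assume e: "0 < e"
    have "\<forall>\<^sub>F n in sequentially. Lnorm 2 \<Omega> (\<lambda>x. v n x - u x) < e/2 \<and> Lnorm 2 \<Omega> (\<lambda>x. grad \<Omega> (v n) x - grad \<Omega> u x) < e/2"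
      using order_tendstoD(2)[OF u(2), of "e/2"] order_tendstoD(2)[OF g', of "e/2"] e by (intro eventually_conj) auto
    then obtain n where n: "Lnorm 2 \<Omega> (\<lambda>x. v n x - u x) < e/2" "Lnorm 2 \<Omega> (\<lambda>x. grad \<Omega> (v n) x - grad \<Omega> u x) < e/2"
      by (auto dest: eventually_happens)
    obtain \<phi> where \<phi>: "\<phi> \<in> test_functions \<Omega>" "Lnorm 2 \<Omega> (\<lambda>x. v n x - \<phi> x) < e/2" "Lnorm 2 \<Omega> (\<lambda>x. grad \<Omega> (v n) x - grad \<Omega> \<phi> x) < e/2"
      using H01_approx[OF v, of "e/2" n] e by auto
    note pL = H1_L2[OF grad_test_function(1)[OF \<phi>(1)]]
    have "Lnorm 2 \<Omega> (\<lambda>x. u x - \<phi> x) < e"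
      using Lnorm_2_triangle_diff[OF u(1) vL(1)[of n] pL(1)] Lnorm_2_minus[of \<Omega> u "v n"] n \<phi> by linarith
    moreover have "Lnorm 2 \<Omega> (\<lambda>x. grad \<Omega> u x - grad \<Omega> \<phi> x) < e"
      using Lnorm_2_triangle_diff[OF H1_L2(3)[OF uH(1)] vL(3)[of n] pL(3)] Lnorm_2_minus[of \<Omega> "grad \<Omega> u" "grad \<Omega> (v n)"] n \<phi> by linarith
    ultimately show "\<exists>\<phi>\<in>test_functions \<Omega>. Lnorm 2 \<Omega> (\<lambda>x. u x - \<phi> x) < e \<and> Lnorm 2 \<Omega> (\<lambda>x. grad \<Omega> u x - grad \<Omega> \<phi> x) < e"
      using \<phi>(1) by blast
  qed
  then show thesis using u(2) g' by (rule that)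
qed

lemma H01_add_scaled:
  assumes "u \<in> H01 \<Omega>" "v \<in> H01 \<Omega>"
  shows "(\<lambda>x. u x + c * v x) \<in> H01 \<Omega>"
proof (rule H01_I[OF H1_add_scaled(1)[OF assms[THEN H01_H1]]])
  fix e :: real assume e: "0 < e"
  \<comment> \<open>Errors below \<open>d\<close> in both functions combine to less than
    \<open>d + \<bar>c\<bar> * d = e\<close>.\<close>
  define d where "d = e / (1 + \<bar>c\<bar>)"
  have d: "0 < d" "d + \<bar>c\<bar> * d = e"
  proof -
    have "1 + \<bar>c\<bar> \<noteq> 0" by linarith
    then have "(1 + \<bar>c\<bar>) * d = e" by (simp add: d_def)
    then show "d + \<bar>c\<bar> * d = e" by (simp add: distrib_right)
  qed (use e in \<open>simp add: d_def\<close>)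
  obtain \<phi> where \<phi>: "\<phi> \<in> test_functions \<Omega>" "Lnorm 2 \<Omega> (\<lambda>x. u x - \<phi> x) < d" "Lnorm 2 \<Omega> (\<lambda>x. grad \<Omega> u x - grad \<Omega> \<phi> x) < d"
    by (rule H01_approx[OF assms(1) d(1)])
  obtain \<psi> where \<psi>: "\<psi> \<in> test_functions \<Omega>" "Lnorm 2 \<Omega> (\<lambda>x. v x - \<psi> x) < d" "Lnorm 2 \<Omega> (\<lambda>x. grad \<Omega> v x - grad \<Omega> \<psi> x) < d"
    by (rule H01_approx[OF assms(2) d(1)])
  let ?w = "\<lambda>x. u x + c * v x" and ?t = "\<lambda>x. \<phi> x + c * \<psi> x"
  have t: "?t \<in> test_functions \<Omega>" by (intro test_functions_add test_functions_scale \<phi> \<psi>)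
  note uL = H1_L2[OF H01_H1[OF assms(1)]] and vL = H1_L2[OF H01_H1[OF assms(2)]]
    and pL = H1_L2[OF grad_test_function(1)[OF \<phi>(1)]] and qL = H1_L2[OF grad_test_function(1)[OF \<psi>(1)]]
  have bound: "Lnorm 2 \<Omega> (\<lambda>x. (f x - f' x) + c *\<^sub>R (g x - g' x)) < e"
    if "L2_on \<Omega> f" "L2_on \<Omega> f'" "L2_on \<Omega> g" "L2_on \<Omega> g'"
      "Lnorm 2 \<Omega> (\<lambda>x. f x - f' x) < d" "Lnorm 2 \<Omega> (\<lambda>x. g x - g' x) < d" for f f' g g' :: "pt \<Rightarrow> 'b::euclidean_space"
  proof -
    have "Lnorm 2 \<Omega> (\<lambda>x. (f x - f' x) + c *\<^sub>R (g x - g' x)) \<le> Lnorm 2 \<Omega> (\<lambda>x. f x - f' x) + \<bar>c\<bar> * Lnorm 2 \<Omega> (\<lambda>x. g x - g' x)"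
      using Lnorm_2_triangle[OF L2_on_diff[OF that(1,2)] L2_on_scaleR[OF L2_on_diff[OF that(3,4)], of c]]
      by (simp add: Lnorm_scaleR)
    also have "\<dots> < d + \<bar>c\<bar> * d"
      using that by (intro add_less_le_mono mult_left_mono) auto
    finally show ?thesis using d by simp
  qed
  have "Lnorm 2 \<Omega> (\<lambda>x. ?w x - ?t x) = Lnorm 2 \<Omega> (\<lambda>x. (u x - \<phi> x) + c *\<^sub>R (v x - \<psi> x))"
    by (simp add: algebra_simps)
  then have 1: "Lnorm 2 \<Omega> (\<lambda>x. ?w x - ?t x) < e"
    using bound[OF uL(1) pL(1) vL(1) qL(1) \<phi>(2) \<psi>(2)] by simp
  have "Lnorm 2 \<Omega> (\<lambda>x. grad \<Omega> ?w x - grad \<Omega> ?t x) =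
    Lnorm 2 \<Omega> (\<lambda>x. (grad \<Omega> u x - grad \<Omega> \<phi> x) + c *\<^sub>R (grad \<Omega> v x - grad \<Omega> \<psi> x))"
  proof (rule Lnorm_cong_AE)
    show "AE x in lebesgue_on \<Omega>. grad \<Omega> ?w x - grad \<Omega> ?t x = (grad \<Omega> u x - grad \<Omega> \<phi> x) + c *\<^sub>R (grad \<Omega> v x - grad \<Omega> \<psi> x)"
      using H1_add_scaled(2)[OF assms[THEN H01_H1], of c]
        H1_add_scaled(2)[OF grad_test_function(1)[OF \<phi>(1)] grad_test_function(1)[OF \<psi>(1)], of c]
      by eventually_elim (simp add: algebra_simps)
  qed (intro L2_onD(1) L2_on_diff L2_on_add L2_on_scaleR uL vL pL qL H1_L2 H1_add_scaled assms[THEN H01_H1]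
      grad_test_function \<phi> \<psi>)+
  then have 2: "Lnorm 2 \<Omega> (\<lambda>x. grad \<Omega> ?w x - grad \<Omega> ?t x) < e"
    using bound[OF uL(3) pL(3) vL(3) qL(3) \<phi>(3) \<psi>(3)] by simp
  show "\<exists>\<phi>\<in>test_functions \<Omega>. Lnorm 2 \<Omega> (\<lambda>x. ?w x - \<phi> x) < e \<and> Lnorm 2 \<Omega> (\<lambda>x. grad \<Omega> ?w x - grad \<Omega> \<phi> x) < e"
    using 1 2 by (intro bexI[OF _ t] conjI)
qed

end

subsection \<open>The Poincare inequality and compactness\<close>

lemma nn_integral_lborel_shift:
  fixes c :: "'a::euclidean_space"
  assumes "F \<in> borel_measurable borel"
  shows "(\<integral>\<^sup>+x. F (x + c) \<partial>lborel) = (\<integral>\<^sup>+x. F x \<partial>lborel)"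
proof -
  have "(\<integral>\<^sup>+x. F x \<partial>lborel) = (\<integral>\<^sup>+x. F x \<partial>distr lborel borel ((+) c))"
    by (simp add: lborel_distr_plus)
  also have "\<dots> = (\<integral>\<^sup>+x. F (x + c) \<partial>lborel)"
    using assms by (subst nn_integral_distr) (auto simp: add.commute)
  finally show ?thesis by simp
qed

text \<open>Cauchy-Schwarz on the unit interval in variance form: \<open>m\<close> is the mean of
  \<open>f'\<close>, and the integral of \<open>(f' t - m)\<^sup>2\<close> is nonnegative.\<close>

lemma square_increment_le_integral:
  fixes f f' :: "real \<Rightarrow> real"
  assumes "\<And>t. (f has_real_derivative f' t) (at t)" "continuous_on UNIV f'"
  shows "ennreal ((f 1 - f 0)\<^sup>2) \<le> (\<integral>\<^sup>+t. ennreal ((f' t)\<^sup>2) * indicator {0..1} t \<partial>lborel)"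
proof -
  define m where "m = f 1 - f 0"
  have c: "continuous_on {0..1} f'" using assms(2) continuous_on_subset by blast
  have i1: "integrable lborel (\<lambda>t. indicator {0..1} t *\<^sub>R f' t)"
    and i2: "integrable lborel (\<lambda>t. indicator {0..1} t *\<^sub>R (f' t)\<^sup>2)"
    and i3: "integrable lborel (\<lambda>t. indicator {0..1::real} t *\<^sub>R (1::real))"
    by (intro borel_integrable_compact continuous_intros c compact_Icc)+
  have m: "(LINT t|lborel. indicator {0..1} t *\<^sub>R f' t) = m"
    unfolding m_def using assms(1)
    by (intro integral_FTC_atLeastAtMost c)
      (auto simp: has_real_derivative_iff_has_vector_derivative intro: has_vector_derivative_at_within)
  have "0 \<le> (LINT t|lborel. indicator {0..1} t *\<^sub>R (f' t - m)\<^sup>2)"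
    by (intro integral_nonneg_AE) auto
  also have "\<dots> = (LINT t|lborel. indicator {0..1} t *\<^sub>R (f' t)\<^sup>2 - 2 * m * (indicator {0..1} t *\<^sub>R f' t) + m\<^sup>2 * (indicator {0..1} t *\<^sub>R (1::real)))"
    by (intro Bochner_Integration.integral_cong) (auto simp: indicator_def power2_eq_square algebra_simps)
  also have "\<dots> = (LINT t|lborel. indicator {0..1} t *\<^sub>R (f' t)\<^sup>2) - 2 * m * m + m\<^sup>2 * 1"
    using i1 i2 i3 m by simp
  finally have "m\<^sup>2 \<le> (LINT t|lborel. indicator {0..1} t *\<^sub>R (f' t)\<^sup>2)"
    by (simp add: power2_eq_square)
  then have "ennreal (m\<^sup>2) \<le> ennreal (LINT t|lborel. indicator {0..1} t *\<^sub>R (f' t)\<^sup>2)"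
    by (rule ennreal_leI)
  also have "\<dots> = (\<integral>\<^sup>+t. ennreal (indicator {0..1} t *\<^sub>R (f' t)\<^sup>2) \<partial>lborel)"
    by (rule nn_integral_eq_integral[symmetric, OF i2]) auto
  also have "\<dots> = (\<integral>\<^sup>+t. ennreal ((f' t)\<^sup>2) * indicator {0..1} t \<partial>lborel)"
    by (intro nn_integral_cong) (auto simp: indicator_def)
  finally show ?thesis by (simp add: m_def)
qed

lemma test_function_line_derivative:
  assumes "f \<in> test_functions \<Omega>"
  shows "((\<lambda>t. f (x + t *\<^sub>R v)) has_real_derivative (cgrad f (x + t *\<^sub>R v) \<bullet> v)) (at t)"
proof -
  have "((\<lambda>t. x + t *\<^sub>R v) has_derivative (\<lambda>t. t *\<^sub>R v)) (at t)"
    by (auto intro!: derivative_eq_intros)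
  then have "((\<lambda>t. f (x + t *\<^sub>R v)) has_derivative (\<lambda>s. cgrad f (x + t *\<^sub>R v) \<bullet> (s *\<^sub>R v))) (at t)"
    by (rule has_derivative_compose[OF _ test_function_has_derivative[OF assms]])
  moreover have "(\<lambda>s. cgrad f (x + t *\<^sub>R v) \<bullet> (s *\<^sub>R v)) = (*) (cgrad f (x + t *\<^sub>R v) \<bullet> v)" by auto
  ultimately show ?thesis by (simp only: has_field_derivative_def)
qed

lemma test_function_borel:
  assumes "f \<in> test_functions \<Omega>"
  shows "f \<in> borel_measurable borel" "cgrad f \<in> borel_measurable borel"
  using continuous_on_test_function[OF assms] by (auto intro: borel_measurable_continuous_onI)

context bounded_open
begin

lemma nn_integral_test_function_sq:
  assumes "\<phi> \<in> test_functions \<Omega>"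
  shows "(\<integral>\<^sup>+x. ennreal ((\<phi> x)\<^sup>2) \<partial>lborel) = ennreal ((Lnorm 2 \<Omega> \<phi>)\<^sup>2)"
    "(\<integral>\<^sup>+x. ennreal ((norm (cgrad \<phi> x))\<^sup>2) \<partial>lborel) = ennreal ((Lnorm 2 \<Omega> (cgrad \<phi>))\<^sup>2)"
    "integrable lborel (\<lambda>x. (\<phi> x)\<^sup>2)" "integrable lborel \<phi>"
proof -
  obtain K where K: "compact K" "K \<subseteq> \<Omega>" "\<And>x. x \<notin> K \<Longrightarrow> \<phi> x = 0" "\<And>x. x \<notin> K \<Longrightarrow> cgrad \<phi> x = 0"
    using test_function_support[OF assms] by blast
  note c = continuous_on_test_function[OF assms]
  have "continuous_on UNIV (\<lambda>x. (\<phi> x)\<^sup>2)" "continuous_on UNIV (\<lambda>x. (norm (cgrad \<phi> x))\<^sup>2)"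
    by (intro continuous_intros c)+
  then have i: "integrable lborel (\<lambda>x. (\<phi> x)\<^sup>2)" "integrable lborel (\<lambda>x. (norm (cgrad \<phi> x))\<^sup>2)"
    using K by (auto intro: compact_support_integrable[OF _ K(1)])
  show "(\<integral>\<^sup>+x. ennreal ((\<phi> x)\<^sup>2) \<partial>lborel) = ennreal ((Lnorm 2 \<Omega> \<phi>)\<^sup>2)"
    "(\<integral>\<^sup>+x. ennreal ((norm (cgrad \<phi> x))\<^sup>2) \<partial>lborel) = ennreal ((Lnorm 2 \<Omega> (cgrad \<phi>))\<^sup>2)"
    unfolding test_function_L2(3,4)[OF assms dom_sets] by (intro nn_integral_eq_integral i; simp)+
  show "integrable lborel (\<lambda>x. (\<phi> x)\<^sup>2)" by (rule i)
  show "integrable lborel \<phi>" using compact_support_integrable[OF c(1) K(1,3)] .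
qed

text \<open>The squared increment along the segment from x to x + h is bounded by the integral of
  the squared directional derivative over the segment. Fubini and translation invariance in x then
  remove the dependence on the position t.\<close>

lemma translation_estimate:
  assumes \<phi>: "\<phi> \<in> test_functions \<Omega>"
  shows "(\<integral>\<^sup>+x. ennreal ((\<phi> (x + h) - \<phi> x)\<^sup>2) \<partial>lborel) \<le> ennreal ((norm h)\<^sup>2 * (Lnorm 2 \<Omega> (cgrad \<phi>))\<^sup>2)"
proof -
  note [measurable] = test_function_borel[OF \<phi>]
  have cont: "continuous_on UNIV (\<lambda>t. cgrad \<phi> (x + t *\<^sub>R h) \<bullet> h)" for x
    by (intro continuous_intros continuous_on_compose2[OF continuous_on_test_function(2)[OF \<phi>]]) auto
  have "(\<integral>\<^sup>+x. ennreal ((\<phi> (x + h) - \<phi> x)\<^sup>2) \<partial>lborel) \<le>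
    (\<integral>\<^sup>+x. \<integral>\<^sup>+t. ennreal ((cgrad \<phi> (x + t *\<^sub>R h) \<bullet> h)\<^sup>2) * indicator {0..1} t \<partial>lborel \<partial>lborel)"
    using square_increment_le_integral[OF test_function_line_derivative[OF \<phi>] cont]
    by (intro nn_integral_mono) simp
  also have "\<dots> = (\<integral>\<^sup>+t. \<integral>\<^sup>+x. ennreal ((cgrad \<phi> (x + t *\<^sub>R h) \<bullet> h)\<^sup>2) * indicator {0..1} t \<partial>lborel \<partial>lborel)"
    by (rule lborel_pair.Fubini'[symmetric]) measurable
  also have "\<dots> = (\<integral>\<^sup>+t. (\<integral>\<^sup>+x. ennreal ((cgrad \<phi> x \<bullet> h)\<^sup>2) \<partial>lborel) * indicator {0..1} (t::real) \<partial>lborel)"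
  proof (intro nn_integral_cong)
    fix t :: real
    have "(\<integral>\<^sup>+x. ennreal ((cgrad \<phi> (x + t *\<^sub>R h) \<bullet> h)\<^sup>2) * indicator {0..1} t \<partial>lborel)
      = (\<integral>\<^sup>+x. ennreal ((cgrad \<phi> (x + t *\<^sub>R h) \<bullet> h)\<^sup>2) \<partial>lborel) * indicator {0..1} t"
      by (intro nn_integral_multc) measurable
    also have "(\<integral>\<^sup>+x. ennreal ((cgrad \<phi> (x + t *\<^sub>R h) \<bullet> h)\<^sup>2) \<partial>lborel) = (\<integral>\<^sup>+x. ennreal ((cgrad \<phi> x \<bullet> h)\<^sup>2) \<partial>lborel)"
      by (rule nn_integral_lborel_shift[where F="\<lambda>x. ennreal ((cgrad \<phi> x \<bullet> h)\<^sup>2)"]) measurable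
    finally show "(\<integral>\<^sup>+x. ennreal ((cgrad \<phi> (x + t *\<^sub>R h) \<bullet> h)\<^sup>2) * indicator {0..1} t \<partial>lborel)
      = (\<integral>\<^sup>+x. ennreal ((cgrad \<phi> x \<bullet> h)\<^sup>2) \<partial>lborel) * indicator {0..1} t" .
  qed
  also have "\<dots> = (\<integral>\<^sup>+x. ennreal ((cgrad \<phi> x \<bullet> h)\<^sup>2) \<partial>lborel)"
    by (simp add: nn_integral_cmult)
  also have "\<dots> \<le> (\<integral>\<^sup>+x. ennreal ((norm h)\<^sup>2) * ennreal ((norm (cgrad \<phi> x))\<^sup>2) \<partial>lborel)"
  proof (intro nn_integral_mono)
    fix x
    have "\<bar>cgrad \<phi> x \<bullet> h\<bar>\<^sup>2 \<le> (norm (cgrad \<phi> x) * norm h)\<^sup>2"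
      by (intro power_mono Cauchy_Schwarz_ineq2) simp
    then show "ennreal ((cgrad \<phi> x \<bullet> h)\<^sup>2) \<le> ennreal ((norm h)\<^sup>2) * ennreal ((norm (cgrad \<phi> x))\<^sup>2)"
      by (simp add: power_mult_distrib mult.commute flip: ennreal_mult)
  qed
  also have "\<dots> = ennreal ((norm h)\<^sup>2 * (Lnorm 2 \<Omega> (cgrad \<phi>))\<^sup>2)"
    by (simp add: nn_integral_cmult nn_integral_test_function_sq[OF \<phi>] ennreal_mult)
  finally show ?thesis .
qed

text \<open>Translating by more than the diameter of the domain separates the supports.\<close>

lemma Poincare_test_function:
  "\<exists>C>0. \<forall>\<phi>\<in>test_functions \<Omega>. Lnorm 2 \<Omega> \<phi> \<le> C * Lnorm 2 \<Omega> (cgrad \<phi>)"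
proof -
  obtain R where R: "0 < R" "\<And>x. x \<in> \<Omega> \<Longrightarrow> norm x \<le> R"
    using bounded_dom by (auto simp: bounded_pos)
  \<comment> \<open>Two points of \<Omega> have distance at most \<open>2 * R\<close>, so a shift of
    length \<open>3 * R\<close> moves every point of \<Omega> outside it.\<close>
  define h :: pt where "h = (3 * R) *\<^sub>R axis 1 1"
  have h: "norm h = 3 * R" using R by (simp add: h_def)
  have "Lnorm 2 \<Omega> \<phi> \<le> 3 * R * Lnorm 2 \<Omega> (cgrad \<phi>)" if \<phi>: "\<phi> \<in> test_functions \<Omega>" for \<phi>
  proof (rule power2_le_imp_le)
    note [measurable] = test_function_borel[OF \<phi>]
    have out: "\<phi> x = 0" if "x \<notin> \<Omega>" for x
      using test_function_support[OF \<phi>] that by blast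
    have sep: "(\<phi> x)\<^sup>2 \<le> (\<phi> (x + h) - \<phi> x)\<^sup>2" for x
    proof (cases "x \<in> \<Omega>")
      case True
      have "x + h \<notin> \<Omega>"
      proof
        assume "x + h \<in> \<Omega>"
        then show False
          using R(1) R(2)[of "x + h"] R(2)[OF True] h norm_triangle_ineq4[of "x + h" x] by simp
      qed
      then show ?thesis using out by simp
    qed (simp add: out)
    have "ennreal ((Lnorm 2 \<Omega> \<phi>)\<^sup>2) \<le> (\<integral>\<^sup>+x. ennreal ((\<phi> (x + h) - \<phi> x)\<^sup>2) \<partial>lborel)"
      unfolding nn_integral_test_function_sq(1)[OF \<phi>, symmetric]
      by (intro nn_integral_mono ennreal_leI sep)
    also have "\<dots> \<le> ennreal ((norm h)\<^sup>2 * (Lnorm 2 \<Omega> (cgrad \<phi>))\<^sup>2)"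
      by (rule translation_estimate[OF \<phi>])
    finally show "(Lnorm 2 \<Omega> \<phi>)\<^sup>2 \<le> (3 * R * Lnorm 2 \<Omega> (cgrad \<phi>))\<^sup>2"
      by (simp add: h power_mult_distrib)
  qed (use R in \<open>simp add: Lnorm_nonneg\<close>)
  then show ?thesis using R by (intro exI[of _ "3 * R"]) auto
qed

end

section \<open>Grid cells and the oscillation of a function on them\<close>

definition grid_cell :: "real \<Rightarrow> (3 \<Rightarrow> int) \<Rightarrow> pt set" where
  "grid_cell s k = {x. \<forall>i. \<lfloor>x $ i / s\<rfloor> = k i}"

text \<open>The cells are half-open cubes, so that every point lies in exactly one of them and sums
  over cells count nothing twice.\<close>

lemma grid_cell_iff:
  assumes "0 < s"
  shows "x \<in> grid_cell s k \<longleftrightarrow> (\<forall>i. s * of_int (k i) \<le> x $ i \<and> x $ i < s * of_int (k i) + s)"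
  using assms by (auto simp: grid_cell_def floor_eq_iff field_simps)

lemma sets_grid_cell [measurable]: "grid_cell s k \<in> sets borel"
proof -
  have "grid_cell s k = (\<Inter>i. (\<lambda>x. \<lfloor>x \<bullet> axis i 1 / s\<rfloor>) -` {k i} \<inter> space borel)"
    by (auto simp: grid_cell_def inner_axis)
  also have "\<dots> \<in> sets borel"
    by (intro sets.finite_INT measurable_sets[of _ _ "count_space UNIV"]) auto
  finally show ?thesis .
qed

lemma emeasure_lborel_cube:
  fixes a :: pt
  assumes "0 \<le> s"
  shows "emeasure lborel (box a (a + (\<chi> i. s))) = ennreal (s ^ 3)" "emeasure lborel (cbox a (a + (\<chi> i. s))) = ennreal (s ^ 3)"
proof -
  have "(\<Prod>b\<in>(Basis::pt set). (\<chi> i. s) \<bullet> b) = (\<Prod>b\<in>(Basis::pt set). s)"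
    by (intro prod.cong) (auto simp: Basis_vec_def inner_axis)
  moreover have "a \<bullet> b \<le> (a + (\<chi> i. s)) \<bullet> b" if "b \<in> Basis" for b
    using that assms by (auto simp: Basis_vec_def inner_axis inner_add_left)
  ultimately show "emeasure lborel (box a (a + (\<chi> i. s))) = ennreal (s ^ 3)" "emeasure lborel (cbox a (a + (\<chi> i. s))) = ennreal (s ^ 3)"
    by (simp_all add: emeasure_lborel_box emeasure_lborel_cbox)
qed

lemma emeasure_grid_cell:
  assumes "0 < s"
  shows "emeasure lborel (grid_cell s k) = ennreal (s ^ 3)"
proof -
  let ?a = "(\<chi> i. s * of_int (k i)) :: pt"
  have "box ?a (?a + (\<chi> i. s)) \<subseteq> grid_cell s k" "grid_cell s k \<subseteq> cbox ?a (?a + (\<chi> i. s))"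
    using assms by (auto simp: grid_cell_iff mem_box_cart less_imp_le)
  then have "emeasure lborel (box ?a (?a + (\<chi> i. s))) \<le> emeasure lborel (grid_cell s k)"
    "emeasure lborel (grid_cell s k) \<le> emeasure lborel (cbox ?a (?a + (\<chi> i. s)))"
    by (auto intro!: emeasure_mono)
  then show ?thesis using assms by (simp add: emeasure_lborel_cube)
qed

lemma grid_cell_diff:
  assumes "0 < s" "x \<in> grid_cell s k" "x + z \<in> grid_cell s k"
  shows "z \<in> cbox (\<chi> i. - s) (\<chi> i. s)"
proof -
  have "- s \<le> z $ i \<and> z $ i \<le> s" for i
    using assms(2,3)[unfolded grid_cell_iff[OF assms(1)], rule_format, of i] by simp
  then show ?thesis by (simp add: mem_box_cart)
qed

lemma norm_le_of_cube:
  fixes z :: pt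
  assumes "z \<in> cbox (\<chi> i. - s) (\<chi> i. s)"
  shows "(norm z)\<^sup>2 \<le> 4 * s\<^sup>2"
proof -
  have "(z $ i)\<^sup>2 \<le> s\<^sup>2" for i
  proof -
    have "\<bar>z $ i\<bar> \<le> s" using assms by (auto simp: mem_box_cart abs_le_iff) (smt (verit))
    then show ?thesis by (metis abs_ge_zero power2_abs power_mono)
  qed
  moreover have "(norm z)\<^sup>2 = (z $ 1)\<^sup>2 + (z $ 2)\<^sup>2 + (z $ 3)\<^sup>2"
    unfolding power2_norm_eq_inner inner_vec_def by (simp add: sum_3 power2_eq_square)
  ultimately show ?thesis
    using zero_le_power2[of s] by (smt (verit))
qed

lemma finite_grid_cells:
  assumes "0 < s" "bounded A"
  shows "finite {k. grid_cell s k \<inter> A \<noteq> {}}"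
proof -
  obtain R where R: "\<And>x. x \<in> A \<Longrightarrow> norm x \<le> R" using assms(2) by (auto simp: bounded_iff)
  have "{k. grid_cell s k \<inter> A \<noteq> {}} \<subseteq> (UNIV \<rightarrow>\<^sub>E {\<lfloor>- R / s\<rfloor>..\<lfloor>R / s\<rfloor>})"
  proof (rule subsetI)
    fix k assume "k \<in> {k. grid_cell s k \<inter> A \<noteq> {}}"
    then obtain x where "x \<in> grid_cell s k" "x \<in> A" by blast
    then have k: "\<lfloor>x $ i / s\<rfloor> = k i" and x: "\<bar>x $ i\<bar> \<le> R" for i
      using R[of x] component_le_norm_cart[of x i] by (auto simp: grid_cell_def)
    have "- R / s \<le> x $ i / s" "x $ i / s \<le> R / s" for i
    proof -
      have "- R \<le> x $ i" "x $ i \<le> R" using x[of i] by linarith+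
      then show "- R / s \<le> x $ i / s" "x $ i / s \<le> R / s"
        using assms(1) by (intro divide_right_mono; simp)+
    qed
    then show "k \<in> UNIV \<rightarrow>\<^sub>E {\<lfloor>- R / s\<rfloor>..\<lfloor>R / s\<rfloor>}"
      by (auto simp: k[symmetric] intro!: floor_mono)
  qed
  then show ?thesis by (rule finite_subset) (simp add: finite_PiE)
qed

lemma sum_indicator_cells_le:
  assumes "finite K"
  shows "(\<Sum>k\<in>K. indicator (grid_cell s k) x) \<le> (1::ennreal)"
proof -
  let ?k = "\<lambda>i. \<lfloor>x $ i / s\<rfloor>"
  have "(indicator (grid_cell s k) x :: ennreal) = (if k = ?k then 1 else 0)" for k
    by (auto simp: grid_cell_def indicator_def)
  then show ?thesis using assms by (simp add: sum.delta)
qed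

text \<open>Expanding the square gives \<open>2 * m * m\<close> times the variance of
  \<open>f\<close> on \<open>A\<close> when \<open>m > 0\<close>. The identity turns a bound on
  pairwise differences into control of the L2 norm by the mean.\<close>

lemma double_integral_square_diff:
  fixes f :: "'a \<Rightarrow> real"
  assumes A: "A \<in> sets M" "emeasure M A = ennreal m" "0 \<le> m"
    and f: "integrable M f" "integrable M (\<lambda>x. (f x)\<^sup>2)"
  shows "(\<integral>\<^sup>+x. (\<integral>\<^sup>+y. ennreal ((f x - f y)\<^sup>2) * indicator A y \<partial>M) * indicator A x \<partial>M) =
    ennreal (2 * m * (LINT x:A|M. (f x)\<^sup>2) - 2 * (LINT x:A|M. f x)\<^sup>2)"
proof -
  let ?I = "LINT x:A|M. f x" and ?S = "LINT x:A|M. (f x)\<^sup>2"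
  have i: "integrable M (\<lambda>x. indicator A x *\<^sub>R f x)" "integrable M (\<lambda>x. indicator A x *\<^sub>R (f x)\<^sup>2)"
    by (intro integrable_mult_indicator A f)+
  have i1: "integrable M (\<lambda>x. indicator A x :: real)" using A by (simp add: integrable_indicator_iff)
  have m: "measure M A = m" using A by (simp add: measure_def)
  have 1: "(\<integral>\<^sup>+y. ennreal ((f x - f y)\<^sup>2) * indicator A y \<partial>M) = ennreal (m * (f x)\<^sup>2 - 2 * ?I * f x + ?S)" 
    and 2: "0 \<le> m * (f x)\<^sup>2 - 2 * ?I * f x + ?S" for x
  proof -
    have eq: "(\<lambda>y. (f x - f y)\<^sup>2 * indicator A y) =
      (\<lambda>y. (f x)\<^sup>2 * indicator A y - 2 * f x * (indicator A y *\<^sub>R f y) + indicator A y *\<^sub>R (f y)\<^sup>2)"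
      by (auto simp: fun_eq_iff power2_eq_square algebra_simps)
    have int: "integrable M (\<lambda>y. (f x - f y)\<^sup>2 * indicator A y)"
      unfolding eq by (intro Bochner_Integration.integrable_add Bochner_Integration.integrable_diff integrable_mult_right i i1)
    have val: "(LINT y|M. (f x - f y)\<^sup>2 * indicator A y) = m * (f x)\<^sup>2 - 2 * ?I * f x + ?S"
      unfolding eq using i i1 A m by (simp add: set_lebesgue_integral_def)
    have "(\<integral>\<^sup>+y. ennreal ((f x - f y)\<^sup>2) * indicator A y \<partial>M) = (\<integral>\<^sup>+y. ennreal ((f x - f y)\<^sup>2 * indicator A y) \<partial>M)"
      by (intro nn_integral_cong) (auto simp: indicator_def)
    also have "\<dots> = ennreal (LINT y|M. (f x - f y)\<^sup>2 * indicator A y)"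
      by (intro nn_integral_eq_integral int) auto
    finally show "(\<integral>\<^sup>+y. ennreal ((f x - f y)\<^sup>2) * indicator A y \<partial>M) = ennreal (m * (f x)\<^sup>2 - 2 * ?I * f x + ?S)"
      by (simp add: val)
    have "0 \<le> (LINT y|M. (f x - f y)\<^sup>2 * indicator A y)" by (intro integral_nonneg_AE) auto
    then show "0 \<le> m * (f x)\<^sup>2 - 2 * ?I * f x + ?S" by (simp add: val)
  qed
  let ?g = "\<lambda>x. (m * (f x)\<^sup>2 - 2 * ?I * f x + ?S) * indicator A x"
  have eq: "?g = (\<lambda>x. m * (indicator A x *\<^sub>R (f x)\<^sup>2) - 2 * ?I * (indicator A x *\<^sub>R f x) + ?S * indicator A x)"
    by (auto simp: fun_eq_iff algebra_simps)
  have int: "integrable M ?g"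
    unfolding eq by (intro Bochner_Integration.integrable_add Bochner_Integration.integrable_diff integrable_mult_right i i1)
  have val: "(LINT x|M. ?g x) = 2 * m * ?S - 2 * ?I\<^sup>2"
    unfolding eq using i i1 A m by (simp add: set_lebesgue_integral_def power2_eq_square)
  have "(\<integral>\<^sup>+x. (\<integral>\<^sup>+y. ennreal ((f x - f y)\<^sup>2) * indicator A y \<partial>M) * indicator A x \<partial>M) = (\<integral>\<^sup>+x. ennreal (?g x) \<partial>M)"
    unfolding 1 by (intro nn_integral_cong) (auto simp: indicator_def)
  also have "\<dots> = ennreal (LINT x|M. ?g x)"
    using 2 by (intro nn_integral_eq_integral int) (auto intro!: AE_I2 mult_nonneg_nonneg)
  finally show ?thesis by (simp add: val)
qed

context bounded_open
begin

definition cells :: "real \<Rightarrow> (3 \<Rightarrow> int) set" where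
  "cells s = {k. grid_cell s k \<inter> \<Omega> \<noteq> {}}"

lemma finite_cells: "0 < s \<Longrightarrow> finite (cells s)"
  unfolding cells_def by (intro finite_grid_cells bounded_dom)

text \<open>For x and y in one cell, z = y - x lies in a cube of side \<open>2 * s\<close>, and
  disjointness of the cells bounds the sum by one integral over all x. The translation estimate with
  \<open>(norm z)\<^sup>2 \<le> 4 * s\<^sup>2\<close> and the volume \<open>(2 * s) ^ 3\<close> of
  the cube give the constant 4 * 8 = 32.\<close>

lemma cell_oscillation_le:
  assumes \<phi>: "\<phi> \<in> test_functions \<Omega>" and s: "0 < s"
  shows "(\<Sum>k\<in>cells s. \<integral>\<^sup>+x. (\<integral>\<^sup>+y. ennreal ((\<phi> x - \<phi> y)\<^sup>2) * indicator (grid_cell s k) y \<partial>lborel) * indicator (grid_cell s k) x \<partial>lborel)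
    \<le> ennreal (32 * s ^ 5 * (Lnorm 2 \<Omega> (cgrad \<phi>))\<^sup>2)"
proof -
  note [measurable] = test_function_borel[OF \<phi>]
  let ?C = "cbox (\<chi> i. - s) (\<chi> i. s) :: pt set"
  let ?D = "\<lambda>x z. ennreal ((\<phi> (x + z) - \<phi> x)\<^sup>2)"
  let ?H = "\<lambda>x. \<integral>\<^sup>+z. ?D x z * indicator ?C z \<partial>lborel"
  have H[measurable]: "?H \<in> borel_measurable lborel" by measurable
  have le: "(\<integral>\<^sup>+y. ennreal ((\<phi> x - \<phi> y)\<^sup>2) * indicator (grid_cell s k) y \<partial>lborel) * indicator (grid_cell s k) x
      \<le> ?H x * indicator (grid_cell s k) x" for x k
  proof (cases "x \<in> grid_cell s k")
    case True
    have "(\<integral>\<^sup>+y. ennreal ((\<phi> x - \<phi> y)\<^sup>2) * indicator (grid_cell s k) y \<partial>lborel) =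
        (\<integral>\<^sup>+z. ennreal ((\<phi> x - \<phi> (z + x))\<^sup>2) * indicator (grid_cell s k) (z + x) \<partial>lborel)"
      by (rule nn_integral_lborel_shift[symmetric]) measurable
    also have "\<dots> \<le> ?H x"
    proof (intro nn_integral_mono)
      fix z
      show "ennreal ((\<phi> x - \<phi> (z + x))\<^sup>2) * indicator (grid_cell s k) (z + x) \<le> ?D x z * indicator ?C z"
      proof (cases "z + x \<in> grid_cell s k")
        case z: True
        then have "z \<in> ?C" using grid_cell_diff[OF s True, of z] by (simp add: add.commute)
        then show ?thesis using z by (simp add: add.commute power2_commute)
      qed simp
    qed
    finally show ?thesis using True by simp
  qed simp
  have "(\<Sum>k\<in>cells s. \<integral>\<^sup>+x. (\<integral>\<^sup>+y. ennreal ((\<phi> x - \<phi> y)\<^sup>2) * indicator (grid_cell s k) y \<partial>lborel) * indicator (grid_cell s k) x \<partial>lborel)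
    \<le> (\<Sum>k\<in>cells s. \<integral>\<^sup>+x. ?H x * indicator (grid_cell s k) x \<partial>lborel)"
    by (intro sum_mono nn_integral_mono le)
  also have "\<dots> = (\<integral>\<^sup>+x. (\<Sum>k\<in>cells s. ?H x * indicator (grid_cell s k) x) \<partial>lborel)"
    by (rule nn_integral_sum[symmetric]) measurable
  also have "\<dots> \<le> (\<integral>\<^sup>+x. ?H x \<partial>lborel)"
  proof (intro nn_integral_mono)
    fix x
    have "(\<Sum>k\<in>cells s. ?H x * indicator (grid_cell s k) x) = ?H x * (\<Sum>k\<in>cells s. indicator (grid_cell s k) x)"
      by (simp add: sum_distrib_left)
    also have "\<dots> \<le> ?H x * 1"
      by (intro mult_left_mono sum_indicator_cells_le finite_cells s) auto
    finally show "(\<Sum>k\<in>cells s. ?H x * indicator (grid_cell s k) x) \<le> ?H x" by simp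
  qed
  also have "\<dots> = (\<integral>\<^sup>+z. \<integral>\<^sup>+x. ?D x z * indicator ?C z \<partial>lborel \<partial>lborel)"
    by (rule lborel_pair.Fubini'[symmetric]) measurable
  also have "\<dots> \<le> (\<integral>\<^sup>+z. ennreal (4 * s\<^sup>2 * (Lnorm 2 \<Omega> (cgrad \<phi>))\<^sup>2) * indicator ?C z \<partial>lborel)"
  proof (intro nn_integral_mono)
    fix z
    have "(\<integral>\<^sup>+x. ?D x z \<partial>lborel) \<le> ennreal (4 * s\<^sup>2 * (Lnorm 2 \<Omega> (cgrad \<phi>))\<^sup>2)" if "z \<in> ?C"
      by (rule order_trans[OF translation_estimate[OF \<phi>]])
        (intro ennreal_leI mult_right_mono norm_le_of_cube that, simp)
    then show "(\<integral>\<^sup>+x. ?D x z * indicator ?C z \<partial>lborel) \<le> ennreal (4 * s\<^sup>2 * (Lnorm 2 \<Omega> (cgrad \<phi>))\<^sup>2) * indicator ?C z"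
      by (cases "z \<in> ?C") auto
  qed
  also have "\<dots> = ennreal (4 * s\<^sup>2 * (Lnorm 2 \<Omega> (cgrad \<phi>))\<^sup>2) * emeasure lborel ?C"
    by (simp add: nn_integral_cmult)
  also have "emeasure lborel ?C = ennreal ((2 * s) ^ 3)"
  proof -
    have "(\<chi> i. s) = ((\<chi> i. - s) + (\<chi> i. 2 * s) :: pt)" by (simp add: vec_eq_iff)
    then show ?thesis using emeasure_lborel_cube(2)[of "2 * s" "\<chi> i. - s"] s by simp
  qed
  also have "ennreal (4 * s\<^sup>2 * (Lnorm 2 \<Omega> (cgrad \<phi>))\<^sup>2) * ennreal ((2 * s) ^ 3) = ennreal (32 * s ^ 5 * (Lnorm 2 \<Omega> (cgrad \<phi>))\<^sup>2)"
    using s by (simp add: ennreal_mult[symmetric] power_mult_distrib eval_nat_numeral mult_ac)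
  finally show ?thesis .
qed

text \<open>Points of one cell differ by a small translation, so the translation estimate controls the oscillation of \<open>\<phi>\<close>
  on the cells; up to this error, \<open>\<phi>\<close> is determined by finitely many averages.\<close>

lemma cell_averages_inequality:
  assumes \<phi>: "\<phi> \<in> test_functions \<Omega>" and s: "0 < s"
  shows "(Lnorm 2 \<Omega> \<phi>)\<^sup>2 \<le> (\<Sum>k\<in>cells s. (LINT x:grid_cell s k|lborel. \<phi> x)\<^sup>2) / s ^ 3 + 16 * s\<^sup>2 * (Lnorm 2 \<Omega> (cgrad \<phi>))\<^sup>2"
proof -
  note i = nn_integral_test_function_sq(3,4)[OF \<phi>]
  let ?S = "\<lambda>k. LINT x:grid_cell s k|lborel. (\<phi> x)\<^sup>2" and ?I = "\<lambda>k. LINT x:grid_cell s k|lborel. \<phi> x"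
  have osc: "(\<integral>\<^sup>+x. (\<integral>\<^sup>+y. ennreal ((\<phi> x - \<phi> y)\<^sup>2) * indicator (grid_cell s k) y \<partial>lborel) * indicator (grid_cell s k) x \<partial>lborel)
    = ennreal (2 * s ^ 3 * ?S k - 2 * (?I k)\<^sup>2)" for k
    using s by (intro double_integral_square_diff i emeasure_grid_cell) auto
  have "(\<Sum>k\<in>cells s. ennreal (2 * s ^ 3 * ?S k - 2 * (?I k)\<^sup>2)) \<le> ennreal (32 * s ^ 5 * (Lnorm 2 \<Omega> (cgrad \<phi>))\<^sup>2)"
    using cell_oscillation_le[OF \<phi> s] unfolding osc .
  moreover have "ennreal (\<Sum>k\<in>cells s. 2 * s ^ 3 * ?S k - 2 * (?I k)\<^sup>2) \<le> (\<Sum>k\<in>cells s. ennreal (2 * s ^ 3 * ?S k - 2 * (?I k)\<^sup>2))"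
  proof -
    \<comment> \<open>\<open>ennreal\<close> maps negative numbers to 0, so the real sum is compared
      with the sum of \<open>ennreal\<close> values through \<open>max 0\<close>.\<close>
    have "ennreal (\<Sum>k\<in>cells s. 2 * s ^ 3 * ?S k - 2 * (?I k)\<^sup>2) \<le> ennreal (\<Sum>k\<in>cells s. max 0 (2 * s ^ 3 * ?S k - 2 * (?I k)\<^sup>2))"
      by (intro ennreal_leI sum_mono) simp
    also have "\<dots> = (\<Sum>k\<in>cells s. ennreal (max 0 (2 * s ^ 3 * ?S k - 2 * (?I k)\<^sup>2)))"
      by (rule sum_ennreal[symmetric]) simp
    finally show ?thesis by (simp add: ennreal_max_0)
  qed
  ultimately have "ennreal (\<Sum>k\<in>cells s. 2 * s ^ 3 * ?S k - 2 * (?I k)\<^sup>2) \<le> ennreal (32 * s ^ 5 * (Lnorm 2 \<Omega> (cgrad \<phi>))\<^sup>2)"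
    by (rule order_trans[rotated])
  then have "(\<Sum>k\<in>cells s. 2 * s ^ 3 * ?S k - 2 * (?I k)\<^sup>2) \<le> 32 * s ^ 5 * (Lnorm 2 \<Omega> (cgrad \<phi>))\<^sup>2"
    using s by (subst (asm) ennreal_le_iff) auto
  then have 1: "2 * s ^ 3 * (\<Sum>k\<in>cells s. ?S k) \<le> 2 * (\<Sum>k\<in>cells s. (?I k)\<^sup>2) + 32 * s ^ 5 * (Lnorm 2 \<Omega> (cgrad \<phi>))\<^sup>2"
    by (simp add: sum_subtractf sum_distrib_left)
  have "(\<Sum>k\<in>cells s. ?S k) = (LINT x|lborel. (\<Sum>k\<in>cells s. indicator (grid_cell s k) x *\<^sub>R (\<phi> x)\<^sup>2))"
    unfolding set_lebesgue_integral_def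
    by (rule Bochner_Integration.integral_sum[symmetric]) (intro integrable_mult_indicator i, simp)
  also have "\<dots> = (LINT x|lborel. (\<phi> x)\<^sup>2)"
  proof (intro Bochner_Integration.integral_cong refl)
    fix x :: pt
    let ?k = "\<lambda>i. \<lfloor>x $ i / s\<rfloor>"
    have "(indicator (grid_cell s k) x :: real) = (if k = ?k then 1 else 0)" for k
      by (auto simp: grid_cell_def indicator_def)
    then have "(\<Sum>k\<in>cells s. indicator (grid_cell s k) x *\<^sub>R (\<phi> x)\<^sup>2) = (if ?k \<in> cells s then (\<phi> x)\<^sup>2 else 0)"
      using finite_cells[OF s] by (simp add: if_distrib[of "\<lambda>c. c * _"] sum.delta cong: if_cong)
    moreover have "\<phi> x = 0" if "?k \<notin> cells s"
    proof -
      have "x \<in> grid_cell s ?k" by (simp add: grid_cell_def)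
      then have "x \<notin> \<Omega>" using that by (auto simp: cells_def)
      then show ?thesis using test_function_support[OF \<phi>] by blast
    qed
    ultimately show "(\<Sum>k\<in>cells s. indicator (grid_cell s k) x *\<^sub>R (\<phi> x)\<^sup>2) = (\<phi> x)\<^sup>2" by auto
  qed
  also have "\<dots> = (Lnorm 2 \<Omega> \<phi>)\<^sup>2" using test_function_L2(3)[OF \<phi> dom_sets] by simp
  finally have "2 * s ^ 3 * (Lnorm 2 \<Omega> \<phi>)\<^sup>2 \<le> 2 * (\<Sum>k\<in>cells s. (?I k)\<^sup>2) + 32 * s ^ 5 * (Lnorm 2 \<Omega> (cgrad \<phi>))\<^sup>2"
    using 1 by simp
  then have "(Lnorm 2 \<Omega> \<phi>)\<^sup>2 \<le> (2 * (\<Sum>k\<in>cells s. (?I k)\<^sup>2) + 32 * s ^ 5 * (Lnorm 2 \<Omega> (cgrad \<phi>))\<^sup>2) / (2 * s ^ 3)"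
    using s by (simp add: pos_le_divide_eq mult.commute)
  also have "\<dots> = (\<Sum>k\<in>cells s. (?I k)\<^sup>2) / s ^ 3 + 16 * s\<^sup>2 * (Lnorm 2 \<Omega> (cgrad \<phi>))\<^sup>2"
    using s by (simp add: field_simps eval_nat_numeral)
  finally show ?thesis .
qed

lemma Poincare:
  "\<exists>C>0. \<forall>u\<in>H01 \<Omega>. Lnorm 2 \<Omega> u \<le> C * Lnorm 2 \<Omega> (grad \<Omega> u)"
proof -
  obtain C where C: "0 < C" "\<And>\<phi>. \<phi> \<in> test_functions \<Omega> \<Longrightarrow> Lnorm 2 \<Omega> \<phi> \<le> C * Lnorm 2 \<Omega> (cgrad \<phi>)"
    using Poincare_test_function by blast
  have "Lnorm 2 \<Omega> u \<le> C * Lnorm 2 \<Omega> (grad \<Omega> u)" if u: "u \<in> H01 \<Omega>" for u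
  proof (rule field_le_epsilon)
    fix e :: real assume "0 < e"
    \<comment> \<open>The approximation error enters once for the function and \<open>C\<close>
      times for the gradient, in total \<open>1 + C\<close> times.\<close>
    then have d: "0 < e / (1 + C)" using C(1) by simp
    obtain \<phi> where \<phi>: "\<phi> \<in> test_functions \<Omega>" "Lnorm 2 \<Omega> (\<lambda>x. u x - \<phi> x) < e / (1 + C)"
      "Lnorm 2 \<Omega> (\<lambda>x. grad \<Omega> u x - grad \<Omega> \<phi> x) < e / (1 + C)"
      by (rule H01_approx[OF u d])
    note uL = H1_L2[OF H01_H1[OF u]] and pL = H1_L2[OF grad_test_function(1)[OF \<phi>(1)]]
    have "Lnorm 2 \<Omega> u \<le> Lnorm 2 \<Omega> \<phi> + e / (1 + C)"
      using Lnorm_2_diff_le[OF uL(1) pL(1)] \<phi>(2) by linarith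
    also have "Lnorm 2 \<Omega> \<phi> \<le> C * Lnorm 2 \<Omega> (grad \<Omega> \<phi>)"
      using C(2)[OF \<phi>(1)] grad_test_function(3)[OF \<phi>(1)] by simp
    also have "\<dots> \<le> C * (Lnorm 2 \<Omega> (grad \<Omega> u) + e / (1 + C))"
      using Lnorm_2_diff_le[OF uL(3) pL(3)] \<phi>(3) C(1) by (intro mult_left_mono) linarith+
    finally have "Lnorm 2 \<Omega> u \<le> C * Lnorm 2 \<Omega> (grad \<Omega> u) + (1 + C) * (e / (1 + C))"
      by (simp add: algebra_simps add_divide_distrib)
    then show "Lnorm 2 \<Omega> u \<le> C * Lnorm 2 \<Omega> (grad \<Omega> u) + e" using C(1) by simp
  qed
  then show ?thesis using C(1) by blast
qed

section \<open>Rellich compactness\<close>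

lemma cell_integral_bound:
  assumes \<phi>: "\<phi> \<in> test_functions \<Omega>"
  shows "\<bar>LINT x:grid_cell s k|lborel. \<phi> x\<bar> \<le> sqrt (measure lebesgue \<Omega>) * Lnorm 2 \<Omega> \<phi>"
proof -
  note i = nn_integral_test_function_sq(4)[OF \<phi>]
  obtain K where K: "compact K" "K \<subseteq> \<Omega>" "\<And>x. x \<notin> K \<Longrightarrow> \<phi> x = 0"
    using test_function_support[OF \<phi>] by blast
  have c: "continuous_on UNIV (\<lambda>x. norm (\<phi> x))"
    by (intro continuous_intros continuous_on_test_function[OF \<phi>])
  have "\<bar>LINT x:grid_cell s k|lborel. \<phi> x\<bar> \<le> (LINT x|lborel. norm (indicator (grid_cell s k) x *\<^sub>R \<phi> x))"
    unfolding set_lebesgue_integral_def by (rule integral_abs_bound[THEN order_trans]) simp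
  also have "\<dots> \<le> (LINT x|lborel. norm (\<phi> x))"
    by (intro integral_mono integrable_norm integrable_mult_indicator i) (auto simp: indicator_def)
  also have "\<dots> = (LINT x|lebesgue_on \<Omega>. norm (\<phi> x))"
    using K by (intro compact_support_lebesgue_on(2)[symmetric, OF c K(1,2) _ dom_sets]) auto
  also have "\<dots> \<le> sqrt (measure lebesgue \<Omega>) * Lnorm 2 \<Omega> \<phi>"
    by (rule integral_norm_le_Lnorm_2(2)[OF test_L2(1)[OF \<phi>] dom_lmeasurable])
  finally show ?thesis .
qed

text \<open>The inequality for cell averages is applied to differences of the sequence. Along one
  subsequence the cell integrals converge for all mesh sizes 1 / (j + 1). Given \<open>e\<close>, a
  fine mesh makes the gradient term less than \<open>e\<^sup>2 / 2\<close>, and then only finitely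
  many cell integrals remain to be controlled.\<close>

lemma Rellich_test_functions:
  assumes \<phi>: "\<And>n. \<phi> n \<in> test_functions \<Omega>" and B: "\<And>n. Lnorm 2 \<Omega> (cgrad (\<phi> n)) \<le> B"
  shows "\<exists>r::nat \<Rightarrow> nat. strict_mono r \<and>
    (\<forall>e>0. \<exists>N. \<forall>m\<ge>N. \<forall>n\<ge>N. Lnorm 2 \<Omega> (\<lambda>x. \<phi> (r m) x - \<phi> (r n) x) < e)"
proof -
  obtain C where C: "0 < C" "\<And>\<phi>. \<phi> \<in> test_functions \<Omega> \<Longrightarrow> Lnorm 2 \<Omega> \<phi> \<le> C * Lnorm 2 \<Omega> (cgrad \<phi>)"
    using Poincare_test_function by blast
  \<comment> \<open>Mesh size and cell are packed into one countable index, so a single diagonal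
    extraction serves every mesh.\<close>
  define I where "I n = (\<lambda>(j, k). LINT x:grid_cell (inverse (real (Suc j))) k|lborel. \<phi> n x)" for n
  have bd: "norm (I n p) \<le> sqrt (measure lebesgue \<Omega>) * (C * B)" for n p
  proof -
    obtain j k where p: "p = (j, k)" by fastforce
    have "Lnorm 2 \<Omega> (\<phi> n) \<le> C * B"
      using C(2)[OF \<phi>, of n] mult_left_mono[OF B, of C n] C(1) by linarith
    then have "sqrt (measure lebesgue \<Omega>) * Lnorm 2 \<Omega> (\<phi> n) \<le> sqrt (measure lebesgue \<Omega>) * (C * B)"
      by (intro mult_left_mono) auto
    then show ?thesis
      using cell_integral_bound[OF \<phi>[of n], of "inverse (real (Suc j))" k] unfolding I_def p by simp
  qed
  have "countable (UNIV :: (nat \<times> (3 \<Rightarrow> int)) set)" by (rule countableI_type)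
  then have "\<exists>r::nat \<Rightarrow> nat. strict_mono r \<and> (\<forall>p. \<exists>l. (\<lambda>n. I (r n) p) \<longlonglongrightarrow> l)"
  proof (rule function_convergent_subsequence[where f=I])
    show "norm (I n p) \<le> sqrt (measure lebesgue \<Omega>) * (C * B)" for n p by (rule bd)
  qed blast
  then obtain r :: "nat \<Rightarrow> nat" where r: "strict_mono r" "\<And>p. \<exists>l. (\<lambda>n. I (r n) p) \<longlonglongrightarrow> l"
    by blast
  have "\<exists>N. \<forall>m\<ge>N. \<forall>n\<ge>N. Lnorm 2 \<Omega> (\<lambda>x. \<phi> (r m) x - \<phi> (r n) x) < e" if e: "0 < e" for e
  proof -
    have "(\<lambda>j. 16 * (inverse (real (Suc j)))\<^sup>2 * (2 * B)\<^sup>2) \<longlonglongrightarrow> 16 * 0\<^sup>2 * (2 * B)\<^sup>2"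
      by (intro tendsto_intros LIMSEQ_inverse_real_of_nat)
    then have "\<forall>\<^sub>F j in sequentially. 16 * (inverse (real (Suc j)))\<^sup>2 * (2 * B)\<^sup>2 < e\<^sup>2 / 2"
      by (rule order_tendstoD(2)) (use e in simp)
    then obtain j where j: "16 * (inverse (real (Suc j)))\<^sup>2 * (2 * B)\<^sup>2 < e\<^sup>2 / 2"
      by (auto dest: eventually_happens)
    define s where "s = inverse (real (Suc j))"
    have s: "0 < s" by (simp add: s_def)
    define T where "T m n = (\<Sum>k\<in>cells s. (I (r m) (j, k) - I (r n) (j, k))\<^sup>2) / s ^ 3" for m n
    have "\<exists>N. \<forall>m\<ge>N. \<forall>n\<ge>N. T m n < e\<^sup>2 / 2"
    proof -
      have "\<forall>k. \<exists>l. (\<lambda>n. I (r n) (j, k)) \<longlonglongrightarrow> l" using r(2) by blast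
      then have "\<exists>l. \<forall>k. (\<lambda>n. I (r n) (j, k)) \<longlonglongrightarrow> l k" by (rule choice)
      then obtain l where l: "\<And>k. (\<lambda>n. I (r n) (j, k)) \<longlonglongrightarrow> l k" by blast
      \<comment> \<open>Each of the \<open>card (cells s)\<close> squared differences is at most
        \<open>d\<close>; the \<open>+ 1\<close> makes their sum strictly smaller than
        \<open>e\<^sup>2 / 2 * s ^ 3\<close>.\<close>
      define d where "d = e\<^sup>2 / 2 * s ^ 3 / (real (card (cells s)) + 1)"
      have d: "0 < d" using e s by (simp add: d_def)
      have "\<forall>\<^sub>F n in sequentially. \<forall>k\<in>cells s. \<bar>I (r n) (j, k) - l k\<bar> < sqrt d / 2"
      proof (rule eventually_ball_finite[OF finite_cells[OF s]])
        show "\<forall>k\<in>cells s. \<forall>\<^sub>F n in sequentially. \<bar>I (r n) (j, k) - l k\<bar> < sqrt d / 2"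
          using tendstoD[OF l, of "sqrt d / 2"] d by (simp add: dist_real_def)
      qed
      then obtain N where N: "\<And>n k. n \<ge> N \<Longrightarrow> k \<in> cells s \<Longrightarrow> \<bar>I (r n) (j, k) - l k\<bar> < sqrt d / 2"
        by (auto simp: eventually_sequentially)
      have "T m n < e\<^sup>2 / 2" if "m \<ge> N" "n \<ge> N" for m n
      proof -
        have "(\<Sum>k\<in>cells s. (I (r m) (j, k) - I (r n) (j, k))\<^sup>2) \<le> (\<Sum>k\<in>cells s. d)"
        proof (intro sum_mono)
          fix k assume k: "k \<in> cells s"
          have "\<bar>I (r m) (j, k) - I (r n) (j, k)\<bar> \<le> sqrt d"
            using N[OF that(1) k] N[OF that(2) k] by linarith
          then have "\<bar>I (r m) (j, k) - I (r n) (j, k)\<bar>\<^sup>2 \<le> (sqrt d)\<^sup>2" by (intro power_mono) auto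
          then show "(I (r m) (j, k) - I (r n) (j, k))\<^sup>2 \<le> d" using d by simp
        qed
        also have "\<dots> < (real (card (cells s)) + 1) * d" using d by (simp add: distrib_right)
        also have "\<dots> = e\<^sup>2 / 2 * s ^ 3"
        proof -
          have "real (card (cells s)) + 1 \<noteq> 0" by linarith
          then show ?thesis unfolding d_def times_divide_eq_right by (rule nonzero_mult_div_cancel_left)
        qed
        finally show ?thesis using s by (simp add: T_def pos_divide_less_eq)
      qed
      then show ?thesis by blast
    qed
    then obtain N where N: "\<And>m n. m \<ge> N \<Longrightarrow> n \<ge> N \<Longrightarrow> T m n < e\<^sup>2 / 2" by blast
    have "Lnorm 2 \<Omega> (\<lambda>x. \<phi> (r m) x - \<phi> (r n) x) < e" if "m \<ge> N" "n \<ge> N" for m n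
    proof -
      let ?w = "\<lambda>x. \<phi> (r m) x - \<phi> (r n) x"
      have w: "?w \<in> test_functions \<Omega>"
        using test_functions_add[OF \<phi>[of "r m"] test_functions_scale[OF \<phi>[of "r n"], of "-1"]] by simp
      have gw: "Lnorm 2 \<Omega> (cgrad ?w) \<le> 2 * B"
      proof -
        have "cgrad ?w x = cgrad (\<phi> (r m)) x - cgrad (\<phi> (r n)) x" for x
          using fun_cong[OF has_derivative_unique[OF test_function_has_derivative[OF w]
              has_derivative_diff[OF test_function_has_derivative[OF \<phi>[of "r m"]] test_function_has_derivative[OF \<phi>[of "r n"]]]], of x]
          by (intro vector_eq_rdot[THEN iffD1]) (simp add: inner_diff_left)
        then have "cgrad ?w = (\<lambda>x. cgrad (\<phi> (r m)) x + (-1) *\<^sub>R cgrad (\<phi> (r n)) x)" by auto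
        then have "Lnorm 2 \<Omega> (cgrad ?w) \<le> Lnorm 2 \<Omega> (cgrad (\<phi> (r m))) + Lnorm 2 \<Omega> (cgrad (\<phi> (r n)))"
          using Lnorm_2_triangle[OF test_L2(2)[OF \<phi>[of "r m"]] L2_on_scaleR[OF test_L2(2)[OF \<phi>[of "r n"]], of "-1"]]
          by (simp only: Lnorm_scaleR)
        then show ?thesis using B[of "r m"] B[of "r n"] by linarith
      qed
      have "(LINT x:grid_cell s k|lborel. ?w x) = I (r m) (j, k) - I (r n) (j, k)" for k
        unfolding I_def s_def prod.case
        by (intro set_integral_diff; unfold set_integrable_def;
            intro integrable_mult_indicator nn_integral_test_function_sq(4)[OF \<phi>]; simp)
      then have "(Lnorm 2 \<Omega> ?w)\<^sup>2 \<le> T m n + 16 * s\<^sup>2 * (Lnorm 2 \<Omega> (cgrad ?w))\<^sup>2"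
        using cell_averages_inequality[OF w s] by (simp add: T_def)
      also have "16 * s\<^sup>2 * (Lnorm 2 \<Omega> (cgrad ?w))\<^sup>2 \<le> 16 * s\<^sup>2 * (2 * B)\<^sup>2"
        using gw by (intro mult_left_mono power_mono Lnorm_nonneg) auto
      finally have "(Lnorm 2 \<Omega> ?w)\<^sup>2 < e\<^sup>2" using N[OF that] j by (simp add: s_def)
      then show ?thesis by (rule power2_less_imp_less) (use e in simp)
    qed
    then show ?thesis by blast
  qed
  then show ?thesis using r(1) by blast
qed

text \<open>Each \<open>u n\<close> is replaced by a test function at distance less than 1 / (n +
  1). This raises the gradient bound by at most 1 and preserves the Cauchy property in L2.\<close>

lemma Rellich:
  assumes u: "\<And>n. u n \<in> H01 \<Omega>" and B: "\<And>n. Lnorm 2 \<Omega> (grad \<Omega> (u n)) \<le> B"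
  shows "\<exists>r::nat \<Rightarrow> nat. strict_mono r \<and>
    (\<forall>e>0. \<exists>N. \<forall>m\<ge>N. \<forall>n\<ge>N. Lnorm 2 \<Omega> (\<lambda>x. u (r m) x - u (r n) x) < e)"
proof -
  have "\<exists>\<phi>. \<phi> \<in> test_functions \<Omega> \<and> Lnorm 2 \<Omega> (\<lambda>x. u n x - \<phi> x) < inverse (real (Suc n)) \<and>
      Lnorm 2 \<Omega> (\<lambda>x. grad \<Omega> (u n) x - grad \<Omega> \<phi> x) < inverse (real (Suc n))" for n
  proof -
    have "0 < inverse (real (Suc n))" by simp
    from H01_approx[OF u this, of n] show ?thesis by blast
  qed
  then have "\<exists>\<phi>. \<forall>n. \<phi> n \<in> test_functions \<Omega> \<and> Lnorm 2 \<Omega> (\<lambda>x. u n x - \<phi> n x) < inverse (real (Suc n)) \<and>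
      Lnorm 2 \<Omega> (\<lambda>x. grad \<Omega> (u n) x - grad \<Omega> (\<phi> n) x) < inverse (real (Suc n))"
    by (intro choice allI)
  then obtain \<phi> where \<phi>: "\<And>n. \<phi> n \<in> test_functions \<Omega>"
    "\<And>n. Lnorm 2 \<Omega> (\<lambda>x. u n x - \<phi> n x) < inverse (real (Suc n))"
    "\<And>n. Lnorm 2 \<Omega> (\<lambda>x. grad \<Omega> (u n) x - grad \<Omega> (\<phi> n) x) < inverse (real (Suc n))"
    by blast
  note uL = H1_L2[OF H01_H1[OF u]] and pL = H1_L2[OF grad_test_function(1)[OF \<phi>(1)]]
  have "Lnorm 2 \<Omega> (cgrad (\<phi> n)) \<le> B + 1" for n
  proof -
    have "inverse (real (Suc n)) \<le> 1" by (simp add: field_simps)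
    then show ?thesis
      using Lnorm_2_diff_le[OF uL(3)[of n] pL(3)[of n]] \<phi>(3)[of n] B[of n] grad_test_function(3)[OF \<phi>(1)[of n]] by linarith
  qed
  then obtain r :: "nat \<Rightarrow> nat" where r: "strict_mono r"
    "\<And>e. 0 < e \<Longrightarrow> \<exists>N. \<forall>m\<ge>N. \<forall>n\<ge>N. Lnorm 2 \<Omega> (\<lambda>x. \<phi> (r m) x - \<phi> (r n) x) < e"
    using Rellich_test_functions[of \<phi> "B + 1"] \<phi>(1) by blast
  have "\<exists>N. \<forall>m\<ge>N. \<forall>n\<ge>N. Lnorm 2 \<Omega> (\<lambda>x. u (r m) x - u (r n) x) < e" if e: "0 < e" for e
  proof -
    obtain N1 where N1: "\<And>m n. m \<ge> N1 \<Longrightarrow> n \<ge> N1 \<Longrightarrow> Lnorm 2 \<Omega> (\<lambda>x. \<phi> (r m) x - \<phi> (r n) x) < e/3"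
      using r(2)[of "e/3"] e by auto
    obtain N2 where N2: "\<And>n. n \<ge> N2 \<Longrightarrow> inverse (real (Suc n)) < e/3"
      using order_tendstoD(2)[OF LIMSEQ_inverse_real_of_nat, of "e/3"] e by (auto simp: eventually_sequentially)
    have "Lnorm 2 \<Omega> (\<lambda>x. u (r m) x - u (r n) x) < e" if "m \<ge> max N1 N2" "n \<ge> max N1 N2" for m n
    proof -
      have "r m \<ge> N2" "r n \<ge> N2" using that seq_suble[OF r(1), of m] seq_suble[OF r(1), of n] by auto
      then have "Lnorm 2 \<Omega> (\<lambda>x. u (r m) x - \<phi> (r m) x) < e/3" "Lnorm 2 \<Omega> (\<lambda>x. u (r n) x - \<phi> (r n) x) < e/3"
        using \<phi>(2)[of "r m"] \<phi>(2)[of "r n"] N2[of "r m"] N2[of "r n"] by linarith+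
      moreover have "Lnorm 2 \<Omega> (\<lambda>x. \<phi> (r m) x - \<phi> (r n) x) < e/3" using N1 that by simp
      ultimately show ?thesis
        using Lnorm_2_triangle_diff[OF uL(1)[of "r m"] pL(1)[of "r m"] uL(1)[of "r n"]]
          Lnorm_2_triangle_diff[OF pL(1)[of "r m"] pL(1)[of "r n"] uL(1)[of "r n"]]
          Lnorm_2_minus[of \<Omega> "u (r n)" "\<phi> (r n)"] by linarith
    qed
    then show ?thesis by blast
  qed
  then show ?thesis using r(1) by blast
qed

end

subsection \<open>The Sobolev inequality\<close>

text \<open>The integrals in the Loomis-Whitney argument may be infinite, so roots are taken in
  \<open>ennreal\<close>, where squaring undoes them without side conditions.\<close>

definition esqrt :: "ennreal \<Rightarrow> ennreal" where
  "esqrt a = (if a = \<infinity> then \<infinity> else ennreal (sqrt (enn2real a)))"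

lemma esqrt_sq [simp]: "(esqrt a)\<^sup>2 = a"
  by (cases a) (auto simp: esqrt_def ennreal_power)

lemma esqrt_measurable [measurable]: "esqrt \<in> borel_measurable borel"
  unfolding esqrt_def[abs_def] by measurable

lemma ennreal_power2_le_imp_le:
  fixes p q :: ennreal
  assumes "p\<^sup>2 \<le> q\<^sup>2" shows "p \<le> q"
proof (rule ccontr)
  assume "\<not> p \<le> q"
  then have qp: "q < p" by simp
  then obtain r where r: "q = ennreal r" "0 \<le> r" by (cases q) auto
  show False
  proof (cases p)
    case (real s)
    then have "r < s" using qp r by (simp add: ennreal_less_iff)
    moreover have "s\<^sup>2 \<le> r\<^sup>2" using assms real r by (simp add: ennreal_power)
    ultimately show False using r(2) power2_le_imp_le by fastforce
  next
    case top
    then show False using assms r by (simp add: ennreal_power power_eq_top_ennreal top_unique)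
  qed
qed

text \<open>For fixed x, Cauchy-Schwarz in (y, z) separates \<open>\<alpha>\<close> from the product
  of \<open>\<beta>\<close> and \<open>\<gamma>\<close>, whose squared integral factors as
  \<open>b x * c x\<close>. A second Cauchy-Schwarz, in x, separates \<open>b\<close> from
  \<open>c\<close>.\<close>

lemma Loomis_Whitney:
  fixes \<alpha> \<beta> \<gamma> :: "real \<Rightarrow> real \<Rightarrow> ennreal"
  assumes [measurable]: "case_prod \<alpha> \<in> borel_measurable (lborel \<Otimes>\<^sub>M lborel)"
    "case_prod \<beta> \<in> borel_measurable (lborel \<Otimes>\<^sub>M lborel)" "case_prod \<gamma> \<in> borel_measurable (lborel \<Otimes>\<^sub>M lborel)"
  shows "(\<integral>\<^sup>+x. \<integral>\<^sup>+y. \<integral>\<^sup>+z. \<alpha> y z * \<beta> x z * \<gamma> x y \<partial>lborel \<partial>lborel \<partial>lborel)\<^sup>2 \<le>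
    (\<integral>\<^sup>+y. \<integral>\<^sup>+z. (\<alpha> y z)\<^sup>2 \<partial>lborel \<partial>lborel) * (\<integral>\<^sup>+x. \<integral>\<^sup>+z. (\<beta> x z)\<^sup>2 \<partial>lborel \<partial>lborel) *
    (\<integral>\<^sup>+x. \<integral>\<^sup>+y. (\<gamma> x y)\<^sup>2 \<partial>lborel \<partial>lborel)"
proof -
  define K where "K = (\<integral>\<^sup>+y. \<integral>\<^sup>+z. (\<alpha> y z)\<^sup>2 \<partial>lborel \<partial>lborel)"
  define b where "b x = (\<integral>\<^sup>+z. (\<beta> x z)\<^sup>2 \<partial>lborel)" for x
  define c where "c x = (\<integral>\<^sup>+y. (\<gamma> x y)\<^sup>2 \<partial>lborel)" for x
  have [measurable]: "b \<in> borel_measurable lborel" "c \<in> borel_measurable lborel"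
    unfolding b_def[abs_def] c_def[abs_def] by measurable
  have inner: "(\<integral>\<^sup>+y. \<integral>\<^sup>+z. \<alpha> y z * \<beta> x z * \<gamma> x y \<partial>lborel \<partial>lborel) \<le> esqrt K * (esqrt (b x) * esqrt (c x))" for x
  proof (rule ennreal_power2_le_imp_le)
    have [measurable]: "(\<lambda>z. \<beta> x z) \<in> borel_measurable lborel" "(\<lambda>y. \<gamma> x y) \<in> borel_measurable lborel"
      by measurable
    have "(\<integral>\<^sup>+y. \<integral>\<^sup>+z. \<alpha> y z * \<beta> x z * \<gamma> x y \<partial>lborel \<partial>lborel) =
      (\<integral>\<^sup>+p. case_prod \<alpha> p * (\<beta> x (snd p) * \<gamma> x (fst p)) \<partial>(lborel \<Otimes>\<^sub>M lborel))"
      by (subst lborel.nn_integral_fst[symmetric]) (auto simp: mult.assoc)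
    also have "\<dots>\<^sup>2 \<le> (\<integral>\<^sup>+p. (case_prod \<alpha> p)\<^sup>2 \<partial>(lborel \<Otimes>\<^sub>M lborel)) * (\<integral>\<^sup>+p. (\<beta> x (snd p) * \<gamma> x (fst p))\<^sup>2 \<partial>(lborel \<Otimes>\<^sub>M lborel))"
      by (rule Cauchy_Schwarz_nn_integral) measurable
    also have "(\<integral>\<^sup>+p. (case_prod \<alpha> p)\<^sup>2 \<partial>(lborel \<Otimes>\<^sub>M lborel)) = K"
      unfolding K_def by (subst lborel.nn_integral_fst[symmetric]) auto
    also have "(\<integral>\<^sup>+p. (\<beta> x (snd p) * \<gamma> x (fst p))\<^sup>2 \<partial>(lborel \<Otimes>\<^sub>M lborel)) =
      (\<integral>\<^sup>+y. \<integral>\<^sup>+z. (\<beta> x z)\<^sup>2 * (\<gamma> x y)\<^sup>2 \<partial>lborel \<partial>lborel)"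
      by (subst lborel.nn_integral_fst[symmetric]) (auto simp: power_mult_distrib)
    also have "\<dots> = b x * c x"
      unfolding b_def c_def by (simp add: nn_integral_multc nn_integral_cmult)
    finally show "(\<integral>\<^sup>+y. \<integral>\<^sup>+z. \<alpha> y z * \<beta> x z * \<gamma> x y \<partial>lborel \<partial>lborel)\<^sup>2 \<le> (esqrt K * (esqrt (b x) * esqrt (c x)))\<^sup>2"
      by (simp add: power_mult_distrib)
  qed
  have "(\<integral>\<^sup>+x. \<integral>\<^sup>+y. \<integral>\<^sup>+z. \<alpha> y z * \<beta> x z * \<gamma> x y \<partial>lborel \<partial>lborel \<partial>lborel) \<le> (\<integral>\<^sup>+x. esqrt K * (esqrt (b x) * esqrt (c x)) \<partial>lborel)"
    by (intro nn_integral_mono inner)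
  also have "\<dots> = esqrt K * (\<integral>\<^sup>+x. esqrt (b x) * esqrt (c x) \<partial>lborel)"
    by (rule nn_integral_cmult) measurable
  finally have "(\<integral>\<^sup>+x. \<integral>\<^sup>+y. \<integral>\<^sup>+z. \<alpha> y z * \<beta> x z * \<gamma> x y \<partial>lborel \<partial>lborel \<partial>lborel)\<^sup>2 \<le> (esqrt K * (\<integral>\<^sup>+x. esqrt (b x) * esqrt (c x) \<partial>lborel))\<^sup>2"
    by (rule power_mono) simp
  also have "\<dots> = K * (\<integral>\<^sup>+x. esqrt (b x) * esqrt (c x) \<partial>lborel)\<^sup>2"
    by (simp add: power_mult_distrib)
  also have "\<dots> \<le> K * ((\<integral>\<^sup>+x. (esqrt (b x))\<^sup>2 \<partial>lborel) * (\<integral>\<^sup>+x. (esqrt (c x))\<^sup>2 \<partial>lborel))"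
    by (intro mult_left_mono Cauchy_Schwarz_nn_integral) auto
  finally show ?thesis by (simp add: K_def b_def c_def mult.assoc)
qed

lemma sigma_finite_lborel_pair: "sigma_finite_measure (lborel \<Otimes>\<^sub>M lborel :: (real \<times> real) measure)"
  by (simp add: lborel_prod sigma_finite_lborel)

section \<open>Iterated integrals in three coordinates\<close>

definition point3 :: "real \<Rightarrow> real \<Rightarrow> real \<Rightarrow> pt" where
  "point3 x y z = x *\<^sub>R axis 1 1 + y *\<^sub>R axis 2 1 + z *\<^sub>R axis 3 1"

lemma point3_component: "point3 x y z $ 1 = x" "point3 x y z $ 2 = y" "point3 x y z $ 3 = z"
  by (simp_all add: point3_def axis_def)

lemma point3_measurable [measurable]:
  "f \<in> borel_measurable M \<Longrightarrow> g \<in> borel_measurable M \<Longrightarrow> h \<in> borel_measurable M \<Longrightarrow>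
    (\<lambda>x. point3 (f x) (g x) (h x)) \<in> borel_measurable M"
  unfolding point3_def
  by (intro borel_measurable_add borel_measurable_scaleR borel_measurable_const)

text \<open>Lebesgue measure is determined by its values on boxes, and the preimage of a box is a
  product of three intervals.\<close>

lemma distr_point3:
  "distr (lborel \<Otimes>\<^sub>M (lborel \<Otimes>\<^sub>M lborel)) borel (\<lambda>(x, y, z). point3 x y z) = lborel"
proof (rule lborel_eqI[symmetric])
  fix l u :: pt assume le: "\<And>b. b \<in> Basis \<Longrightarrow> l \<bullet> b \<le> u \<bullet> b"
  have le': "l $ i \<le> u $ i" for i
    using le[of "axis i 1"] by (simp add: inner_axis axis_in_Basis_iff)
  have pre: "(\<lambda>(x, y, z). point3 x y z) -` box l u \<inter> space (lborel \<Otimes>\<^sub>M (lborel \<Otimes>\<^sub>M lborel)) =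
      {l $ 1<..<u $ 1} \<times> ({l $ 2<..<u $ 2} \<times> {l $ 3<..<u $ 3})"
    by (auto simp: mem_box_cart forall_3 point3_component space_pair_measure)
  have "emeasure (distr (lborel \<Otimes>\<^sub>M (lborel \<Otimes>\<^sub>M lborel)) borel (\<lambda>(x, y, z). point3 x y z)) (box l u)
    = emeasure (lborel \<Otimes>\<^sub>M (lborel \<Otimes>\<^sub>M lborel)) ({l $ 1<..<u $ 1} \<times> ({l $ 2<..<u $ 2} \<times> {l $ 3<..<u $ 3}))"
    by (subst emeasure_distr) (auto simp: pre)
  also have "\<dots> = ennreal (u $ 1 - l $ 1) * (ennreal (u $ 2 - l $ 2) * ennreal (u $ 3 - l $ 3))"
    using le'
    by (simp add: sigma_finite_measure.emeasure_pair_measure_Times[OF sigma_finite_lborel_pair]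
        lborel.emeasure_pair_measure_Times)
  also have "\<dots> = ennreal ((u $ 1 - l $ 1) * ((u $ 2 - l $ 2) * (u $ 3 - l $ 3)))"
    using le' by (simp add: ennreal_mult)
  also have "(u $ 1 - l $ 1) * ((u $ 2 - l $ 2) * (u $ 3 - l $ 3)) = (\<Prod>b\<in>Basis. (u - l) \<bullet> b)"
  proof -
    have B: "(Basis :: pt set) = range (\<lambda>i. axis i 1)" by (auto simp: Basis_vec_def)
    have I: "inj (\<lambda>i::3. axis i (1::real))" by (simp add: inj_def axis_eq_axis)
    have "(\<Prod>b\<in>(Basis :: pt set). (u - l) \<bullet> b) = (\<Prod>i\<in>UNIV. (u - l) \<bullet> axis i 1)"
      unfolding B by (subst prod.reindex[OF I]) simp
    also have "\<dots> = (u $ 1 - l $ 1) * ((u $ 2 - l $ 2) * (u $ 3 - l $ 3))"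
      unfolding UNIV_3 by (simp add: inner_axis)
    finally show ?thesis by simp
  qed
  finally show "emeasure (distr (lborel \<Otimes>\<^sub>M (lborel \<Otimes>\<^sub>M lborel)) borel (\<lambda>(x, y, z). point3 x y z)) (box l u) = (\<Prod>b\<in>Basis. (u - l) \<bullet> b)" .
qed simp

lemma nn_integral_point3:
  assumes [measurable]: "F \<in> borel_measurable borel"
  shows "(\<integral>\<^sup>+v. F v \<partial>lborel) = (\<integral>\<^sup>+x. \<integral>\<^sup>+y. \<integral>\<^sup>+z. F (point3 x y z) \<partial>lborel \<partial>lborel \<partial>lborel)"
proof -
  have [measurable]: "(\<lambda>p. F (point3 (fst p) (fst (snd p)) (snd (snd p)))) \<in> borel_measurable (lborel \<Otimes>\<^sub>M (lborel \<Otimes>\<^sub>M lborel))"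
    by measurable
  have "(\<integral>\<^sup>+v. F v \<partial>lborel) = (\<integral>\<^sup>+v. F v \<partial>distr (lborel \<Otimes>\<^sub>M (lborel \<Otimes>\<^sub>M lborel)) borel (\<lambda>(x, y, z). point3 x y z))"
    by (simp only: distr_point3)
  also have "\<dots> = (\<integral>\<^sup>+p. F (point3 (fst p) (fst (snd p)) (snd (snd p))) \<partial>(lborel \<Otimes>\<^sub>M (lborel \<Otimes>\<^sub>M lborel)))"
    by (subst nn_integral_distr) (auto simp: case_prod_beta)
  also have "\<dots> = (\<integral>\<^sup>+x. \<integral>\<^sup>+q. F (point3 x (fst q) (snd q)) \<partial>(lborel \<Otimes>\<^sub>M lborel) \<partial>lborel)"
    using sigma_finite_measure.nn_integral_fst[OF sigma_finite_lborel_pair, of "\<lambda>p. F (point3 (fst p) (fst (snd p)) (snd (snd p)))" lborel]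
    by simp
  also have "\<dots> = (\<integral>\<^sup>+x. \<integral>\<^sup>+y. \<integral>\<^sup>+z. F (point3 x y z) \<partial>lborel \<partial>lborel \<partial>lborel)"
  proof (intro nn_integral_cong)
    fix x :: real
    have "(\<lambda>q. F (point3 x (fst q) (snd q))) \<in> borel_measurable (lborel \<Otimes>\<^sub>M lborel)" by measurable
    from lborel.nn_integral_fst[OF this]
    show "(\<integral>\<^sup>+q. F (point3 x (fst q) (snd q)) \<partial>(lborel \<Otimes>\<^sub>M lborel)) = (\<integral>\<^sup>+y. \<integral>\<^sup>+z. F (point3 x y z) \<partial>lborel \<partial>lborel)"
      by simp
  qed
  finally show ?thesis .
qed

section \<open>Line integrals and the endpoint inequality\<close>

lemma compact_support_le_integral_deriv:
  fixes f f' :: "real \<Rightarrow> real"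
  assumes "\<And>t. (f has_real_derivative f' t) (at t)" "continuous_on UNIV f'" "\<And>t. R \<le> \<bar>t\<bar> \<Longrightarrow> f t = 0"
  shows "ennreal \<bar>f x\<bar> \<le> (\<integral>\<^sup>+t. ennreal \<bar>f' t\<bar> \<partial>lborel)"
proof -
  \<comment> \<open>A starting point left of \<open>x\<close> with
    \<open>R \<le> \<bar>a\<bar>\<close>: there \<open>f a = 0\<close>, and the fundamental theorem
    of calculus gives \<open>f x\<close> alone.\<close>
  define a where "a = min x (- \<bar>R\<bar>)"
  have a: "a \<le> x" "f a = 0" using assms(3)[of a] by (auto simp: a_def)
  have c: "continuous_on {a..x} f'" using assms(2) continuous_on_subset by blast
  have i: "integrable lborel (\<lambda>t. indicator {a..x} t *\<^sub>R f' t)"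
    by (intro borel_integrable_compact c compact_Icc)
  have "(LINT t|lborel. indicator {a..x} t *\<^sub>R f' t) = f x - f a"
    using a(1) assms(1)
    by (intro integral_FTC_atLeastAtMost c)
      (auto simp: has_real_derivative_iff_has_vector_derivative intro: has_vector_derivative_at_within)
  then have "ennreal \<bar>f x\<bar> = ennreal (norm (LINT t|lborel. indicator {a..x} t *\<^sub>R f' t))"
    by (simp add: a)
  also have "\<dots> \<le> (\<integral>\<^sup>+t. ennreal (norm (indicator {a..x} t *\<^sub>R f' t)) \<partial>lborel)"
    by (rule integral_norm_bound_ennreal[OF i])
  also have "\<dots> \<le> (\<integral>\<^sup>+t. ennreal \<bar>f' t\<bar> \<partial>lborel)"
    by (intro nn_integral_mono ennreal_leI) (auto simp: indicator_def)
  finally show ?thesis .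
qed

lemma test_function_le_line_integral:
  assumes w: "w \<in> test_functions \<Omega>" and e: "norm e = 1"
  shows "ennreal \<bar>w (p + x *\<^sub>R e)\<bar> \<le> (\<integral>\<^sup>+t. ennreal (norm (cgrad w (p + t *\<^sub>R e))) \<partial>lborel)"
proof -
  obtain K where K: "compact K" "\<And>x. x \<notin> K \<Longrightarrow> w x = 0"
    using test_function_support[OF w] by blast
  obtain R where R: "\<And>x. x \<in> K \<Longrightarrow> norm x \<le> R" using compact_imp_bounded[OF K(1)] by (auto simp: bounded_iff)
  have c: "continuous_on UNIV (\<lambda>t. cgrad w (p + t *\<^sub>R e) \<bullet> e)"
    by (intro continuous_intros continuous_on_compose2[OF continuous_on_test_function(2)[OF w]]) auto
  have z: "w (p + t *\<^sub>R e) = 0" if "R + norm p + 1 \<le> \<bar>t\<bar>" for t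
  proof (rule K(2), rule notI)
    assume "p + t *\<^sub>R e \<in> K"
    then have "norm (p + t *\<^sub>R e) \<le> R" by (rule R)
    then show False using that norm_diff_ineq[of "t *\<^sub>R e" p] e by (simp add: add.commute)
  qed
  have "ennreal \<bar>w (p + x *\<^sub>R e)\<bar> \<le> (\<integral>\<^sup>+t. ennreal \<bar>cgrad w (p + t *\<^sub>R e) \<bullet> e\<bar> \<partial>lborel)"
    by (rule compact_support_le_integral_deriv[OF test_function_line_derivative[OF w] c z])
  also have "\<dots> \<le> (\<integral>\<^sup>+t. ennreal (norm (cgrad w (p + t *\<^sub>R e))) \<partial>lborel)"
    using Cauchy_Schwarz_ineq2[of _ e] e by (intro nn_integral_mono ennreal_leI) simp
  finally show ?thesis .
qed

text \<open>The endpoint inequality of Gagliardo and Nirenberg, stated for \<open>v\<^sup>2 \<le> \<bar>w\<bar>\<close> to avoid fractional powers.\<close>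

lemma Gagliardo_Nirenberg:
  assumes w: "w \<in> test_functions \<Omega>" and [measurable]: "v \<in> borel_measurable borel"
    and v: "\<And>x. (v x)\<^sup>2 \<le> ennreal \<bar>w x\<bar>"
  shows "(\<integral>\<^sup>+x. (v x) ^ 3 \<partial>lborel)\<^sup>2 \<le> (\<integral>\<^sup>+x. ennreal (norm (cgrad w x)) \<partial>lborel) ^ 3"
proof -
  note [measurable] = test_function_borel[OF w]
  let ?g = "\<lambda>x y z. ennreal (norm (cgrad w (point3 x y z)))"
  let ?N = "\<integral>\<^sup>+x. ennreal (norm (cgrad w x)) \<partial>lborel"
  define A where "A y z = (\<integral>\<^sup>+s. ?g s y z \<partial>lborel)" for y z
  define B where "B x z = (\<integral>\<^sup>+s. ?g x s z \<partial>lborel)" for x z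
  define C where "C x y = (\<integral>\<^sup>+s. ?g x y s \<partial>lborel)" for x y
  have [measurable]: "case_prod A \<in> borel_measurable (lborel \<Otimes>\<^sub>M lborel)"
    "case_prod B \<in> borel_measurable (lborel \<Otimes>\<^sub>M lborel)" "case_prod C \<in> borel_measurable (lborel \<Otimes>\<^sub>M lborel)"
    unfolding A_def[abs_def] B_def[abs_def] C_def[abs_def] by measurable
  \<comment> \<open>Each line integral bounds \<open>v\<close> by a root that depends on two
    coordinates only, which is the shape required by Loomis-Whitney.\<close>
  have root: "v p \<le> esqrt a" if "ennreal \<bar>w p\<bar> \<le> a" for p a
    by (rule ennreal_power2_le_imp_le) (use order_trans[OF v that] in simp)
  have le: "v (point3 x y z) \<le> esqrt (A y z)" "v (point3 x y z) \<le> esqrt (B x z)" "v (point3 x y z) \<le> esqrt (C x y)" for x y z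
  proof -
    have "ennreal \<bar>w (point3 x y z)\<bar> \<le> A y z"
      using test_function_le_line_integral[OF w, of "axis 1 1" "y *\<^sub>R axis 2 1 + z *\<^sub>R axis 3 1" x]
      unfolding A_def point3_def by (simp add: add_ac)
    moreover have "ennreal \<bar>w (point3 x y z)\<bar> \<le> B x z"
      using test_function_le_line_integral[OF w, of "axis 2 1" "x *\<^sub>R axis 1 1 + z *\<^sub>R axis 3 1" y]
      unfolding B_def point3_def by (simp add: add_ac)
    moreover have "ennreal \<bar>w (point3 x y z)\<bar> \<le> C x y"
      using test_function_le_line_integral[OF w, of "axis 3 1" "x *\<^sub>R axis 1 1 + y *\<^sub>R axis 2 1" z]
      unfolding C_def point3_def by (simp add: add_ac)
    ultimately show "v (point3 x y z) \<le> esqrt (A y z)" "v (point3 x y z) \<le> esqrt (B x z)" "v (point3 x y z) \<le> esqrt (C x y)"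
      by (blast intro: root)+
  qed
  have N: "?N = (\<integral>\<^sup>+x. \<integral>\<^sup>+y. \<integral>\<^sup>+z. ?g x y z \<partial>lborel \<partial>lborel \<partial>lborel)"
    by (rule nn_integral_point3) measurable
  have NC: "(\<integral>\<^sup>+x. \<integral>\<^sup>+y. (esqrt (C x y))\<^sup>2 \<partial>lborel \<partial>lborel) = ?N"
    unfolding N by (simp add: C_def)
  have NB: "(\<integral>\<^sup>+x. \<integral>\<^sup>+z. (esqrt (B x z))\<^sup>2 \<partial>lborel \<partial>lborel) = ?N"
    unfolding N esqrt_sq B_def by (intro nn_integral_cong lborel_pair.Fubini') measurable
  have NA: "(\<integral>\<^sup>+y. \<integral>\<^sup>+z. (esqrt (A y z))\<^sup>2 \<partial>lborel \<partial>lborel) = ?N"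
  proof -
    have "(\<integral>\<^sup>+y. \<integral>\<^sup>+z. (esqrt (A y z))\<^sup>2 \<partial>lborel \<partial>lborel) = (\<integral>\<^sup>+y. \<integral>\<^sup>+x. \<integral>\<^sup>+z. ?g x y z \<partial>lborel \<partial>lborel \<partial>lborel)"
      unfolding esqrt_sq A_def by (intro nn_integral_cong lborel_pair.Fubini') measurable
    also have "\<dots> = (\<integral>\<^sup>+x. \<integral>\<^sup>+y. \<integral>\<^sup>+z. ?g x y z \<partial>lborel \<partial>lborel \<partial>lborel)"
      by (rule lborel_pair.Fubini') measurable
    finally show ?thesis unfolding N .
  qed
  have "(\<integral>\<^sup>+x. (v x) ^ 3 \<partial>lborel) = (\<integral>\<^sup>+x. \<integral>\<^sup>+y. \<integral>\<^sup>+z. (v (point3 x y z)) ^ 3 \<partial>lborel \<partial>lborel \<partial>lborel)"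
    by (rule nn_integral_point3) measurable
  also have "\<dots> \<le> (\<integral>\<^sup>+x. \<integral>\<^sup>+y. \<integral>\<^sup>+z. esqrt (A y z) * esqrt (B x z) * esqrt (C x y) \<partial>lborel \<partial>lborel \<partial>lborel)"
    unfolding power3_eq_cube by (intro nn_integral_mono mult_mono le) auto
  finally have "(\<integral>\<^sup>+x. (v x) ^ 3 \<partial>lborel)\<^sup>2 \<le> (\<integral>\<^sup>+x. \<integral>\<^sup>+y. \<integral>\<^sup>+z. esqrt (A y z) * esqrt (B x z) * esqrt (C x y) \<partial>lborel \<partial>lborel \<partial>lborel)\<^sup>2"
    by (rule power_mono) simp
  also have "\<dots> \<le> ?N * ?N * ?N"
    using Loomis_Whitney[of "\<lambda>y z. esqrt (A y z)" "\<lambda>x z. esqrt (B x z)" "\<lambda>x y. esqrt (C x y)"]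
    unfolding NA NB NC by measurable
  finally show ?thesis by (simp add: power3_eq_cube)
qed

section \<open>The inequality for exponent 6 and its extension to \<open>H01\<close>\<close>

context bounded_open
begin

text \<open>Let X be the integral of |\<phi>|^6, Y that of |\<phi>|^3 times the norm of the
  gradient, and G the L2 norm of the gradient. The endpoint inequality for w = \<phi>^4 and v =
  \<phi>^2 gives X^2 \<le> (4 Y)^3, and Cauchy-Schwarz gives Y^2 \<le> X G^2. Squaring the first and
  inserting the second yields X^4 \<le> 4^6 X^3 G^6, whence 4096.\<close>

lemma Sobolev_test_function:
  assumes \<phi>: "\<phi> \<in> test_functions \<Omega>"
  shows "(\<integral>\<^sup>+x. ennreal (\<bar>\<phi> x\<bar> ^ 6) \<partial>lebesgue_on \<Omega>) \<le> ennreal (4096 * (Lnorm 2 \<Omega> (cgrad \<phi>)) ^ 6)"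
proof -
  note [measurable] = test_function_borel[OF \<phi>]
  note c = continuous_on_test_function[OF \<phi>]
  obtain K where K: "compact K" "K \<subseteq> \<Omega>" "\<And>x. x \<notin> K \<Longrightarrow> \<phi> x = 0"
    using test_function_support[OF \<phi>] by blast
  let ?G = "Lnorm 2 \<Omega> (cgrad \<phi>)"
  define X where "X = (LINT x|lborel. \<bar>\<phi> x\<bar> ^ 6)"
  define Y where "Y = (LINT x|lborel. \<bar>\<phi> x\<bar> ^ 3 * norm (cgrad \<phi> x))"
  have c6: "continuous_on UNIV (\<lambda>x. \<bar>\<phi> x\<bar> ^ 6)" by (intro continuous_intros c)
  have i6: "integrable lborel (\<lambda>x. \<bar>\<phi> x\<bar> ^ 6)"
    using K by (intro compact_support_integrable[OF c6 K(1)]) auto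
  have iY: "integrable lborel (\<lambda>x. \<bar>\<phi> x\<bar> ^ 3 * norm (cgrad \<phi> x))"
  proof (rule compact_support_integrable[OF _ K(1)])
    show "continuous_on UNIV (\<lambda>x. \<bar>\<phi> x\<bar> ^ 3 * norm (cgrad \<phi> x))" by (intro continuous_intros c)
  qed (use K in auto)
  have X: "(\<integral>\<^sup>+x. ennreal (\<bar>\<phi> x\<bar> ^ 6) \<partial>lborel) = ennreal X" "0 \<le> X"
    unfolding X_def by (rule nn_integral_eq_integral[OF i6], simp) (rule integral_nonneg_AE, simp)
  have Y: "(\<integral>\<^sup>+x. ennreal (\<bar>\<phi> x\<bar> ^ 3 * norm (cgrad \<phi> x)) \<partial>lborel) = ennreal Y" "0 \<le> Y"
    unfolding Y_def by (rule nn_integral_eq_integral[OF iY], simp) (rule integral_nonneg_AE, simp)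
  have "(\<integral>\<^sup>+x. ennreal (\<bar>\<phi> x\<bar> ^ 3 * norm (cgrad \<phi> x)) \<partial>lborel)\<^sup>2 \<le>
      (\<integral>\<^sup>+x. (ennreal (\<bar>\<phi> x\<bar> ^ 3))\<^sup>2 \<partial>lborel) * (\<integral>\<^sup>+x. (ennreal (norm (cgrad \<phi> x)))\<^sup>2 \<partial>lborel)"
    unfolding ennreal_mult[OF zero_le_power[OF abs_ge_zero] norm_ge_zero]
    by (rule Cauchy_Schwarz_nn_integral) measurable
  also have "\<dots> = ennreal X * ennreal (?G\<^sup>2)"
    using X(1) nn_integral_test_function_sq(2)[OF \<phi>] by (simp add: ennreal_power flip: power_mult)
  finally have YX: "Y\<^sup>2 \<le> X * ?G\<^sup>2"
    using X Y by (simp add: ennreal_power flip: ennreal_mult)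
  define w where "w x = (\<phi> x * \<phi> x) * (\<phi> x * \<phi> x)" for x
  have s: "smooth_on UNIV \<phi>" using \<phi> by (simp add: test_functions_def)
  have w: "w \<in> test_functions \<Omega>"
    unfolding w_def by (intro test_functions_mult \<phi> smooth_on_mult s)
  have gw: "cgrad w x = (4 * \<phi> x ^ 3) *\<^sub>R cgrad \<phi> x" for x
  proof (rule vector_eq_rdot[THEN iffD1], rule allI)
    fix h
    note d = test_function_has_derivative[OF \<phi>, of x]
    have "(w has_derivative (\<lambda>h. (\<phi> x * \<phi> x) * (\<phi> x * (cgrad \<phi> x \<bullet> h) + (cgrad \<phi> x \<bullet> h) * \<phi> x) + (\<phi> x * (cgrad \<phi> x \<bullet> h) + (cgrad \<phi> x \<bullet> h) * \<phi> x) * (\<phi> x * \<phi> x))) (at x)"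
      unfolding w_def by (intro has_derivative_mult d)
    from fun_cong[OF has_derivative_unique[OF test_function_has_derivative[OF w] this], of h]
    show "cgrad w x \<bullet> h = (4 * \<phi> x ^ 3) *\<^sub>R cgrad \<phi> x \<bullet> h"
      by (simp add: power3_eq_cube algebra_simps)
  qed
  have "(\<integral>\<^sup>+x. (ennreal ((\<phi> x)\<^sup>2)) ^ 3 \<partial>lborel)\<^sup>2 \<le> (\<integral>\<^sup>+x. ennreal (norm (cgrad w x)) \<partial>lborel) ^ 3"
  proof (rule Gagliardo_Nirenberg[OF w])
    fix x
    have "((\<phi> x)\<^sup>2)\<^sup>2 = \<bar>w x\<bar>" by (simp add: w_def power2_eq_square abs_mult)
    then show "(ennreal ((\<phi> x)\<^sup>2))\<^sup>2 \<le> ennreal \<bar>w x\<bar>" by (simp add: ennreal_power)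
  qed measurable
  also have "(\<integral>\<^sup>+x. (ennreal ((\<phi> x)\<^sup>2)) ^ 3 \<partial>lborel) = ennreal X"
    unfolding X(1)[symmetric] by (intro nn_integral_cong) (simp add: ennreal_power flip: power_mult)
  also have "(\<integral>\<^sup>+x. ennreal (norm (cgrad w x)) \<partial>lborel) = (\<integral>\<^sup>+x. 4 * ennreal (\<bar>\<phi> x\<bar> ^ 3 * norm (cgrad \<phi> x)) \<partial>lborel)"
  proof (intro nn_integral_cong)
    fix x
    have "norm (cgrad w x) = 4 * (\<bar>\<phi> x\<bar> ^ 3 * norm (cgrad \<phi> x))"
      by (simp add: gw abs_mult power_abs)
    then show "ennreal (norm (cgrad w x)) = 4 * ennreal (\<bar>\<phi> x\<bar> ^ 3 * norm (cgrad \<phi> x))"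
      by (simp only: ennreal_mult'[OF zero_le_numeral] ennreal_numeral)
  qed
  also have "\<dots> = 4 * ennreal Y"
    unfolding Y(1)[symmetric] by (rule nn_integral_cmult) measurable
  also have "(4 * ennreal Y) ^ 3 = ennreal (64 * Y ^ 3)"
    using Y by (simp add: power_mult_distrib ennreal_power ennreal_mult' flip: ennreal_numeral)
  finally have "X\<^sup>2 \<le> 64 * Y ^ 3" using X Y by (simp add: ennreal_power)
  then have "(X\<^sup>2)\<^sup>2 \<le> (64 * Y ^ 3)\<^sup>2" by (rule power_mono) simp
  also have "\<dots> = 4096 * (Y\<^sup>2) ^ 3" by (simp add: power_mult_distrib flip: power_mult)
  also have "\<dots> \<le> 4096 * (X * ?G\<^sup>2) ^ 3" using YX by (intro mult_left_mono power_mono) auto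
  also have "\<dots> = X ^ 3 * (4096 * ?G ^ 6)" by (simp add: power_mult_distrib flip: power_mult)
  finally have "X ^ 3 * X \<le> X ^ 3 * (4096 * ?G ^ 6)" by (simp add: eval_nat_numeral)
  \<comment> \<open>Division by \<open>X ^ 3\<close> is possible because \<open>X\<close> is a
    finite number for a test function; \<open>X = 0\<close> is trivial.\<close>
  then have XG: "X \<le> 4096 * ?G ^ 6"
    using X(2) by (cases "X = 0") (auto simp: mult_le_cancel_left Lnorm_nonneg)
  have "(\<integral>\<^sup>+x. ennreal (\<bar>\<phi> x\<bar> ^ 6) \<partial>lebesgue_on \<Omega>) = ennreal (LINT x|lebesgue_on \<Omega>. \<bar>\<phi> x\<bar> ^ 6)"
    using K by (intro nn_integral_eq_integral compact_support_lebesgue_on(1)[OF c6 K(1,2) _ dom_sets]) auto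
  also have "(LINT x|lebesgue_on \<Omega>. \<bar>\<phi> x\<bar> ^ 6) = X"
    unfolding X_def using K by (intro compact_support_lebesgue_on(2)[OF c6 K(1,2) _ dom_sets]) auto
  finally show ?thesis using XG by (simp add: ennreal_leI)
qed

text \<open>Fatou requires pointwise convergence, whereas \<open>H01\<close> supplies convergence in
  norm. A subsequence converges almost everywhere, and uniqueness of L2 limits identifies its limit
  with \<open>u\<close>.\<close>

lemma H01_AE_approx:
  assumes u: "u \<in> H01 \<Omega>"
  shows "\<exists>\<phi>. (\<forall>n. \<phi> n \<in> test_functions \<Omega>) \<and> (AE x in lebesgue_on \<Omega>. (\<lambda>n. \<phi> n x) \<longlonglongrightarrow> u x) \<and>
    (\<forall>n. Lnorm 2 \<Omega> (cgrad (\<phi> n)) \<le> Lnorm 2 \<Omega> (grad \<Omega> u) + inverse (real (Suc n)))"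
proof -
  note uL = H1_L2[OF H01_H1[OF u]]
  have "\<exists>\<phi>. \<phi> \<in> test_functions \<Omega> \<and> Lnorm 2 \<Omega> (\<lambda>x. u x - \<phi> x) < inverse (real (Suc n)) \<and>
      Lnorm 2 \<Omega> (\<lambda>x. grad \<Omega> u x - grad \<Omega> \<phi> x) < inverse (real (Suc n))" for n
  proof -
    have "0 < inverse (real (Suc n))" by simp
    from H01_approx[OF u this] show ?thesis by blast
  qed
  then have "\<exists>\<phi>. \<forall>n. \<phi> n \<in> test_functions \<Omega> \<and> Lnorm 2 \<Omega> (\<lambda>x. u x - \<phi> n x) < inverse (real (Suc n)) \<and>
      Lnorm 2 \<Omega> (\<lambda>x. grad \<Omega> u x - grad \<Omega> (\<phi> n) x) < inverse (real (Suc n))"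
    by (intro choice allI)
  then obtain \<phi> where \<phi>: "\<And>n. \<phi> n \<in> test_functions \<Omega>"
    "\<And>n. Lnorm 2 \<Omega> (\<lambda>x. u x - \<phi> n x) < inverse (real (Suc n))"
    "\<And>n. Lnorm 2 \<Omega> (\<lambda>x. grad \<Omega> u x - grad \<Omega> (\<phi> n) x) < inverse (real (Suc n))"
    by blast
  note pL = H1_L2[OF grad_test_function(1)[OF \<phi>(1)]]
  have conv: "(\<lambda>n. Lnorm 2 \<Omega> (\<lambda>x. \<phi> n x - u x)) \<longlonglongrightarrow> 0"
  proof (rule tendsto_sandwich[OF _ _ tendsto_const LIMSEQ_inverse_real_of_nat])
    show "\<forall>\<^sub>F n in sequentially. Lnorm 2 \<Omega> (\<lambda>x. \<phi> n x - u x) \<le> inverse (real (Suc n))"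
      unfolding Lnorm_2_minus[of \<Omega> _ u] by (intro always_eventually allI less_imp_le \<phi>(2))
  qed (simp add: Lnorm_nonneg)
  have Cauchy: "\<exists>N. \<forall>m\<ge>N. \<forall>n\<ge>N. Lnorm 2 \<Omega> (\<lambda>x. \<phi> m x - \<phi> n x) < e" if e: "0 < e" for e
  proof -
    obtain N where N: "\<And>n. n \<ge> N \<Longrightarrow> Lnorm 2 \<Omega> (\<lambda>x. \<phi> n x - u x) < e/2"
      using order_tendstoD(2)[OF conv, of "e/2"] e by (auto simp: eventually_sequentially)
    have "Lnorm 2 \<Omega> (\<lambda>x. \<phi> m x - \<phi> n x) < e" if "m \<ge> N" "n \<ge> N" for m n
      using N[OF that(1)] N[OF that(2)] Lnorm_2_triangle_diff[OF pL(1)[of m] uL(1) pL(1)[of n]]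
        Lnorm_2_minus[of \<Omega> u "\<phi> n"] by linarith
    then show ?thesis by blast
  qed
  obtain g r where g: "L2_on \<Omega> g" "(\<lambda>n. Lnorm 2 \<Omega> (\<lambda>x. \<phi> n x - g x)) \<longlonglongrightarrow> 0"
    "strict_mono r" "AE x in lebesgue_on \<Omega>. (\<lambda>k. \<phi> (r k) x) \<longlonglongrightarrow> g x"
    by (rule L2_complete[OF pL(1) dom_lmeasurable Cauchy])
  have "(\<lambda>n. Lnorm 2 \<Omega> (\<lambda>x. \<phi> n x - u x) + Lnorm 2 \<Omega> (\<lambda>x. \<phi> n x - g x)) \<longlonglongrightarrow> 0"
    using tendsto_add[OF conv g(2)] by simp
  moreover have "Lnorm 2 \<Omega> (\<lambda>x. g x - u x) \<le> Lnorm 2 \<Omega> (\<lambda>x. \<phi> n x - u x) + Lnorm 2 \<Omega> (\<lambda>x. \<phi> n x - g x)" for n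
    using Lnorm_2_triangle_diff[OF g(1) pL(1)[of n] uL(1)] Lnorm_2_minus[of \<Omega> g "\<phi> n"] by linarith
  ultimately have "Lnorm 2 \<Omega> (\<lambda>x. g x - u x) \<le> 0"
    by (intro LIMSEQ_le_const[of _ 0]) auto
  then have "Lnorm 2 \<Omega> (\<lambda>x. g x - u x) = 0" using Lnorm_nonneg[of 2 \<Omega> "\<lambda>x. g x - u x"] by linarith
  then have "AE x in lebesgue_on \<Omega>. g x - u x = 0"
    using Lnorm_2_eq_0_iff[OF L2_on_diff[OF g(1) uL(1)]] by simp
  with g(4) have AE: "AE x in lebesgue_on \<Omega>. (\<lambda>k. \<phi> (r k) x) \<longlonglongrightarrow> u x"
    by eventually_elim simp
  have "Lnorm 2 \<Omega> (cgrad (\<phi> (r n))) \<le> Lnorm 2 \<Omega> (grad \<Omega> u) + inverse (real (Suc n))" for n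
  proof -
    have "inverse (real (Suc (r n))) \<le> inverse (real (Suc n))"
      using seq_suble[OF g(3), of n] by (intro le_imp_inverse_le) auto
    then show ?thesis
      using Lnorm_2_diff_le[OF uL(3) pL(3)[of "r n"]] \<phi>(3)[of "r n"] grad_test_function(3)[OF \<phi>(1)[of "r n"]] by linarith
  qed
  then show ?thesis using AE \<phi>(1) by (intro exI[of _ "\<lambda>n. \<phi> (r n)"]) auto
qed

lemma Sobolev_6:
  assumes u: "u \<in> H01 \<Omega>"
  shows "integrable (lebesgue_on \<Omega>) (\<lambda>x. \<bar>u x\<bar> ^ 6)"
    "(LINT x|lebesgue_on \<Omega>. \<bar>u x\<bar> ^ 6) \<le> 4096 * (Lnorm 2 \<Omega> (grad \<Omega> u)) ^ 6"
proof -
  let ?M = "lebesgue_on \<Omega>" and ?G = "Lnorm 2 \<Omega> (grad \<Omega> u)"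
  have [measurable]: "u \<in> borel_measurable ?M" using H1_L2(1)[OF H01_H1[OF u]] by (rule L2_onD)
  obtain \<phi> where \<phi>: "\<And>n. \<phi> n \<in> test_functions \<Omega>" "AE x in ?M. (\<lambda>n. \<phi> n x) \<longlonglongrightarrow> u x"
    "\<And>n. Lnorm 2 \<Omega> (cgrad (\<phi> n)) \<le> ?G + inverse (real (Suc n))"
    using H01_AE_approx[OF u] by blast
  have [measurable]: "\<phi> n \<in> borel_measurable ?M" for n using test_L2(1)[OF \<phi>(1)] by (rule L2_onD)
  \<comment> \<open>For fixed \<open>m\<close> all terms with \<open>n \<ge> m\<close> share one
    bound; letting \<open>m\<close> grow afterwards loses nothing in the constant.\<close>
  have b: "(\<integral>\<^sup>+x. ennreal (\<bar>u x\<bar> ^ 6) \<partial>?M) \<le> ennreal (4096 * (?G + inverse (real (Suc m))) ^ 6)" for m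
  proof (rule nn_integral_Fatou_bound[where F="\<lambda>n x. \<bar>\<phi> n x\<bar> ^ 6" and N=m])
    show "AE x in ?M. (\<lambda>n. \<bar>\<phi> n x\<bar> ^ 6) \<longlonglongrightarrow> \<bar>u x\<bar> ^ 6"
      using \<phi>(2) by eventually_elim (intro tendsto_intros)
    fix n assume "m \<le> n"
    then have "inverse (real (Suc n)) \<le> inverse (real (Suc m))" by (intro le_imp_inverse_le) auto
    then have "Lnorm 2 \<Omega> (cgrad (\<phi> n)) \<le> ?G + inverse (real (Suc m))" using \<phi>(3)[of n] by linarith
    then show "(\<integral>\<^sup>+x. ennreal (\<bar>\<phi> n x\<bar> ^ 6) \<partial>?M) \<le> ennreal (4096 * (?G + inverse (real (Suc m))) ^ 6)"
      by (intro order_trans[OF Sobolev_test_function[OF \<phi>(1)]] ennreal_leI mult_left_mono power_mono Lnorm_nonneg) auto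
  qed measurable
  have "(\<lambda>m. ennreal (4096 * (?G + inverse (real (Suc m))) ^ 6)) \<longlonglongrightarrow> ennreal (4096 * (?G + 0) ^ 6)"
    by (intro tendsto_intros LIMSEQ_inverse_real_of_nat)
  then have "(\<integral>\<^sup>+x. ennreal (\<bar>u x\<bar> ^ 6) \<partial>?M) \<le> ennreal (4096 * (?G + 0) ^ 6)"
    by (rule LIMSEQ_le_const) (use b in blast)
  then have le: "(\<integral>\<^sup>+x. ennreal (\<bar>u x\<bar> ^ 6) \<partial>?M) \<le> ennreal (4096 * ?G ^ 6)" by simp
  show i: "integrable ?M (\<lambda>x. \<bar>u x\<bar> ^ 6)"
    by (rule integrableI_nonneg) (use le le_less_trans in fastforce)+
  then have "(\<integral>\<^sup>+x. ennreal (\<bar>u x\<bar> ^ 6) \<partial>?M) = ennreal (LINT x|?M. \<bar>u x\<bar> ^ 6)"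
    by (intro nn_integral_eq_integral) auto
  then show "(LINT x|?M. \<bar>u x\<bar> ^ 6) \<le> 4096 * ?G ^ 6" using le by (simp add: Lnorm_nonneg)
qed

text \<open>The exponent 6 inequality recast as an L2 bound, so that products with |u| can be
  handled by Cauchy-Schwarz. The constant is the square root of 4096.\<close>

lemma H01_cube:
  assumes u: "u \<in> H01 \<Omega>"
  shows "L2_on \<Omega> (\<lambda>x. \<bar>u x\<bar> ^ 3)" "Lnorm 2 \<Omega> (\<lambda>x. \<bar>u x\<bar> ^ 3) \<le> 64 * (Lnorm 2 \<Omega> (grad \<Omega> u)) ^ 3"
proof -
  have [measurable]: "u \<in> borel_measurable (lebesgue_on \<Omega>)"
    using H1_L2(1)[OF H01_H1[OF u]] by (rule L2_onD)
  have p6: "(\<bar>x\<bar> ^ 3)\<^sup>2 = \<bar>x\<bar> ^ 6" for x :: real by (simp flip: power_mult)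
  show "L2_on \<Omega> (\<lambda>x. \<bar>u x\<bar> ^ 3)" unfolding L2_on_def using Sobolev_6(1)[OF u] by (simp add: p6)
  show "Lnorm 2 \<Omega> (\<lambda>x. \<bar>u x\<bar> ^ 3) \<le> 64 * (Lnorm 2 \<Omega> (grad \<Omega> u)) ^ 3"
  proof (rule power2_le_imp_le)
    have "(Lnorm 2 \<Omega> (\<lambda>x. \<bar>u x\<bar> ^ 3))\<^sup>2 = (LINT x|lebesgue_on \<Omega>. \<bar>u x\<bar> ^ 6)"
      by (simp add: Lnorm_2_sq p6)
    also have "\<dots> \<le> (64 * (Lnorm 2 \<Omega> (grad \<Omega> u)) ^ 3)\<^sup>2"
      using Sobolev_6(2)[OF u] by (simp add: power_mult_distrib flip: power_mult)
    finally show "(Lnorm 2 \<Omega> (\<lambda>x. \<bar>u x\<bar> ^ 3))\<^sup>2 \<le> (64 * (Lnorm 2 \<Omega> (grad \<Omega> u)) ^ 3)\<^sup>2" .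
  qed (simp add: Lnorm_nonneg)
qed

text \<open>Cauchy-Schwarz for |u|^4 = |u| |u|^3.\<close>

lemma L4_bound:
  assumes u: "u \<in> H01 \<Omega>"
  shows "integrable (lebesgue_on \<Omega>) (\<lambda>x. \<bar>u x\<bar> ^ 4)"
    "(Lnorm 4 \<Omega> u) ^ 4 \<le> 64 * Lnorm 2 \<Omega> u * (Lnorm 2 \<Omega> (grad \<Omega> u)) ^ 3"
proof -
  let ?M = "lebesgue_on \<Omega>" and ?G = "Lnorm 2 \<Omega> (grad \<Omega> u)"
  have uL: "L2_on \<Omega> u" by (rule H1_L2(1)[OF H01_H1[OF u]])
  then have [measurable]: "u \<in> borel_measurable ?M" by (rule L2_onD)
  have L1: "L2_on \<Omega> (\<lambda>x. \<bar>u x\<bar>)" using uL by (simp add: L2_on_def)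
  note L3 = H01_cube(1)[OF u] and n3 = H01_cube(2)[OF u]
  have p4: "\<bar>x\<bar> \<bullet> \<bar>x\<bar> ^ 3 = \<bar>x\<bar> ^ 4" for x :: real by (simp add: eval_nat_numeral)
  show "integrable ?M (\<lambda>x. \<bar>u x\<bar> ^ 4)" using L2_on_integrable_inner[OF L1 L3] unfolding p4 .
  have "(Lnorm 4 \<Omega> u) ^ 4 = (LINT x|?M. \<bar>u x\<bar> \<bullet> \<bar>u x\<bar> ^ 3)" unfolding Lnorm_4_pow p4 by simp
  also have "\<dots> \<le> Lnorm 2 \<Omega> (\<lambda>x. \<bar>u x\<bar>) * Lnorm 2 \<Omega> (\<lambda>x. \<bar>u x\<bar> ^ 3)"
    using L2_on_Cauchy_Schwarz[OF L1 L3] by linarith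
  also have "\<dots> \<le> Lnorm 2 \<Omega> (\<lambda>x. \<bar>u x\<bar>) * (64 * ?G ^ 3)"
    by (intro mult_left_mono n3 Lnorm_nonneg)
  also have "Lnorm 2 \<Omega> (\<lambda>x. \<bar>u x\<bar>) = Lnorm 2 \<Omega> u" by (simp add: Lnorm_2)
  finally show "(Lnorm 4 \<Omega> u) ^ 4 \<le> 64 * Lnorm 2 \<Omega> u * ?G ^ 3" by (simp add: mult_ac)
qed

end

subsection \<open>The principal eigenvalue and weak limits\<close>

context bounded_open
begin

abbreviation Mn :: "(pt \<Rightarrow> real) \<Rightarrow> real" where "Mn u \<equiv> Lnorm 2 \<Omega> u"
abbreviation Gn :: "(pt \<Rightarrow> real) \<Rightarrow> real" where "Gn u \<equiv> Lnorm 2 \<Omega> (grad \<Omega> u)"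

lemma H01_L2:
  assumes "u \<in> H01 \<Omega>"
  shows "L2_on \<Omega> u" "L2_on \<Omega> (grad \<Omega> u)"
  using H1_L2[OF H01_H1[OF assms]] by auto

lemma Mn_add_scaled:
  assumes "u \<in> H01 \<Omega>" "v \<in> H01 \<Omega>"
  shows "(Mn (\<lambda>x. u x + c * v x))\<^sup>2 = (Mn u)\<^sup>2 + 2 * c * (LINT x|lebesgue_on \<Omega>. u x * v x) + c\<^sup>2 * (Mn v)\<^sup>2"
  using L2_on_integral_add_scaled[OF H01_L2(1)[OF assms(1)] H01_L2(1)[OF assms(2)], of c] by simp

lemma Gn_add_scaled:
  assumes "u \<in> H01 \<Omega>" "v \<in> H01 \<Omega>"
  shows "(Gn (\<lambda>x. u x + c * v x))\<^sup>2 = (Gn u)\<^sup>2 + 2 * c * (LINT x|lebesgue_on \<Omega>. grad \<Omega> u x \<bullet> grad \<Omega> v x) + c\<^sup>2 * (Gn v)\<^sup>2"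
  unfolding H1_add_scaled(3)[OF assms[THEN H01_H1]]
  by (rule L2_on_integral_add_scaled[OF H01_L2(2)[OF assms(1)] H01_L2(2)[OF assms(2)]])

lemma Lnorm_scale: "0 < q \<Longrightarrow> Lnorm q \<Omega> (\<lambda>x. t * u x) = \<bar>t\<bar> * Lnorm q \<Omega> u" for u :: "pt \<Rightarrow> real"
  using Lnorm_scaleR[of q \<Omega> t u] by simp

lemma H01_scale:
  assumes "u \<in> H01 \<Omega>"
  shows "(\<lambda>x. t * u x) \<in> H01 \<Omega>" "Gn (\<lambda>x. t * u x) = \<bar>t\<bar> * Gn u"
proof -
  have eq: "(\<lambda>x. u x + (t - 1) * u x) = (\<lambda>x. t * u x)" by (auto simp: algebra_simps)
  show "(\<lambda>x. t * u x) \<in> H01 \<Omega>" using H01_add_scaled[OF assms assms, of "t - 1"] by (simp add: eq)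
  have "(\<lambda>x. grad \<Omega> u x + (t - 1) *\<^sub>R grad \<Omega> u x) = (\<lambda>x. t *\<^sub>R grad \<Omega> u x)" by (auto simp: algebra_simps)
  then show "Gn (\<lambda>x. t * u x) = \<bar>t\<bar> * Gn u"
    using H1_add_scaled(3)[OF H01_H1[OF assms] H01_H1[OF assms], of "t - 1"] by (simp add: eq Lnorm_scaleR)
qed

lemma Gn_diff:
  assumes "u \<in> H01 \<Omega>" "v \<in> H01 \<Omega>"
  shows "Lnorm 2 \<Omega> (\<lambda>x. grad \<Omega> u x - grad \<Omega> v x) = Gn (\<lambda>x. u x - v x)"
  using H1_diff(2)[OF assms[THEN H01_H1]] by simp

lemma Gn_parallelogram:
  assumes "u \<in> H01 \<Omega>" "v \<in> H01 \<Omega>"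
  shows "(Gn (\<lambda>x. u x - v x))\<^sup>2 + (Gn (\<lambda>x. u x + v x))\<^sup>2 = 2 * (Gn u)\<^sup>2 + 2 * (Gn v)\<^sup>2"
  using Gn_add_scaled[OF assms, of 1] Gn_add_scaled[OF assms, of "-1"] by simp

lemma Mn_parallelogram:
  assumes "u \<in> H01 \<Omega>" "v \<in> H01 \<Omega>"
  shows "(Mn (\<lambda>x. u x - v x))\<^sup>2 + (Mn (\<lambda>x. u x + v x))\<^sup>2 = 2 * (Mn u)\<^sup>2 + 2 * (Mn v)\<^sup>2"
  using Mn_add_scaled[OF assms, of 1] Mn_add_scaled[OF assms, of "-1"] by simp

lemma zero_H01_iff:
  assumes "u \<in> H01 \<Omega>"
  shows "u \<in> zero_H01 \<Omega> \<longleftrightarrow> Mn u = 0"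
  using assms Lnorm_2_eq_0_iff[OF H01_L2(1)[OF assms]] by (simp add: zero_H01_def)

lemma nonzero_pos:
  assumes "u \<in> H01 \<Omega>" "u \<notin> zero_H01 \<Omega>"
  shows "0 < Mn u" "0 < Gn u"
proof -
  show M: "0 < Mn u" using assms zero_H01_iff[OF assms(1)] Lnorm_nonneg[of 2 \<Omega> u] by linarith
  obtain C where "0 < C" "Mn u \<le> C * Gn u" using Poincare assms(1) by blast
  then show "0 < Gn u" using M by (metis less_le_trans zero_less_mult_pos)
qed

text \<open>A bump function is positive on a nonempty open box inside \<Omega>, which is not a null
  set.\<close>

lemma exists_nonzero:
  assumes "\<Omega> \<noteq> {}"
  obtains u where "u \<in> H01 \<Omega>" "u \<notin> zero_H01 \<Omega>"
proof -
  obtain x where x: "x \<in> \<Omega>" using assms by blast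
  obtain c d where cd: "cbox c d \<subseteq> \<Omega>" "x \<in> box c d"
    using open_contains_cbox[OF open_dom x] by metis
  let ?u = "box_bump c d 0"
  have u: "?u \<in> H01 \<Omega>" by (intro test_function_H01 box_bump_test_function cd)
  have "?u \<notin> zero_H01 \<Omega>"
  proof
    assume "?u \<in> zero_H01 \<Omega>"
    then have "AE x in lebesgue. x \<in> \<Omega> \<longrightarrow> ?u x = 0"
      using dom_sets by (simp add: zero_H01_def AE_restrict_space_iff)
    then have "AE x in lebesgue. x \<notin> box c d"
    proof eventually_elim
      case (elim x)
      then show ?case using box_bump_pos_iff[of c d 0 x] cd(1) box_subset_cbox[of c d] by auto
    qed
    then have "box c d \<in> null_sets lebesgue" by (subst AE_iff_null_sets) auto
    then show False using cd(2) by (auto simp: negligible_interval simp flip: negligible_iff_null_sets)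
  qed
  then show thesis using u that by blast
qed

lemma LIMSEQ_Lnorm_2:
  assumes "\<And>n. L2_on \<Omega> (f n)" "L2_on \<Omega> g" "(\<lambda>n. Lnorm 2 \<Omega> (\<lambda>x. f n x - g x)) \<longlonglongrightarrow> 0"
  shows "(\<lambda>n. Lnorm 2 \<Omega> (f n)) \<longlonglongrightarrow> Lnorm 2 \<Omega> g"
proof (rule LIM_zero_cancel, rule Lim_null_comparison[OF _ assms(3)])
  show "\<forall>\<^sub>F n in sequentially. norm (Lnorm 2 \<Omega> (f n) - Lnorm 2 \<Omega> g) \<le> Lnorm 2 \<Omega> (\<lambda>x. f n x - g x)"
    using Lnorm_2_diff_le[OF assms(1,2)] by simp
qed

text \<open>A minimizing sequence of the Rayleigh quotient is Cauchy in \<open>L\<^sup>2\<close> by Rellich, hence in \<open>H\<^sup>1\<close> by the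
  parallelogram law and minimality.\<close>

lemma Rayleigh_minimizer:
  assumes "\<Omega> \<noteq> {}"
  obtains \<psi> where "\<psi> \<in> H01 \<Omega>" "Mn \<psi> = 1" "\<And>u. u \<in> H01 \<Omega> \<Longrightarrow> (Gn \<psi>)\<^sup>2 * (Mn u)\<^sup>2 \<le> (Gn u)\<^sup>2"
proof -
  define R where "R = (\<lambda>u. (Gn u)\<^sup>2) ` {u \<in> H01 \<Omega>. Mn u = 1}"
  define \<mu> where "\<mu> = Inf R"
  have normalize: "(Gn u)\<^sup>2 / (Mn u)\<^sup>2 \<in> R" if u: "u \<in> H01 \<Omega>" "u \<notin> zero_H01 \<Omega>" for u
  proof -
    have "0 < Mn u" by (rule nonzero_pos[OF u])
    then show ?thesis unfolding R_def
      using H01_scale[OF u(1), of "1 / Mn u"] Lnorm_scale[of 2 "1 / Mn u" u]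
      by (intro image_eqI[of _ _ "\<lambda>x. 1 / Mn u * u x"]) (auto simp: power_divide)
  qed
  obtain u0 where "u0 \<in> H01 \<Omega>" "u0 \<notin> zero_H01 \<Omega>" by (rule exists_nonzero[OF assms])
  then have ne: "R \<noteq> {}" using normalize by blast
  have bdd: "bdd_below R" by (rule bdd_belowI[of _ 0]) (auto simp: R_def)
  have \<mu>0: "0 \<le> \<mu>" unfolding \<mu>_def by (rule cInf_greatest[OF ne]) (auto simp: R_def)
  have low: "\<mu> * (Mn u)\<^sup>2 \<le> (Gn u)\<^sup>2" if u: "u \<in> H01 \<Omega>" for u
  proof (cases "u \<in> zero_H01 \<Omega>")
    case True
    then show ?thesis using zero_H01_iff[OF u] by simp
  next
    case False
    then have "\<mu> \<le> (Gn u)\<^sup>2 / (Mn u)\<^sup>2" unfolding \<mu>_def by (intro cInf_lower bdd normalize u)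
    then show ?thesis using nonzero_pos(1)[OF u False] by (simp add: pos_le_divide_eq)
  qed
  have "\<exists>u. u \<in> H01 \<Omega> \<and> Mn u = 1 \<and> (Gn u)\<^sup>2 < \<mu> + inverse (real (Suc n))" for n
  proof -
    have "Inf R < \<mu> + inverse (real (Suc n))" by (simp add: \<mu>_def)
    from cInf_lessD[OF ne this] show ?thesis by (auto simp: R_def)
  qed
  then have "\<exists>u. \<forall>n. u n \<in> H01 \<Omega> \<and> Mn (u n) = 1 \<and> (Gn (u n))\<^sup>2 < \<mu> + inverse (real (Suc n))"
    by (intro choice allI)
  then obtain u where u: "\<And>n. u n \<in> H01 \<Omega>" "\<And>n. Mn (u n) = 1" "\<And>n. (Gn (u n))\<^sup>2 < \<mu> + inverse (real (Suc n))"
    by blast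
  have inv1: "inverse (real (Suc n)) \<le> 1" for n by (simp add: field_simps)
  have "Gn (u n) \<le> \<mu> + 1" for n
  proof (rule power2_le_imp_le)
    have "(Gn (u n))\<^sup>2 \<le> \<mu> + 1" using u(3)[of n] inv1[of n] by linarith
    also have "\<dots> \<le> (\<mu> + 1)\<^sup>2" using \<mu>0 by (simp add: power2_eq_square)
    finally show "(Gn (u n))\<^sup>2 \<le> (\<mu> + 1)\<^sup>2" .
  qed (use \<mu>0 in simp)
  then obtain r :: "nat \<Rightarrow> nat" where r: "strict_mono r" and
    CM: "\<And>e. 0 < e \<Longrightarrow> \<exists>N. \<forall>m\<ge>N. \<forall>n\<ge>N. Mn (\<lambda>x. u (r m) x - u (r n) x) < e"
    using Rellich[of u "\<mu> + 1"] u(1) by blast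
  have CG: "\<exists>N. \<forall>m\<ge>N. \<forall>n\<ge>N. Lnorm 2 \<Omega> (\<lambda>x. grad \<Omega> (u (r m)) x - grad \<Omega> (u (r n)) x) < e" if e: "0 < e" for e
  proof -
    \<comment> \<open>The parallelogram law will leave at most
      \<open>e\<^sup>2 / 2 + \<mu> * d\<^sup>2\<close>: the first part from the near minimality of
      both energies, the second from the L2 distance. The \<open>+ 1\<close> covers \<mu> =
      0.\<close>
    define d where "d = e / sqrt (2 * (\<mu> + 1))"
    have d: "0 < d" "\<mu> * d\<^sup>2 \<le> e\<^sup>2 / 2"
    proof -
      show "0 < d" using e \<mu>0 by (simp add: d_def)
      have "d\<^sup>2 = e\<^sup>2 / (2 * (\<mu> + 1))" using \<mu>0 by (simp add: d_def power_divide)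
      then have "2 * d\<^sup>2 + 2 * (\<mu> * d\<^sup>2) = e\<^sup>2" using \<mu>0 by (simp add: field_simps)
      then show "\<mu> * d\<^sup>2 \<le> e\<^sup>2 / 2" using zero_le_power2[of d] by linarith
    qed
    obtain N1 where N1: "\<And>m n. m \<ge> N1 \<Longrightarrow> n \<ge> N1 \<Longrightarrow> Mn (\<lambda>x. u (r m) x - u (r n) x) < d"
      using CM[OF d(1)] by blast
    obtain N2 where N2: "\<And>n. n \<ge> N2 \<Longrightarrow> inverse (real (Suc n)) < e\<^sup>2 / 8"
      using order_tendstoD(2)[OF LIMSEQ_inverse_real_of_nat, of "e\<^sup>2 / 8"] e by (auto simp: eventually_sequentially)
    have "Lnorm 2 \<Omega> (\<lambda>x. grad \<Omega> (u (r m)) x - grad \<Omega> (u (r n)) x) < e" if mn: "m \<ge> max N1 N2" "n \<ge> max N1 N2" for m n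
    proof -
      let ?u = "u (r m)" and ?v = "u (r n)"
      have "N2 \<le> r m" "N2 \<le> r n" using mn seq_suble[OF r, of m] seq_suble[OF r, of n] by auto
      then have G: "(Gn ?u)\<^sup>2 < \<mu> + e\<^sup>2 / 8" "(Gn ?v)\<^sup>2 < \<mu> + e\<^sup>2 / 8"
        using u(3)[of "r m"] u(3)[of "r n"] N2[of "r m"] N2[of "r n"] by linarith+
      have "(Mn (\<lambda>x. ?u x - ?v x))\<^sup>2 \<le> d\<^sup>2"
        using N1[of m n] mn by (intro power_mono Lnorm_nonneg) auto
      then have "\<mu> * (Mn (\<lambda>x. ?u x - ?v x))\<^sup>2 \<le> \<mu> * d\<^sup>2" using \<mu>0 by (rule mult_left_mono)
      moreover have "\<mu> * (Mn (\<lambda>x. ?u x + ?v x))\<^sup>2 \<le> (Gn (\<lambda>x. ?u x + ?v x))\<^sup>2"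
        using low[OF H01_add_scaled[OF u(1)[of "r m"] u(1)[of "r n"], of 1]] by simp
      moreover have "(Mn (\<lambda>x. ?u x + ?v x))\<^sup>2 = 4 - (Mn (\<lambda>x. ?u x - ?v x))\<^sup>2"
        using Mn_parallelogram[OF u(1)[of "r m"] u(1)[of "r n"]] u(2) by simp
      ultimately have "4 * \<mu> - \<mu> * d\<^sup>2 \<le> (Gn (\<lambda>x. ?u x + ?v x))\<^sup>2"
        by (simp add: right_diff_distrib)
      then have "(Gn (\<lambda>x. ?u x - ?v x))\<^sup>2 < e\<^sup>2"
        using Gn_parallelogram[OF u(1)[of "r m"] u(1)[of "r n"]] G d(2) by linarith
      then have "Gn (\<lambda>x. ?u x - ?v x) < e" by (rule power2_less_imp_less) (use e in simp)
      then show ?thesis by (simp add: Gn_diff[OF u(1) u(1)])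
    qed
    then show ?thesis by blast
  qed
  obtain \<psi> where \<psi>: "\<psi> \<in> H01 \<Omega>" "(\<lambda>n. Mn (\<lambda>x. u (r n) x - \<psi> x)) \<longlonglongrightarrow> 0"
    "(\<lambda>n. Lnorm 2 \<Omega> (\<lambda>x. grad \<Omega> (u (r n)) x - grad \<Omega> \<psi> x)) \<longlonglongrightarrow> 0"
    by (rule H01_complete[of "\<lambda>n. u (r n)", OF u(1) CM CG])
  have "(\<lambda>n. Mn (u (r n))) \<longlonglongrightarrow> Mn \<psi>"
    by (rule LIMSEQ_Lnorm_2[OF H01_L2(1)[OF u(1)] H01_L2(1)[OF \<psi>(1)] \<psi>(2)])
  then have M1: "Mn \<psi> = 1" by (simp add: u(2) LIMSEQ_const_iff)
  have "(\<lambda>n. (Gn (u (r n)))\<^sup>2) \<longlonglongrightarrow> (Gn \<psi>)\<^sup>2"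
    by (intro tendsto_power LIMSEQ_Lnorm_2[OF H01_L2(2)[OF u(1)] H01_L2(2)[OF \<psi>(1)] \<psi>(3)])
  moreover have "(\<lambda>n. \<mu> + inverse (real (Suc (r n)))) \<longlonglongrightarrow> \<mu> + 0"
    by (intro tendsto_add tendsto_const LIMSEQ_subseq_LIMSEQ[OF LIMSEQ_inverse_real_of_nat r, unfolded o_def])
  ultimately have "(Gn \<psi>)\<^sup>2 \<le> \<mu> + 0"
    by (rule LIMSEQ_le) (use u(3) less_imp_le in blast)
  then have "(Gn \<psi>)\<^sup>2 \<le> \<mu>" by simp
  then have "(Gn \<psi>)\<^sup>2 * (Mn v)\<^sup>2 \<le> (Gn v)\<^sup>2" if "v \<in> H01 \<Omega>" for v
    using low[OF that] mult_right_mono[of "(Gn \<psi>)\<^sup>2" \<mu> "(Mn v)\<^sup>2"] by simp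
  then show thesis using that \<psi>(1) M1 by blast
qed

lemma eigenfunction_Rayleigh:
  assumes "dirichlet_eigenfunction \<Omega> \<mu> u"
  shows "u \<in> H01 \<Omega>" "u \<notin> zero_H01 \<Omega>" "(Gn u)\<^sup>2 = \<mu> * (Mn u)\<^sup>2"
proof -
  show u: "u \<in> H01 \<Omega>" "u \<notin> zero_H01 \<Omega>" using assms by (auto simp: dirichlet_eigenfunction_def)
  have "(LINT x|lebesgue_on \<Omega>. grad \<Omega> u x \<bullet> grad \<Omega> u x) = \<mu> * (LINT x|lebesgue_on \<Omega>. u x * u x)"
    using assms u(1) unfolding dirichlet_eigenfunction_def by blast
  moreover have "(Gn u)\<^sup>2 = (LINT x|lebesgue_on \<Omega>. grad \<Omega> u x \<bullet> grad \<Omega> u x)"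
    unfolding Lnorm_2_sq by (simp add: dot_square_norm)
  moreover have "(Mn u)\<^sup>2 = (LINT x|lebesgue_on \<Omega>. u x * u x)"
    unfolding Lnorm_2_sq by (simp add: power2_eq_square)
  ultimately show "(Gn u)\<^sup>2 = \<mu> * (Mn u)\<^sup>2" by simp
qed

text \<open>Perturbing the minimizer by t v gives a nonnegative quadratic polynomial in t without
  constant term, so its linear coefficient vanishes, which is the weak eigenvalue equation. Any
  other eigenfunction, tested with itself, has its eigenvalue as Rayleigh quotient; hence the
  minimum is the value selected by \<open>LEAST\<close>.\<close>

lemma principal_eigenvalue_Rayleigh:
  assumes "\<Omega> \<noteq> {}"
  shows "0 < principal_eigenvalue \<Omega>"
    "\<And>u. u \<in> H01 \<Omega> \<Longrightarrow> principal_eigenvalue \<Omega> * (Mn u)\<^sup>2 \<le> (Gn u)\<^sup>2"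
proof -
  obtain \<psi> where \<psi>: "\<psi> \<in> H01 \<Omega>" "Mn \<psi> = 1" "\<And>u. u \<in> H01 \<Omega> \<Longrightarrow> (Gn \<psi>)\<^sup>2 * (Mn u)\<^sup>2 \<le> (Gn u)\<^sup>2"
    by (rule Rayleigh_minimizer[OF assms]) blast
  let ?\<mu> = "(Gn \<psi>)\<^sup>2"
  have nz: "\<psi> \<notin> zero_H01 \<Omega>" using \<psi>(2) zero_H01_iff[OF \<psi>(1)] by simp
  have "dirichlet_eigenfunction \<Omega> ?\<mu> \<psi>"
    unfolding dirichlet_eigenfunction_def
  proof (intro conjI ballI)
    fix v assume v: "v \<in> H01 \<Omega>"
    define D where "D = (LINT x|lebesgue_on \<Omega>. grad \<Omega> \<psi> x \<bullet> grad \<Omega> v x) - ?\<mu> * (LINT x|lebesgue_on \<Omega>. \<psi> x * v x)"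
    define E where "E = (Gn v)\<^sup>2 - ?\<mu> * (Mn v)\<^sup>2"
    have E: "0 \<le> E" using \<psi>(3)[OF v] by (simp add: E_def)
    have ge: "0 \<le> 2 * t * D + t\<^sup>2 * E" for t
      using \<psi>(3)[OF H01_add_scaled[OF \<psi>(1) v, of t]]
      unfolding Mn_add_scaled[OF \<psi>(1) v] Gn_add_scaled[OF \<psi>(1) v] \<psi>(2) D_def E_def
      by (simp add: algebra_simps)
    have "D = 0"
    proof (rule ccontr)
      assume "D \<noteq> 0"
      \<comment> \<open>A nonzero \<open>D\<close> would make the polynomial negative close to 0;
        the choice \<open>- D / (E + 1)\<close> also works for \<open>E = 0\<close>.\<close>
      have "2 * (- D / (E + 1)) * D + (- D / (E + 1))\<^sup>2 * E = - (D\<^sup>2 * (E + 2) / (E + 1)\<^sup>2)"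
        using E by (simp add: power2_eq_square divide_simps) (simp add: algebra_simps)
      moreover have "0 < D\<^sup>2 * (E + 2) / (E + 1)\<^sup>2" using E \<open>D \<noteq> 0\<close> by simp
      ultimately show False using ge[of "- D / (E + 1)"] by linarith
    qed
    then show "(LINT x|lebesgue_on \<Omega>. grad \<Omega> \<psi> x \<bullet> grad \<Omega> v x) = ?\<mu> * (LINT x|lebesgue_on \<Omega>. \<psi> x * v x)"
      by (simp add: D_def)
  qed (use \<psi>(1) nz in blast)
  moreover have "?\<mu> \<le> \<mu>'" if "dirichlet_eigenfunction \<Omega> \<mu>' u" for \<mu>' u
  proof -
    note u = eigenfunction_Rayleigh[OF that]
    have "?\<mu> * (Mn u)\<^sup>2 \<le> \<mu>' * (Mn u)\<^sup>2" using \<psi>(3)[OF u(1)] u(3) by simp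
    then show ?thesis using nonzero_pos(1)[OF u(1,2)] by simp
  qed
  ultimately have eq: "principal_eigenvalue \<Omega> = ?\<mu>"
    unfolding principal_eigenvalue_def by (intro Least_equality) blast+
  show "0 < principal_eigenvalue \<Omega>" using nonzero_pos(2)[OF \<psi>(1) nz] by (simp add: eq)
  show "principal_eigenvalue \<Omega> * (Mn u)\<^sup>2 \<le> (Gn u)\<^sup>2" if "u \<in> H01 \<Omega>" for u
    using \<psi>(3)[OF that] by (simp add: eq)
qed

end

text \<open>Midpoints take the place of general convex combinations because the parallelogram law
  compares two elements only with their midpoint.\<close>

inductive_set midpoint_hull :: "(nat \<Rightarrow> pt \<Rightarrow> real) \<Rightarrow> nat \<Rightarrow> (pt \<Rightarrow> real) set"
  for v :: "nat \<Rightarrow> pt \<Rightarrow> real" and n :: nat where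
  base: "n \<le> m \<Longrightarrow> v m \<in> midpoint_hull v n"
| mid: "f \<in> midpoint_hull v n \<Longrightarrow> g \<in> midpoint_hull v n \<Longrightarrow> (\<lambda>x. (f x + g x) / 2) \<in> midpoint_hull v n"

lemma midpoint_hull_antimono:
  assumes "n \<le> m"
  shows "midpoint_hull v m \<subseteq> midpoint_hull v n"
proof
  fix f assume "f \<in> midpoint_hull v m"
  then show "f \<in> midpoint_hull v n"
    by induction (use assms in \<open>auto intro: midpoint_hull.intros\<close>)
qed

context bounded_open
begin

lemma H01_mid:
  assumes "f \<in> H01 \<Omega>" "g \<in> H01 \<Omega>"
  shows "(\<lambda>x. (f x + g x) / 2) \<in> H01 \<Omega>" "Gn (\<lambda>x. (f x + g x) / 2) = Gn (\<lambda>x. f x + g x) / 2"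
proof -
  have s: "(\<lambda>x. f x + g x) \<in> H01 \<Omega>" using H01_add_scaled[OF assms, of 1] by simp
  have eq: "(\<lambda>x. (f x + g x) / 2) = (\<lambda>x. (1/2) * (f x + g x))" by auto
  show "(\<lambda>x. (f x + g x) / 2) \<in> H01 \<Omega>" unfolding eq by (rule H01_scale(1)[OF s])
  show "Gn (\<lambda>x. (f x + g x) / 2) = Gn (\<lambda>x. f x + g x) / 2" unfolding eq using H01_scale(2)[OF s, of "1/2"] by simp
qed

lemma Gn_triangle:
  assumes "f \<in> H01 \<Omega>" "g \<in> H01 \<Omega>"
  shows "Gn (\<lambda>x. f x + g x) \<le> Gn f + Gn g"
  using H1_add_scaled(3)[OF assms[THEN H01_H1], of 1] Lnorm_2_triangle[OF assms[THEN H01_L2(2)]] by simp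

text \<open>A Mazur-type argument replaces weak compactness: almost minimal elements of the midpoint hulls of the tails
  are Cauchy in \<open>H\<^sup>1\<close> by the parallelogram law, and stay close to the sequence in \<open>L\<^sup>2\<close>.\<close>

lemma H01_weak_limit:
  assumes v: "\<And>n. v n \<in> H01 \<Omega>" and B: "\<And>n. Gn (v n) \<le> B"
    and CM: "\<And>e. 0 < e \<Longrightarrow> \<exists>N. \<forall>m\<ge>N. \<forall>n\<ge>N. Mn (\<lambda>x. v m x - v n x) < e"
  obtains w where "w \<in> H01 \<Omega>" "Gn w \<le> B" "(\<lambda>n. Mn (\<lambda>x. v n x - w x)) \<longlonglongrightarrow> 0"
proof -
  have hull: "f \<in> H01 \<Omega> \<and> Gn f \<le> B" if "f \<in> midpoint_hull v n" for f n
    using that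
  proof induction
    case (mid f g)
    then show ?case using H01_mid[of f g] Gn_triangle[of f g] by auto
  qed (use v B in auto)
  \<comment> \<open>L2 balls around \<open>v k\<close> are convex, so closeness of the tail to
    \<open>v k\<close> is inherited by its hull.\<close>
  have near: "Mn (\<lambda>x. f x - v k x) \<le> e" if "f \<in> midpoint_hull v n" and k: "\<And>m. n \<le> m \<Longrightarrow> Mn (\<lambda>x. v m x - v k x) \<le> e" for f n k e
    using that(1)
  proof induction
    case (mid f g)
    have L: "L2_on \<Omega> (\<lambda>x. f x - v k x)" "L2_on \<Omega> (\<lambda>x. g x - v k x)"
      using hull[OF mid(1)] hull[OF mid(2)] H01_L2(1)[OF v] by (auto intro: L2_on_diff H01_L2(1))
    have "(\<lambda>x. (f x + g x) / 2 - v k x) = (\<lambda>x. (1/2) *\<^sub>R ((f x - v k x) + (g x - v k x)))"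
      by (auto simp: field_simps)
    then have "Mn (\<lambda>x. (f x + g x) / 2 - v k x) = (1/2) * Mn (\<lambda>x. (f x - v k x) + (g x - v k x))"
      by (simp only: Lnorm_scaleR)
    also have "\<dots> \<le> (1/2) * (Mn (\<lambda>x. f x - v k x) + Mn (\<lambda>x. g x - v k x))"
      by (intro mult_left_mono Lnorm_2_triangle L) simp
    also have "\<dots> \<le> e" using mid by simp
    finally show ?case .
  qed (rule k)
  \<comment> \<open>The hulls shrink as \<open>n\<close> grows, so these infima increase while
    staying below \<open>B\<close>. Their convergence makes almost minimal elements of different
    hulls comparable.\<close>
  define s where "s n = Inf (Gn ` midpoint_hull v n)" for n
  have ne: "Gn ` midpoint_hull v n \<noteq> {}" for n using midpoint_hull.base[of n n v] by blast
  have bdd: "bdd_below (Gn ` midpoint_hull v n)" for n by (rule bdd_belowI[of _ 0]) (auto simp: Lnorm_nonneg)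
  have s_le: "s n \<le> Gn f" if "f \<in> midpoint_hull v n" for f n
    unfolding s_def using bdd that by (intro cInf_lower) auto
  have s0: "0 \<le> s n" for n unfolding s_def by (rule cInf_greatest[OF ne]) (auto simp: Lnorm_nonneg)
  have sB: "s n \<le> B" for n using s_le[OF midpoint_hull.base[of n n v]] B[of n] by simp
  have "incseq s"
    unfolding s_def by (intro incseq_SucI cInf_superset_mono ne bdd image_mono midpoint_hull_antimono) simp
  then obtain S where S: "s \<longlonglongrightarrow> S" using incseq_convergent[of s B] sB by blast
  have "\<exists>f. f \<in> midpoint_hull v n \<and> Gn f < s n + inverse (real (Suc n))" for n
  proof -
    have "Inf (Gn ` midpoint_hull v n) < s n + inverse (real (Suc n))" by (simp add: s_def)
    from cInf_lessD[OF ne this] show ?thesis by blast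
  qed
  then have "\<exists>w. \<forall>n. w n \<in> midpoint_hull v n \<and> Gn (w n) < s n + inverse (real (Suc n))"
    by (intro choice allI)
  then obtain w where w: "\<And>n. w n \<in> midpoint_hull v n" "\<And>n. Gn (w n) < s n + inverse (real (Suc n))" by blast
  have wH: "w n \<in> H01 \<Omega>" "Gn (w n) \<le> B" for n using hull[OF w(1)] by auto
  have wv: "(\<lambda>n. Mn (\<lambda>x. w n x - v n x)) \<longlonglongrightarrow> 0"
  proof (rule LIMSEQ_I)
    fix e :: real assume e: "0 < e"
    obtain N where N: "\<And>m n. m \<ge> N \<Longrightarrow> n \<ge> N \<Longrightarrow> Mn (\<lambda>x. v m x - v n x) < e/2"
      using CM[of "e/2"] e by auto
    have "norm (Mn (\<lambda>x. w n x - v n x) - 0) < e" if "n \<ge> N" for n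
    proof -
      have "Mn (\<lambda>x. w n x - v n x) \<le> e/2"
        by (rule near[OF w(1)]) (use N that in \<open>auto intro!: less_imp_le\<close>)
      then show ?thesis using e by (simp add: Lnorm_nonneg)
    qed
    then show "\<exists>N. \<forall>n\<ge>N. norm (Mn (\<lambda>x. w n x - v n x) - 0) < e" by blast
  qed
  have CMw: "\<exists>N. \<forall>m\<ge>N. \<forall>n\<ge>N. Mn (\<lambda>x. w m x - w n x) < e" if e: "0 < e" for e
  proof -
    obtain N1 where N1: "\<And>m n. m \<ge> N1 \<Longrightarrow> n \<ge> N1 \<Longrightarrow> Mn (\<lambda>x. v m x - v n x) < e/3"
      using CM[of "e/3"] e by auto
    obtain N2 where N2: "\<And>n. n \<ge> N2 \<Longrightarrow> Mn (\<lambda>x. w n x - v n x) < e/3"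
      using order_tendstoD(2)[OF wv, of "e/3"] e by (auto simp: eventually_sequentially)
    have "Mn (\<lambda>x. w m x - w n x) < e" if "m \<ge> max N1 N2" "n \<ge> max N1 N2" for m n
      using N1[of m n] N2[of m] N2[of n] that
        Lnorm_2_triangle_diff[OF H01_L2(1)[OF wH(1)[of m]] H01_L2(1)[OF v[of m]] H01_L2(1)[OF wH(1)[of n]]]
        Lnorm_2_triangle_diff[OF H01_L2(1)[OF v[of m]] H01_L2(1)[OF v[of n]] H01_L2(1)[OF wH(1)[of n]]]
        Lnorm_2_minus[of \<Omega> "v n" "w n"] by simp
    then show ?thesis by blast
  qed
  have CGw: "\<exists>N. \<forall>m\<ge>N. \<forall>n\<ge>N. Lnorm 2 \<Omega> (\<lambda>x. grad \<Omega> (w m) x - grad \<Omega> (w n) x) < e" if e: "0 < e" for e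
  proof -
    define q where "q n = s n + inverse (real (Suc n))" for n
    have q: "(\<lambda>n. q n) \<longlonglongrightarrow> S + 0"
      unfolding q_def by (intro tendsto_add S LIMSEQ_inverse_real_of_nat)
    have lims: "(\<lambda>n. 2 * (q n)\<^sup>2) \<longlonglongrightarrow> 2 * (S + 0)\<^sup>2" "(\<lambda>n. 2 * (s n)\<^sup>2) \<longlonglongrightarrow> 2 * S\<^sup>2"
      by (intro tendsto_intros q S)+
    have ev: "\<forall>\<^sub>F n in sequentially. \<bar>2 * (q n)\<^sup>2 - 2 * S\<^sup>2\<bar> < e\<^sup>2 / 4 \<and> \<bar>2 * (s n)\<^sup>2 - 2 * S\<^sup>2\<bar> < e\<^sup>2 / 4"
      using tendstoD[OF lims(1), of "e\<^sup>2 / 4"] tendstoD[OF lims(2), of "e\<^sup>2 / 4"] e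
      by (intro eventually_conj) (simp_all add: dist_real_def)
    then obtain N where N: "\<And>n. n \<ge> N \<Longrightarrow> \<bar>2 * (q n)\<^sup>2 - 2 * S\<^sup>2\<bar> < e\<^sup>2 / 4" "\<And>n. n \<ge> N \<Longrightarrow> \<bar>2 * (s n)\<^sup>2 - 2 * S\<^sup>2\<bar> < e\<^sup>2 / 4"
      by (auto simp: eventually_sequentially)
    have less: "Gn (\<lambda>x. w m x - w n x) < e" if mn: "n \<ge> N" "m \<ge> n" for m n
    proof -
      \<comment> \<open>For \<open>n \<le> m\<close> both elements lie in the larger hull, so their
        midpoint has gradient norm at least \<open>s n\<close>. The parallelogram law then bounds
        the squared distance by
        \<open>2 * (q m)\<^sup>2 + 2 * (q n)\<^sup>2 - 4 * (s n)\<^sup>2\<close>, which tends to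
        0.\<close>
      have "w m \<in> midpoint_hull v n" using w(1)[of m] midpoint_hull_antimono[OF mn(2)] by blast
      then have "s n \<le> Gn (\<lambda>x. (w m x + w n x) / 2)" by (intro s_le midpoint_hull.mid w(1))
      then have "2 * s n \<le> Gn (\<lambda>x. w m x + w n x)" using H01_mid(2)[OF wH(1) wH(1)] by simp
      then have "(2 * s n)\<^sup>2 \<le> (Gn (\<lambda>x. w m x + w n x))\<^sup>2" using s0[of n] by (intro power_mono) auto
      moreover have "(Gn (w m))\<^sup>2 \<le> (q m)\<^sup>2" "(Gn (w n))\<^sup>2 \<le> (q n)\<^sup>2"
        using w(2) by (intro power_mono Lnorm_nonneg; simp add: q_def less_imp_le)+
      moreover have "2 * (q m)\<^sup>2 < 2 * S\<^sup>2 + e\<^sup>2 / 4" "2 * (q n)\<^sup>2 < 2 * S\<^sup>2 + e\<^sup>2 / 4"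
        "2 * S\<^sup>2 - e\<^sup>2 / 4 < 2 * (s n)\<^sup>2"
        using N(1)[OF order_trans[OF mn]] N(1)[OF mn(1)] N(2)[OF mn(1)] by linarith+
      moreover have "(2 * s n)\<^sup>2 = 4 * (s n)\<^sup>2" by (simp add: power_mult_distrib)
      ultimately have "(Gn (\<lambda>x. w m x - w n x))\<^sup>2 < e\<^sup>2"
        using Gn_parallelogram[OF wH(1)[of m] wH(1)[of n]] by linarith
      then show ?thesis by (rule power2_less_imp_less) (use e in simp)
    qed
    have "Lnorm 2 \<Omega> (\<lambda>x. grad \<Omega> (w m) x - grad \<Omega> (w n) x) < e" if "m \<ge> N" "n \<ge> N" for m n
    proof (cases "n \<le> m")
      case True
      then show ?thesis using less[of n m] that by (simp add: Gn_diff[OF wH(1) wH(1)])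
    next
      case False
      then show ?thesis using less[of m n] that Lnorm_2_minus[of \<Omega> "grad \<Omega> (w m)" "grad \<Omega> (w n)"]
        by (simp add: Gn_diff[OF wH(1) wH(1)])
    qed
    then show ?thesis by blast
  qed
  obtain z where z: "z \<in> H01 \<Omega>" "(\<lambda>n. Mn (\<lambda>x. w n x - z x)) \<longlonglongrightarrow> 0"
    "(\<lambda>n. Lnorm 2 \<Omega> (\<lambda>x. grad \<Omega> (w n) x - grad \<Omega> z x)) \<longlonglongrightarrow> 0"
    by (rule H01_complete[OF wH(1) CMw CGw])
  have "(\<lambda>n. Gn (w n)) \<longlonglongrightarrow> Gn z"
    by (rule LIMSEQ_Lnorm_2[OF H01_L2(2)[OF wH(1)] H01_L2(2)[OF z(1)] z(3)])
  then have Gz: "Gn z \<le> B" by (rule LIMSEQ_le_const2) (use wH(2) in blast)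
  have "(\<lambda>n. Mn (\<lambda>x. v n x - z x)) \<longlonglongrightarrow> 0"
  proof (rule Lim_null_comparison)
    show "(\<lambda>n. Mn (\<lambda>x. w n x - v n x) + Mn (\<lambda>x. w n x - z x)) \<longlonglongrightarrow> 0"
      using tendsto_add[OF wv z(2)] by simp
    have "norm (Mn (\<lambda>x. v n x - z x)) \<le> Mn (\<lambda>x. w n x - v n x) + Mn (\<lambda>x. w n x - z x)" for n
      using Lnorm_2_triangle_diff[OF H01_L2(1)[OF v[of n]] H01_L2(1)[OF wH(1)[of n]] H01_L2(1)[OF z(1)]]
        Lnorm_2_minus[of \<Omega> "v n" "w n"] by (simp add: Lnorm_nonneg)
    then show "\<forall>\<^sub>F n in sequentially. norm (Mn (\<lambda>x. v n x - z x)) \<le> Mn (\<lambda>x. w n x - v n x) + Mn (\<lambda>x. w n x - z x)" by simp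
  qed
  then show thesis by (rule that[OF z(1) Gz])
qed

section \<open>Continuity of the L4 norm and intermediate exponents\<close>

lemma abs_pow4_diff_le: "\<bar>x ^ 4 - y ^ 4\<bar> \<le> 4 * (\<bar>x - y\<bar> * (\<bar>x\<bar> ^ 3 + \<bar>y\<bar> ^ 3))" for x y :: real
proof -
  let ?a = "\<bar>x\<bar>" and ?b = "\<bar>y\<bar>"
  \<comment> \<open>Nonnegativity of \<open>(a + b) * (a - b)\<^sup>2\<close> says that the mixed
    terms are dominated by the pure cubes.\<close>
  have cubes: "(a + b) * (a\<^sup>2 + b\<^sup>2) \<le> 4 * (a ^ 3 + b ^ 3)" if "0 \<le> a" "0 \<le> b" for a b :: real
  proof -
    have "0 \<le> (a + b) * (a - b)\<^sup>2" using that by simp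
    also have "\<dots> = 2 * (a ^ 3 + b ^ 3) - (a + b) * (a\<^sup>2 + b\<^sup>2)"
      by (simp add: eval_nat_numeral algebra_simps)
    finally have "(a + b) * (a\<^sup>2 + b\<^sup>2) \<le> 2 * (a ^ 3 + b ^ 3)" by (simp only: diff_ge_0_iff_ge)
    also have "\<dots> \<le> 4 * (a ^ 3 + b ^ 3)" using that by (intro mult_right_mono) simp_all
    finally show ?thesis .
  qed
  have "x ^ 4 - y ^ 4 = (x - y) * ((x + y) * (x\<^sup>2 + y\<^sup>2))" by (simp add: eval_nat_numeral algebra_simps)
  then have "\<bar>x ^ 4 - y ^ 4\<bar> = \<bar>x - y\<bar> * (\<bar>x + y\<bar> * (x\<^sup>2 + y\<^sup>2))" by (simp add: abs_mult)
  also have "\<dots> \<le> \<bar>x - y\<bar> * ((?a + ?b) * (?a\<^sup>2 + ?b\<^sup>2))"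
    by (intro mult_left_mono mult_mono) auto
  also have "\<dots> \<le> \<bar>x - y\<bar> * (4 * (?a ^ 3 + ?b ^ 3))"
    by (intro mult_left_mono cubes) simp_all
  finally show ?thesis by (simp only: mult.left_commute)
qed

text \<open>The pointwise bound is integrated by Cauchy-Schwarz against the cubes; 256 is 4 * 64. As
  the L2 distance enters linearly, L2 convergence with bounded gradients implies convergence of the
  L4 norms.\<close>

lemma L4_diff_le:
  assumes u: "u \<in> H01 \<Omega>" and v: "v \<in> H01 \<Omega>"
  shows "\<bar>(Lnorm 4 \<Omega> u) ^ 4 - (Lnorm 4 \<Omega> v) ^ 4\<bar> \<le> 256 * Mn (\<lambda>x. u x - v x) * ((Gn u) ^ 3 + (Gn v) ^ 3)"
proof -
  let ?M = "lebesgue_on \<Omega>"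
  have d: "L2_on \<Omega> (\<lambda>x. u x - v x)" by (intro L2_on_diff H01_L2 u v)
  have d': "L2_on \<Omega> (\<lambda>x. \<bar>u x - v x\<bar>)" using d by (auto simp: L2_on_def)
  note cu = H01_cube[OF u] and cv = H01_cube[OF v]
  have i: "integrable ?M (\<lambda>x. (u x) ^ 4)" "integrable ?M (\<lambda>x. (v x) ^ 4)"
    using L4_bound(1)[OF u] L4_bound(1)[OF v] by (simp_all add: power_even_abs)
  have j: "integrable ?M (\<lambda>x. \<bar>u x - v x\<bar> \<bullet> (\<bar>u x\<bar> ^ 3 + \<bar>v x\<bar> ^ 3))"
    by (rule L2_on_integrable_inner[OF d' L2_on_add[OF cu(1) cv(1)]])
  have "(Lnorm 4 \<Omega> u) ^ 4 - (Lnorm 4 \<Omega> v) ^ 4 = (LINT x|?M. (u x) ^ 4 - (v x) ^ 4)"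
    using i by (simp add: Lnorm_4_pow power_even_abs)
  then have "\<bar>(Lnorm 4 \<Omega> u) ^ 4 - (Lnorm 4 \<Omega> v) ^ 4\<bar> \<le> (LINT x|?M. \<bar>(u x) ^ 4 - (v x) ^ 4\<bar>)"
    by (simp only: integral_abs_bound)
  also have "\<dots> \<le> (LINT x|?M. 4 * (\<bar>u x - v x\<bar> \<bullet> (\<bar>u x\<bar> ^ 3 + \<bar>v x\<bar> ^ 3)))"
    by (intro integral_mono integrable_abs Bochner_Integration.integrable_diff integrable_mult_right i j)
      (simp add: abs_pow4_diff_le)
  also have "\<dots> = 4 * (LINT x|?M. \<bar>u x - v x\<bar> \<bullet> (\<bar>u x\<bar> ^ 3 + \<bar>v x\<bar> ^ 3))" by simp
  also have "\<dots> \<le> 4 * (Mn (\<lambda>x. \<bar>u x - v x\<bar>) * Mn (\<lambda>x. \<bar>u x\<bar> ^ 3 + \<bar>v x\<bar> ^ 3))"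
    using L2_on_Cauchy_Schwarz[OF d' L2_on_add[OF cu(1) cv(1)]] by linarith
  also have "Mn (\<lambda>x. \<bar>u x - v x\<bar>) = Mn (\<lambda>x. u x - v x)" by (simp add: Lnorm_2)
  also have "4 * (Mn (\<lambda>x. u x - v x) * Mn (\<lambda>x. \<bar>u x\<bar> ^ 3 + \<bar>v x\<bar> ^ 3)) \<le> 4 * (Mn (\<lambda>x. u x - v x) * (64 * (Gn u) ^ 3 + 64 * (Gn v) ^ 3))"
    using Lnorm_2_triangle[OF cu(1) cv(1)] cu(2) cv(2) by (intro mult_left_mono Lnorm_nonneg) auto
  finally show ?thesis by (simp add: algebra_simps)
qed

text \<open>The pointwise bound |x|^q \<le> |x|^4 + |x|^6 gives an estimate that is not homogeneous
  in the gradient norm. Applied to \<open>u\<close> divided by \<open>Gn u\<close> and scaled back,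
  it becomes homogeneous; \<open>P\<close> is the Poincare constant.\<close>

lemma Sobolev_between:
  assumes q: "4 \<le> q" "q \<le> 6"
  obtains C where "0 < C" "\<And>u. u \<in> H01 \<Omega> \<Longrightarrow> integrable (lebesgue_on \<Omega>) (\<lambda>x. \<bar>u x\<bar> powr q)"
    "\<And>u. u \<in> H01 \<Omega> \<Longrightarrow> Lnorm q \<Omega> u powr q \<le> C * Gn u powr q"
proof -
  let ?M = "lebesgue_on \<Omega>"
  obtain P where P: "0 < P" "\<And>u. u \<in> H01 \<Omega> \<Longrightarrow> Mn u \<le> P * Gn u" using Poincare by blast
  have pw: "\<bar>x\<bar> powr q \<le> \<bar>x\<bar> ^ 4 + \<bar>x\<bar> ^ 6" for x :: real
  proof (cases "x = 0")
    case False
    have 46: "\<bar>x\<bar> powr 4 = \<bar>x\<bar> ^ 4" "\<bar>x\<bar> powr 6 = \<bar>x\<bar> ^ 6" using False by simp_all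
    show ?thesis
    proof (cases "\<bar>x\<bar> \<le> 1")
      case True
      then have "\<bar>x\<bar> powr q \<le> \<bar>x\<bar> powr 4" using False q by (intro powr_mono') auto
      then show ?thesis unfolding 46 using zero_le_power[of "\<bar>x\<bar>" 6] by linarith
    next
      case False
      then have "\<bar>x\<bar> powr q \<le> \<bar>x\<bar> powr 6" using q by (intro powr_mono) auto
      then show ?thesis unfolding 46 using zero_le_power[of "\<bar>x\<bar>" 4] by linarith
    qed
  qed (use q in simp)
  have int: "integrable ?M (\<lambda>x. \<bar>u x\<bar> powr q)" and bd: "Lnorm q \<Omega> u powr q \<le> 64 * Mn u * (Gn u) ^ 3 + 4096 * (Gn u) ^ 6"
    if u: "u \<in> H01 \<Omega>" for u
  proof -
    have [measurable]: "u \<in> borel_measurable ?M" using H01_L2(1)[OF u] by (rule L2_onD)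
    have i: "integrable ?M (\<lambda>x. \<bar>u x\<bar> ^ 4 + \<bar>u x\<bar> ^ 6)"
      by (intro Bochner_Integration.integrable_add L4_bound Sobolev_6 u)
    show int: "integrable ?M (\<lambda>x. \<bar>u x\<bar> powr q)"
      by (rule Bochner_Integration.integrable_bound[OF i]) (use pw in auto)
    have "Lnorm q \<Omega> u powr q = (LINT x|?M. \<bar>u x\<bar> powr q)" using q Lnorm_powr[of q \<Omega> u] by simp
    also have "\<dots> \<le> (LINT x|?M. \<bar>u x\<bar> ^ 4 + \<bar>u x\<bar> ^ 6)" by (intro integral_mono int i pw)
    also have "\<dots> = (Lnorm 4 \<Omega> u) ^ 4 + (LINT x|?M. \<bar>u x\<bar> ^ 6)"
      using L4_bound(1)[OF u] Sobolev_6(1)[OF u] by (simp add: Lnorm_4_pow)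
    finally show "Lnorm q \<Omega> u powr q \<le> 64 * Mn u * (Gn u) ^ 3 + 4096 * (Gn u) ^ 6"
      using L4_bound(2)[OF u] Sobolev_6(2)[OF u] by linarith
  qed
  have "Lnorm q \<Omega> u powr q \<le> (64 * P + 4096) * Gn u powr q" if u: "u \<in> H01 \<Omega>" for u
  proof (cases "u \<in> zero_H01 \<Omega>")
    case True
    then have "AE x in ?M. u x = 0" by (simp add: zero_H01_def)
    then have "Lnorm q \<Omega> u = Lnorm q \<Omega> (\<lambda>x. 0::real)"
      using L2_onD(1)[OF H01_L2(1)[OF u]] by (intro Lnorm_cong_AE) auto
    then show ?thesis using q P by (simp add: Lnorm_def)
  next
    case False
    define g where "g = Gn u"
    have g: "0 < g" unfolding g_def by (rule nonzero_pos[OF u False])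
    let ?w = "\<lambda>x. (1 / g) * u x"
    have w: "?w \<in> H01 \<Omega>" "Gn ?w = 1" "Lnorm q \<Omega> ?w = Lnorm q \<Omega> u / g"
      using H01_scale[OF u, of "1 / g"] Lnorm_scale[of q "1 / g" u] g q by (auto simp flip: g_def)
    have "(Lnorm q \<Omega> u / g) powr q \<le> 64 * P + 4096"
      using bd[OF w(1)] P(2)[OF w(1)] unfolding w(2,3) by simp
    moreover have "(Lnorm q \<Omega> u / g) powr q = Lnorm q \<Omega> u powr q / g powr q"
      using g by (simp add: powr_divide Lnorm_nonneg)
    ultimately show ?thesis using g unfolding g_def[symmetric] by (simp add: pos_divide_le_eq)
  qed
  then show thesis using int P(1) by (intro that[of "64 * P + 4096"]) auto
qed

end

subsection \<open>Fibering maps\<close>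

text \<open>The derivative is written as \<open>i t / t\<close> because \<open>i\<close> will be
  \<open>I_fun\<close> along the ray; its sign change at \<open>s\<close> gives monotonicity of
  \<open>j\<close> on either side.\<close>

lemma fibering_sup:
  fixes j i :: "real \<Rightarrow> real"
  assumes "0 < s" and der: "\<And>t. 0 < t \<Longrightarrow> (j has_real_derivative i t / t) (at t)"
    and pos: "\<And>t. 0 < t \<Longrightarrow> t < s \<Longrightarrow> 0 < i t" and neg: "\<And>t. s < t \<Longrightarrow> i t < 0"
    and t: "0 < t"
  shows "j t \<le> j s"
proof -
  have cont: "continuous_on {x..y} j" if "0 < x" for x y
    using der that by (intro DERIV_continuous_on[where D="\<lambda>t. i t / t"]) (auto intro: has_field_derivative_at_within)
  show ?thesis
  proof (cases "t \<le> s")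
    case True
    have "\<exists>y. (j has_real_derivative y) (at x) \<and> 0 \<le> y" if "t < x" "x < s" for x
      using der[of x] pos[of x] that t by (intro exI[of _ "i x / x"]) auto
    then show ?thesis using DERIV_nonneg_imp_increasing_open[OF True] cont[OF t] by blast
  next
    case False
    then have st: "s \<le> t" by simp
    have "\<exists>y. (j has_real_derivative y) (at x) \<and> y \<le> 0" if "s < x" "x < t" for x
      using der[of x] neg[of x] that \<open>0 < s\<close> by (intro exI[of _ "i x / x"]) (auto simp: divide_nonpos_pos)
    then show ?thesis
      using DERIV_nonpos_imp_decreasing_open[OF st] cont[OF \<open>0 < s\<close>] by blast
  qed
qed

lemma fibering_derivative:
  fixes A B D p t :: real
  assumes "0 < t" "0 < p"
  shows "((\<lambda>t. A / 4 * t ^ 4 + B / 2 * t\<^sup>2 - D / (p + 1) * t powr (p + 1)) has_real_derivative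
    (A * t ^ 4 + B * t\<^sup>2 - D * t powr (p + 1)) / t) (at t)"
proof -
  have "t powr (p + 1) = t powr p * t" using assms by (simp add: powr_add)
  then have eq: "(A * t ^ 4 + B * t\<^sup>2 - D * t powr (p + 1)) / t = A * t ^ 3 + B * t - D * t powr p"
    using assms by (simp add: field_simps eval_nat_numeral)
  have d: "((\<lambda>t. t powr (p + 1)) has_real_derivative (p + 1) * t powr p) (at t)"
    using has_real_derivative_powr[of t "p + 1"] assms by simp
  show ?thesis unfolding eq
    by (rule DERIV_cong[OF DERIV_diff[OF DERIV_add[OF DERIV_cmult[OF DERIV_pow] DERIV_cmult[OF DERIV_pow]] DERIV_cmult[OF d]]])
      (use assms in simp)
qed

lemma powr_unbounded:
  fixes K T r :: real
  assumes "0 < r"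
  obtains t where "T < t" "1 \<le> t" "K < t powr r"
proof -
  define t where "t = max (T + 1) (max 1 ((\<bar>K\<bar> + 1) powr (1 / r)))"
  have "((\<bar>K\<bar> + 1) powr (1 / r)) powr r \<le> t powr r"
    using assms by (intro powr_mono2) (auto simp: t_def)
  then have "\<bar>K\<bar> + 1 \<le> t powr r" using assms by (simp add: powr_powr)
  then have "K < t powr r" by linarith
  then show thesis by (intro that[of t]) (auto simp: t_def)
qed

text \<open>The function is strictly decreasing because its power term is; two explicit points with
  opposite signs locate the root.\<close>

lemma fibering_root:
  fixes A B D r :: real
  assumes "0 < A" "0 \<le> B" "0 < D" "0 < r"
  obtains s where "0 < s" "\<And>t. 0 < t \<Longrightarrow> t < s \<Longrightarrow> 0 < A + B / t\<^sup>2 - D * t powr r"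
    "A + B / s\<^sup>2 - D * s powr r = 0" "\<And>t. s < t \<Longrightarrow> A + B / t\<^sup>2 - D * t powr r < 0"
proof -
  define h where "h t = A + B / t\<^sup>2 - D * t powr r" for t
  have mono: "h y < h x" if "0 < x" "x < y" for x y
  proof -
    have "x powr r < y powr r" using that assms(4) by (intro powr_less_mono2) auto
    then have "D * x powr r < D * y powr r" using assms(3) by simp
    moreover have "B / y\<^sup>2 \<le> B / x\<^sup>2"
      using that assms(2) by (intro divide_left_mono power_mono mult_pos_pos) auto
    ultimately show ?thesis by (simp add: h_def)
  qed
  \<comment> \<open>Chosen so that the subtracted term equals \<open>A / 2\<close> at
    \<open>x\<close>, which leaves a value of at least \<open>A / 2\<close>.\<close>
  define x where "x = (A / (2 * D)) powr (1 / r)"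
  have x: "0 < x" using assms by (simp add: x_def)
  have "D * x powr r = A / 2" using assms by (simp add: x_def powr_powr)
  moreover have "0 \<le> B / x\<^sup>2" using assms(2) by simp
  ultimately have hx: "0 < h x" unfolding h_def using assms(1) by linarith
  \<comment> \<open>With \<open>1 \<le> y\<close> the middle term is at most \<open>B\<close>, so a
    subtracted term above \<open>A + B\<close> makes the value negative.\<close>
  obtain y where y: "x < y" "1 \<le> y" "(A + B) / D < y powr r"
    by (rule powr_unbounded[OF assms(4)])
  have "B / y\<^sup>2 \<le> B" using y assms(2) by (simp add: divide_le_eq mult_le_cancel_left1 one_le_power)
  moreover have "A + B < D * y powr r" using y(3) assms(3) by (simp add: pos_divide_less_eq mult.commute)
  ultimately have hy: "h y < 0" by (simp add: h_def)
  have "continuous_on {x..y} h"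
    unfolding h_def using x by (intro continuous_intros) auto
  then obtain s where s: "x \<le> s" "s \<le> y" "h s = 0"
    using IVT2'[of h y 0 x] hx hy y(1) by auto
  have s0: "0 < s" using x s by simp
  have "0 < h t" if "0 < t" "t < s" for t using mono[OF that] s(3) by simp
  moreover have "h t < 0" if "s < t" for t using mono[OF s0 that] s(3) by simp
  ultimately show thesis using that[OF s0] s(3) unfolding h_def by blast
qed

section \<open>Rays and the fibering maximum on a nonempty domain\<close>

locale bounded_domain = bounded_open +
  assumes nonempty: "\<Omega> \<noteq> {}"
begin

abbreviation lam1 :: real where "lam1 \<equiv> principal_eigenvalue \<Omega>"

lemmas lam1_pos = principal_eigenvalue_Rayleigh(1)[OF nonempty]
lemmas lam1_le = principal_eigenvalue_Rayleigh(2)[OF nonempty]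

lemma rescale_H01:
  assumes "u \<in> H01 \<Omega>"
  shows "rescale t u \<in> H01 \<Omega>" "Gn (rescale t u) = \<bar>t\<bar> * Gn u"
  using H01_scale[OF assms] by (simp_all add: rescale_def)

lemma rescale_Lnorm: "0 < q \<Longrightarrow> Lnorm q \<Omega> (rescale t u) = \<bar>t\<bar> * Lnorm q \<Omega> u"
  unfolding rescale_def by (rule Lnorm_scale)

lemma rescale_zero_iff:
  assumes "u \<in> H01 \<Omega>" "0 < t"
  shows "rescale t u \<in> zero_H01 \<Omega> \<longleftrightarrow> u \<in> zero_H01 \<Omega>"
  using assms rescale_H01[OF assms(1)] by (simp add: zero_H01_iff rescale_Lnorm)

lemma ray:
  assumes "u \<in> H01 \<Omega>" "0 < t" "0 < p"
  shows "I_fun \<Omega> a b l p (rescale t u) = a * (Gn u) ^ 4 * t ^ 4 + (b * (Gn u)\<^sup>2 - l * (Mn u)\<^sup>2) * t\<^sup>2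
      - Lnorm (p + 1) \<Omega> u powr (p + 1) * t powr (p + 1)"
    "J_fun \<Omega> a b l p (rescale t u) = a * (Gn u) ^ 4 / 4 * t ^ 4 + (b * (Gn u)\<^sup>2 - l * (Mn u)\<^sup>2) / 2 * t\<^sup>2
      - Lnorm (p + 1) \<Omega> u powr (p + 1) / (p + 1) * t powr (p + 1)"
  using assms rescale_H01[OF assms(1), of t]
  by (simp_all add: rescale_Lnorm I_fun_def J_fun_def power_mult_distrib powr_mult Lnorm_nonneg algebra_simps diff_divide_distrib)

lemma fibering_maxI:
  assumes u: "u \<in> H01 \<Omega>" "u \<notin> zero_H01 \<Omega>" and p: "0 < p" and s: "0 < s"
    and zero: "I_fun \<Omega> a b l p (rescale s u) = 0"
    and pos: "\<And>t. 0 < t \<Longrightarrow> t < s \<Longrightarrow> 0 < I_fun \<Omega> a b l p (rescale t u)"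
    and neg: "\<And>t. s < t \<Longrightarrow> I_fun \<Omega> a b l p (rescale t u) < 0"
  shows "fibering_max \<Omega> a b l p u s"
proof -
  let ?j = "\<lambda>t. a * (Gn u) ^ 4 / 4 * t ^ 4 + (b * (Gn u)\<^sup>2 - l * (Mn u)\<^sup>2) / 2 * t\<^sup>2
      - Lnorm (p + 1) \<Omega> u powr (p + 1) / (p + 1) * t powr (p + 1)"
  let ?i = "\<lambda>t. a * (Gn u) ^ 4 * t ^ 4 + (b * (Gn u)\<^sup>2 - l * (Mn u)\<^sup>2) * t\<^sup>2
      - Lnorm (p + 1) \<Omega> u powr (p + 1) * t powr (p + 1)"
  have max: "J_fun \<Omega> a b l p (rescale t u) \<le> J_fun \<Omega> a b l p (rescale s u)" if t: "0 < t" for t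
  proof -
    have "?j t \<le> ?j s"
    proof (rule fibering_sup[OF s, where j="?j" and i="?i"])
      show "0 < ?i t" if "0 < t" "t < s" for t using pos[OF that] ray(1)[OF u(1) that(1) p] by simp
      show "?i t < 0" if "s < t" for t using neg[OF that] ray(1)[OF u(1) _ p, of t] s that by simp
    qed (use fibering_derivative p t in auto)
    then show ?thesis using ray(2)[OF u(1) _ p] t s by simp
  qed
  have "rescale s u \<in> N_set \<Omega> a b l p"
    using rescale_H01(1)[OF u(1)] rescale_zero_iff[OF u(1) s] u(2) zero by (simp add: N_set_def)
  moreover have "bdd_above ((\<lambda>t. J_fun \<Omega> a b l p (rescale t u)) ` {0<..})"
    using max by (intro bdd_aboveI2) auto
  moreover have "J_fun \<Omega> a b l p (rescale s u) = (SUP t\<in>{0<..}. J_fun \<Omega> a b l p (rescale t u))"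
    using max s by (intro cSup_eq_maximum[symmetric]) auto
  moreover have "rescale t u \<in> N_plus \<Omega> a b l p" if "0 < t" "t < s" for t
    using pos[OF that] rescale_H01(1)[OF u(1)] by (simp add: N_plus_def)
  moreover have "rescale t u \<in> N_minus \<Omega> a b l p" if "s < t" for t
    using neg[OF that] rescale_H01(1)[OF u(1)] by (simp add: N_minus_def)
  ultimately show ?thesis using s by (simp add: fibering_max_def)
qed

text \<open>If \<open>s < s'\<close>, then \<open>rescale s u\<close> lies in \<open>N_set\<close>
  by the property of \<open>s\<close> and in \<open>N_plus\<close> by that of \<open>s'\<close>, and
  these sets are disjoint.\<close>

lemma fibering_max_unique:
  assumes "fibering_max \<Omega> a b l p u s" "fibering_max \<Omega> a b l p u s'"
  shows "s = s'"
proof -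
  have "\<not> s < s'" if "fibering_max \<Omega> a b l p u s" "fibering_max \<Omega> a b l p u s'" for s s'
  proof
    assume "s < s'"
    then have "rescale s u \<in> N_plus \<Omega> a b l p" "rescale s u \<in> N_set \<Omega> a b l p"
      using that by (auto simp: fibering_max_def)
    then show False by (auto simp: N_plus_def N_set_def)
  qed
  then show ?thesis using assms by (meson linorder_neqE)
qed

text \<open>The zero function, written as \<open>rescale 0 u\<close>, belongs to
  \<open>N_plus\<close> by definition and has \<open>J_fun\<close> value 0, below the positive
  level.\<close>

lemma W_plus_nonempty:
  assumes "0 < d_const \<Omega> a b l p" "0 < p"
  shows "W_plus \<Omega> a b l p \<noteq> {}"
proof -
  obtain u where u: "u \<in> H01 \<Omega>" using exists_nonzero[OF nonempty] by metis
  note z = rescale_H01[OF u, of 0]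
  have "J_fun \<Omega> a b l p (rescale 0 u) = 0" using z assms(2) by (simp add: J_fun_def rescale_Lnorm)
  moreover have "rescale 0 u \<in> zero_H01 \<Omega>" using z zero_H01_iff by (simp add: rescale_Lnorm)
  ultimately have "rescale 0 u \<in> W_plus \<Omega> a b l p"
    using z(1) assms by (simp add: W_plus_def J_sublevel_def N_plus_def)
  then show ?thesis by blast
qed

lemma W_minus_nonempty:
  assumes "0 < d_const \<Omega> a b l p" "u \<in> H01 \<Omega>" "I_fun \<Omega> a b l p u < 0" "J_fun \<Omega> a b l p u \<le> 0"
  shows "W_minus \<Omega> a b l p \<noteq> {}"
  using assms by (auto simp: W_minus_def J_sublevel_def N_minus_def)

text \<open>Integrability of the power has to be supplied from the Sobolev inequality: a
  non-integrable power would have integral 0 by convention.\<close>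

lemma Lnorm_pos:
  assumes "u \<in> H01 \<Omega>" "u \<notin> zero_H01 \<Omega>" "4 \<le> q" "q \<le> 6"
  shows "0 < Lnorm q \<Omega> u"
proof -
  have int: "integrable (lebesgue_on \<Omega>) (\<lambda>x. \<bar>u x\<bar> powr q)"
    using Sobolev_between[OF assms(3,4)] assms(1) by metis
  have "Lnorm q \<Omega> u \<noteq> 0"
  proof
    assume "Lnorm q \<Omega> u = 0"
    then have "(LINT x|lebesgue_on \<Omega>. \<bar>u x\<bar> powr q) = 0"
      using Lnorm_powr[of q \<Omega> u] assms(3) by simp
    then have "AE x in lebesgue_on \<Omega>. \<bar>u x\<bar> powr q = 0"
      by (subst (asm) integral_nonneg_eq_0_iff_AE[OF int]) auto
    then have "AE x in lebesgue_on \<Omega>. u x = 0" by eventually_elim simp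
    then show False using assms by (simp add: zero_H01_def)
  qed
  then show ?thesis using Lnorm_nonneg[of q \<Omega> u] by linarith
qed

lemma I_fun_3: "I_fun \<Omega> a b l 3 u = (b * (Gn u)\<^sup>2 - l * (Mn u)\<^sup>2) - ((Lnorm 4 \<Omega> u) ^ 4 - a * (Gn u) ^ 4)"
  by (simp add: I_fun_def Lnorm_nonneg)

lemma J_fun_3: "J_fun \<Omega> a b l 3 u = (b * (Gn u)\<^sup>2 - l * (Mn u)\<^sup>2) / 2 - ((Lnorm 4 \<Omega> u) ^ 4 - a * (Gn u) ^ 4) / 4"
  by (simp add: J_fun_def Lnorm_nonneg diff_divide_distrib)

text \<open>The sign hypothesis covers both cases in use: \<open>B\<close> and \<open>D\<close> both
  positive for elements of S, both negative on \<open>L_minus\<close>. The factored forms leave the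
  sign of \<open>I_fun\<close> to \<open>D\<close> and to the comparison of \<open>t\<close> with
  \<open>sigma_coeff\<close>.\<close>

lemma ray_3:
  assumes u: "u \<in> H01 \<Omega>"
    and D: "D = (Lnorm 4 \<Omega> u) ^ 4 - a * (Gn u) ^ 4" and B: "B = b * (Gn u)\<^sup>2 - l * (Mn u)\<^sup>2"
    and sign: "0 < B / D"
  shows "0 < sigma_coeff \<Omega> a b l u" "B = D * (sigma_coeff \<Omega> a b l u)\<^sup>2"
    "0 \<le> t \<Longrightarrow> I_fun \<Omega> a b l 3 (rescale t u) = t\<^sup>2 * D * ((sigma_coeff \<Omega> a b l u)\<^sup>2 - t\<^sup>2)"
    "0 \<le> t \<Longrightarrow> J_fun \<Omega> a b l 3 (rescale t u) = t\<^sup>2 * D * ((sigma_coeff \<Omega> a b l u)\<^sup>2 / 2 - t\<^sup>2 / 4)"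
proof -
  have s: "sigma_coeff \<Omega> a b l u = sqrt (B / D)" by (simp add: sigma_coeff_def B D)
  show "0 < sigma_coeff \<Omega> a b l u" using sign by (simp add: s)
  have s2: "(sigma_coeff \<Omega> a b l u)\<^sup>2 = B / D" using sign by (simp add: s)
  have "D \<noteq> 0" using sign by auto
  then show BD: "B = D * (sigma_coeff \<Omega> a b l u)\<^sup>2" by (simp add: s2)
  assume t: "0 \<le> t"
  note r = rescale_H01(2)[OF u, of t] rescale_Lnorm[of 2 t u] rescale_Lnorm[of 4 t u]
  have B': "b * (Gn (rescale t u))\<^sup>2 - l * (Mn (rescale t u))\<^sup>2 = t\<^sup>2 * B"
    by (simp add: r B power_mult_distrib algebra_simps)
  have D': "(Lnorm 4 \<Omega> (rescale t u)) ^ 4 - a * (Gn (rescale t u)) ^ 4 = t ^ 4 * D"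
    by (simp add: r D power_mult_distrib algebra_simps)
  have t4: "t ^ 4 = t\<^sup>2 * t\<^sup>2" by (simp flip: power_add)
  show "I_fun \<Omega> a b l 3 (rescale t u) = t\<^sup>2 * D * ((sigma_coeff \<Omega> a b l u)\<^sup>2 - t\<^sup>2)"
    unfolding I_fun_3 B' D' t4 by (subst BD) (simp add: algebra_simps)
  show "J_fun \<Omega> a b l 3 (rescale t u) = t\<^sup>2 * D * ((sigma_coeff \<Omega> a b l u)\<^sup>2 / 2 - t\<^sup>2 / 4)"
    unfolding J_fun_3 B' D' t4 by (subst BD) (simp add: algebra_simps)
qed

lemma quadratic_form_scale:
  assumes "u \<in> H01 \<Omega>"
  shows "b * (Gn (rescale t u))\<^sup>2 - l * (Mn (rescale t u))\<^sup>2 = t\<^sup>2 * (b * (Gn u)\<^sup>2 - l * (Mn u)\<^sup>2)"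
  using rescale_H01(2)[OF assms, of t] rescale_Lnorm[of 2 t u]
  by (simp add: power_mult_distrib algebra_simps)

text \<open>For \<open>l > 0\<close> the Rayleigh bound absorbs \<open>l * (Mn u)\<^sup>2\<close>
  into \<open>(l / lam1) * (Gn u)\<^sup>2\<close>, which leaves the constant
  \<open>b - l / lam1\<close>; for \<open>l \<le> 0\<close> the constant is \<open>b\<close>
  itself.\<close>

lemma coercive:
  assumes "0 < b" "l < b * lam1"
  obtains c where "0 < c" "\<And>u. u \<in> H01 \<Omega> \<Longrightarrow> c * (Gn u)\<^sup>2 \<le> b * (Gn u)\<^sup>2 - l * (Mn u)\<^sup>2"
proof (cases "l \<le> 0")
  case True
  then have "b * (Gn u)\<^sup>2 \<le> b * (Gn u)\<^sup>2 - l * (Mn u)\<^sup>2" for u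
    by (simp add: mult_nonpos_nonneg)
  then show thesis using that[OF assms(1)] by blast
next
  case False
  have c: "0 < b - l / lam1" using assms lam1_pos by (simp add: pos_divide_less_eq)
  have "(b - l / lam1) * (Gn u)\<^sup>2 \<le> b * (Gn u)\<^sup>2 - l * (Mn u)\<^sup>2" if "u \<in> H01 \<Omega>" for u
  proof -
    have "(l / lam1) * (lam1 * (Mn u)\<^sup>2) \<le> (l / lam1) * (Gn u)\<^sup>2"
      using False lam1_pos lam1_le[OF that] by (intro mult_left_mono) auto
    then show ?thesis using lam1_pos by (simp add: left_diff_distrib)
  qed
  then show thesis using that[OF c] by blast
qed

lemma Lambda_props:
  assumes "0 < a" "a < 1 / Lambda_const \<Omega>"
  shows "0 < Lambda_const \<Omega>" "\<And>u. u \<in> H01 \<Omega> \<Longrightarrow> Lambda_const \<Omega> * (Lnorm 4 \<Omega> u) ^ 4 \<le> (Gn u) ^ 4"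
    "S_set \<Omega> a \<noteq> {}"
proof -
  let ?U = "{u \<in> H01 \<Omega>. Lnorm 4 \<Omega> u = 1}"
  have normalize: "rescale (1 / Lnorm 4 \<Omega> u) u \<in> ?U" if "u \<in> H01 \<Omega>" "Lnorm 4 \<Omega> u \<noteq> 0" for u
    using rescale_H01[OF that(1)] that(2) Lnorm_nonneg[of 4 \<Omega> u] by (simp add: rescale_Lnorm)
  obtain u0 where "u0 \<in> H01 \<Omega>" "u0 \<notin> zero_H01 \<Omega>" by (rule exists_nonzero[OF nonempty])
  then have ne: "?U \<noteq> {}" using normalize[of u0] Lnorm_pos[of u0 4] by auto
  have bdd: "bdd_below ((\<lambda>u. (Gn u) ^ 4) ` ?U)" by (rule bdd_belowI[of _ 0]) (auto simp: Lnorm_nonneg)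
  have "0 \<le> Lambda_const \<Omega>"
    unfolding Lambda_const_def by (rule cINF_greatest[OF ne]) (simp add: Lnorm_nonneg)
  \<comment> \<open>The value 0 would give \<open>1 / Lambda_const \<Omega> = 0\<close> by
    convention, contrary to the bounds on \<open>a\<close>.\<close>
  then show pos: "0 < Lambda_const \<Omega>" using assms by (cases "Lambda_const \<Omega> = 0") auto
  show "Lambda_const \<Omega> * (Lnorm 4 \<Omega> u) ^ 4 \<le> (Gn u) ^ 4" if u: "u \<in> H01 \<Omega>" for u
  proof (cases "Lnorm 4 \<Omega> u = 0")
    case True
    then show ?thesis by simp
  next
    case False
    then have "0 < Lnorm 4 \<Omega> u" using Lnorm_nonneg[of 4 \<Omega> u] by linarith
    moreover have "Lambda_const \<Omega> \<le> (Gn (rescale (1 / Lnorm 4 \<Omega> u) u)) ^ 4"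
      unfolding Lambda_const_def by (rule cINF_lower[OF bdd normalize[OF u False]])
    ultimately show ?thesis
      using rescale_H01(2)[OF u, of "1 / Lnorm 4 \<Omega> u"] by (simp add: power_divide pos_le_divide_eq)
  qed
  \<comment> \<open>A near minimizer with L4 norm 1 satisfies \<open>a * (Gn u) ^ 4 < 1\<close>,
    which is membership in \<open>S_set\<close>.\<close>
  have "Lambda_const \<Omega> < 1 / a" using assms pos by (simp add: field_simps)
  then obtain u where u: "u \<in> ?U" "(Gn u) ^ 4 < 1 / a"
    using cINF_less_iff[OF ne bdd] unfolding Lambda_const_def by blast
  then have "u \<in> S_set \<Omega> a" using assms(1) by (simp add: S_set_def field_simps)
  then show "S_set \<Omega> a \<noteq> {}" by blast
qed

lemma S_set_nonzero:
  assumes "0 < a" "u \<in> S_set \<Omega> a"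
  shows "u \<in> H01 \<Omega>" "u \<notin> zero_H01 \<Omega>" "0 < (Lnorm 4 \<Omega> u) ^ 4 - a * (Gn u) ^ 4"
proof -
  show u: "u \<in> H01 \<Omega>" and D: "0 < (Lnorm 4 \<Omega> u) ^ 4 - a * (Gn u) ^ 4" using assms(2) by (auto simp: S_set_def)
  show "u \<notin> zero_H01 \<Omega>"
  proof
    assume "u \<in> zero_H01 \<Omega>"
    then have "AE x in lebesgue_on \<Omega>. u x = 0" by (simp add: zero_H01_def)
    then have "Lnorm 4 \<Omega> u = Lnorm 4 \<Omega> (\<lambda>x. 0::real)"
      using L2_onD(1)[OF H01_L2(1)[OF u]] by (intro Lnorm_cong_AE) auto
    then have "Lnorm 4 \<Omega> u = 0" by (simp add: Lnorm_def)
    moreover have "0 \<le> a * (Gn u) ^ 4" using assms(1) by (simp add: Lnorm_nonneg)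
    ultimately show False using D by simp
  qed
qed

lemma Nehari_cubic_below_eigenvalue:
  assumes "0 < a" "0 < b" "a < 1 / Lambda_const \<Omega>" "l < b * lam1"
  shows "N_set \<Omega> a b l 3 \<noteq> {}" "W_plus \<Omega> a b l 3 \<noteq> {}" "W_minus \<Omega> a b l 3 \<noteq> {}"
    "\<forall>u\<in>S_set \<Omega> a. fibering_max \<Omega> a b l 3 u (sigma_coeff \<Omega> a b l u) \<and> (\<exists>!s. fibering_max \<Omega> a b l 3 u s)"
    "\<forall>u\<in>H01 \<Omega> - S_set \<Omega> a. \<forall>t>0. rescale t u \<in> N_plus \<Omega> a b l 3"
    "bdd_below (J_fun \<Omega> a b l 3 ` N_set \<Omega> a b l 3)" "0 < d_const \<Omega> a b l 3"
proof -
  obtain c where c: "0 < c" "\<And>u. u \<in> H01 \<Omega> \<Longrightarrow> c * (Gn u)\<^sup>2 \<le> b * (Gn u)\<^sup>2 - l * (Mn u)\<^sup>2"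
    by (rule coercive[OF assms(2,4)]) blast
  have Bpos: "0 < b * (Gn u)\<^sup>2 - l * (Mn u)\<^sup>2" if "u \<in> H01 \<Omega>" "u \<notin> zero_H01 \<Omega>" for u
    using c(2)[OF that(1)] c(1) nonzero_pos(2)[OF that] by (smt (verit) zero_less_mult_iff zero_less_power)
  note Lam = Lambda_props[OF assms(1,3)]
  have fib: "fibering_max \<Omega> a b l 3 u (sigma_coeff \<Omega> a b l u)" if uS: "u \<in> S_set \<Omega> a" for u
  proof -
    note u = S_set_nonzero[OF assms(1) uS]
    have sign: "0 < (b * (Gn u)\<^sup>2 - l * (Mn u)\<^sup>2) / ((Lnorm 4 \<Omega> u) ^ 4 - a * (Gn u) ^ 4)"
      using Bpos[OF u(1,2)] u(3) by simp
    note r = ray_3[OF u(1) refl refl sign]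
    show ?thesis
    proof (rule fibering_maxI[OF u(1,2) _ r(1)])
      show "I_fun \<Omega> a b l 3 (rescale (sigma_coeff \<Omega> a b l u) u) = 0" using r(1) r(3)[of "sigma_coeff \<Omega> a b l u"] by simp
      show "0 < I_fun \<Omega> a b l 3 (rescale t u)" if "0 < t" "t < sigma_coeff \<Omega> a b l u" for t
        using r(3)[of t] u(3) that by (simp add: power_strict_mono)
      show "I_fun \<Omega> a b l 3 (rescale t u) < 0" if "sigma_coeff \<Omega> a b l u < t" for t
        using r(1) r(3)[of t] u(3) that by (simp add: mult_pos_neg power_strict_mono)
    qed simp
  qed
  then show "\<forall>u\<in>S_set \<Omega> a. fibering_max \<Omega> a b l 3 u (sigma_coeff \<Omega> a b l u) \<and> (\<exists>!s. fibering_max \<Omega> a b l 3 u s)"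
    using fibering_max_unique by blast
  obtain u where uS: "u \<in> S_set \<Omega> a" using Lam(3) by blast
  note u = S_set_nonzero[OF assms(1) uS]
  show ne: "N_set \<Omega> a b l 3 \<noteq> {}" using fib[OF uS] by (auto simp: fibering_max_def)
  show "\<forall>u\<in>H01 \<Omega> - S_set \<Omega> a. \<forall>t>0. rescale t u \<in> N_plus \<Omega> a b l 3"
  proof (intro ballI allI impI)
    fix u t assume u: "u \<in> H01 \<Omega> - S_set \<Omega> a" and t: "0 < (t::real)"
    then have uH: "u \<in> H01 \<Omega>" by simp
    show "rescale t u \<in> N_plus \<Omega> a b l 3"
    proof (cases "u \<in> zero_H01 \<Omega>")
      case True
      then show ?thesis using rescale_zero_iff[OF uH t] by (simp add: N_plus_def)
    next
      case False
      note rz = rescale_H01[OF uH, of t]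
      have "0 < b * (Gn (rescale t u))\<^sup>2 - l * (Mn (rescale t u))\<^sup>2"
        using rescale_zero_iff[OF uH t] False rz(1) by (intro Bpos) auto
      moreover have "(Lnorm 4 \<Omega> (rescale t u)) ^ 4 - a * (Gn (rescale t u)) ^ 4 = t ^ 4 * ((Lnorm 4 \<Omega> u) ^ 4 - a * (Gn u) ^ 4)"
        using rz(2) rescale_Lnorm[of 4 t u] by (simp add: power_mult_distrib algebra_simps)
      moreover have "t ^ 4 * ((Lnorm 4 \<Omega> u) ^ 4 - a * (Gn u) ^ 4) \<le> 0"
        using u t by (intro mult_nonneg_nonpos) (auto simp: S_set_def)
      ultimately show ?thesis using rz(1) by (simp add: N_plus_def I_fun_3)
    qed
  qed
  \<comment> \<open>On \<open>N_set\<close> the quadratic form equals D(u), and D(u) is at most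
    \<open>k * (Gn u) ^ 4\<close> by the bound through \<Lambda>. Coercivity then gives
    \<open>(Gn u)\<^sup>2 \<ge> c / k\<close>, and \<open>J_fun\<close>, a quarter of the form, is
    at least \<open>c\<^sup>2 / k / 4\<close>.\<close>
  define k where "k = 1 / Lambda_const \<Omega> - a"
  have k: "0 < k" using assms(3) by (simp add: k_def)
  have lower: "c\<^sup>2 / k / 4 \<le> J_fun \<Omega> a b l 3 u" if "u \<in> N_set \<Omega> a b l 3" for u
  proof -
    have u: "u \<in> H01 \<Omega>" "u \<notin> zero_H01 \<Omega>" "I_fun \<Omega> a b l 3 u = 0" using that by (auto simp: N_set_def)
    have BD: "b * (Gn u)\<^sup>2 - l * (Mn u)\<^sup>2 = (Lnorm 4 \<Omega> u) ^ 4 - a * (Gn u) ^ 4"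
      using u(3) by (simp add: I_fun_3)
    have "(Lnorm 4 \<Omega> u) ^ 4 \<le> (Gn u) ^ 4 / Lambda_const \<Omega>"
      using Lam(2)[OF u(1)] Lam(1) by (simp add: pos_le_divide_eq mult.commute)
    then have "c * (Gn u)\<^sup>2 \<le> k * (Gn u) ^ 4"
      using c(2)[OF u(1)] BD by (simp add: k_def left_diff_distrib)
    also have "\<dots> = (k * (Gn u)\<^sup>2) * (Gn u)\<^sup>2" by (simp flip: power_add)
    finally have "c \<le> k * (Gn u)\<^sup>2" using nonzero_pos(2)[OF u(1,2)] by simp
    then have "c * (c / k) \<le> c * (Gn u)\<^sup>2" using k c(1) by (intro mult_left_mono) (auto simp: pos_divide_le_eq mult.commute)
    moreover have "J_fun \<Omega> a b l 3 u = (b * (Gn u)\<^sup>2 - l * (Mn u)\<^sup>2) / 4"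
      unfolding J_fun_3 BD by simp
    ultimately show ?thesis using c(2)[OF u(1)] by (simp add: power2_eq_square)
  qed
  show "bdd_below (J_fun \<Omega> a b l 3 ` N_set \<Omega> a b l 3)" using lower by (intro bdd_belowI2)
  have "0 < c\<^sup>2 / k / 4" using c(1) k by simp
  also have "\<dots> \<le> d_const \<Omega> a b l 3" unfolding d_const_def using lower by (intro cINF_greatest ne)
  finally show d: "0 < d_const \<Omega> a b l 3" .
  show "W_plus \<Omega> a b l 3 \<noteq> {}" by (rule W_plus_nonempty[OF d]) simp
  have sign: "0 < (b * (Gn u)\<^sup>2 - l * (Mn u)\<^sup>2) / ((Lnorm 4 \<Omega> u) ^ 4 - a * (Gn u) ^ 4)"
    using Bpos[OF u(1,2)] u(3) by simp
  note r = ray_3[OF u(1) refl refl sign]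
  \<comment> \<open>At twice \<sigma> the last factor in \<open>I_fun\<close> is -3 \<sigma>^2 and
    the one in \<open>J_fun\<close> is \<sigma>^2 / 2 - \<sigma>^2, so both are negative.\<close>
  let ?t = "2 * sigma_coeff \<Omega> a b l u"
  show "W_minus \<Omega> a b l 3 \<noteq> {}"
  proof (rule W_minus_nonempty[OF d rescale_H01(1)[OF u(1), of ?t]])
    show "I_fun \<Omega> a b l 3 (rescale ?t u) < 0"
      using r(1) r(3)[of ?t] u(3) by (simp add: power_mult_distrib mult_pos_neg)
    show "J_fun \<Omega> a b l 3 (rescale ?t u) \<le> 0"
      using r(1) r(4)[of ?t] u(3) by (simp add: power_mult_distrib mult_nonneg_nonpos)
  qed
qed

end

subsection \<open>The cases \<open>\<lambda> > b \<lambda>\<^sub>1\<close> and \<open>p > 3\<close>\<close>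

context bounded_domain
begin

text \<open>Otherwise there are elements of \<open>L_minus\<close> with \<open>Gn v = 1\<close> and
  D(v) above -1 / (n + 1). Rellich and the weak limit lemma give \<open>w\<close> with
  \<open>Gn w \<le> 1\<close>, \<open>b \<le> l * (Mn w)\<^sup>2\<close> and
  \<open>a \<le> (Lnorm 4 \<Omega> w) ^ 4\<close>. These weak inequalities place \<open>w\<close>
  only in the larger cone for \<open>l'\<close>, but there D(w) < 0, which contradicts the last
  one.\<close>

lemma L_minus_uniform_gap:
  assumes ab: "0 < a" "0 < b" and l: "0 < l" "l < l'"
    and neg: "\<And>u. u \<in> L_minus \<Omega> b l' \<Longrightarrow> (Lnorm 4 \<Omega> u) ^ 4 - a * (Gn u) ^ 4 < 0"
  shows "\<exists>c>0. \<forall>u\<in>L_minus \<Omega> b l. (Lnorm 4 \<Omega> u) ^ 4 - a * (Gn u) ^ 4 \<le> - c * (Gn u) ^ 4" (is ?thesis)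
proof (rule ccontr)
  assume *: "\<not> ?thesis"
  have "\<exists>v. v \<in> H01 \<Omega> \<and> Gn v = 1 \<and> b < l * (Mn v)\<^sup>2 \<and> a - inverse (real (Suc n)) < (Lnorm 4 \<Omega> v) ^ 4" for n
  proof -
    have "0 < inverse (real (Suc n))" by simp
    then obtain u where u: "u \<in> L_minus \<Omega> b l" "\<not> (Lnorm 4 \<Omega> u) ^ 4 - a * (Gn u) ^ 4 \<le> - inverse (real (Suc n)) * (Gn u) ^ 4"
      using * by blast
    then have uH: "u \<in> H01 \<Omega>" and q: "b * (Gn u)\<^sup>2 - l * (Mn u)\<^sup>2 < 0" by (auto simp: L_minus_def)
    have "u \<notin> zero_H01 \<Omega>"
    proof
      assume "u \<in> zero_H01 \<Omega>"
      then have "Mn u = 0" using zero_H01_iff[OF uH] by simp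
      then show False using q ab by (simp add: mult_less_0_iff)
    qed
    then have g: "0 < Gn u" by (rule nonzero_pos[OF uH])
    let ?v = "rescale (1 / Gn u) u"
    have v: "?v \<in> H01 \<Omega>" "Gn ?v = 1" using rescale_H01[OF uH, of "1 / Gn u"] g by auto
    moreover have "b < l * (Mn ?v)\<^sup>2"
      using rescale_Lnorm[of 2 "1 / Gn u" u] g q by (simp add: power_divide pos_less_divide_eq)
    moreover have "a - inverse (real (Suc n)) < (Lnorm 4 \<Omega> ?v) ^ 4"
    proof -
      have "(a - inverse (real (Suc n))) * (Gn u) ^ 4 < (Lnorm 4 \<Omega> u) ^ 4"
        using u(2) by (simp only: left_diff_distrib)
      then show ?thesis
        using rescale_Lnorm[of 4 "1 / Gn u" u] g by (simp only: power_divide) (simp add: power_divide pos_less_divide_eq)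
    qed
    ultimately show ?thesis by blast
  qed
  then have "\<exists>v. \<forall>n. v n \<in> H01 \<Omega> \<and> Gn (v n) = 1 \<and> b < l * (Mn (v n))\<^sup>2 \<and> a - inverse (real (Suc n)) < (Lnorm 4 \<Omega> (v n)) ^ 4"
    by (intro choice allI)
  then obtain v where v: "\<And>n. v n \<in> H01 \<Omega>" "\<And>n. Gn (v n) = 1" "\<And>n. b < l * (Mn (v n))\<^sup>2"
    "\<And>n. a - inverse (real (Suc n)) < (Lnorm 4 \<Omega> (v n)) ^ 4" by blast
  have v1: "Gn (v n) \<le> 1" for n using v(2)[of n] by simp
  have "\<exists>r::nat \<Rightarrow> nat. strict_mono r \<and>
    (\<forall>e>0. \<exists>N. \<forall>m\<ge>N. \<forall>n\<ge>N. Mn (\<lambda>x. v (r m) x - v (r n) x) < e)"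
    by (rule Rellich[of v 1, OF v(1) v1])
  then obtain r :: "nat \<Rightarrow> nat" where r: "strict_mono r" and
    CM: "\<And>e. 0 < e \<Longrightarrow> \<exists>N. \<forall>m\<ge>N. \<forall>n\<ge>N. Mn (\<lambda>x. v (r m) x - v (r n) x) < e"
    by blast
  obtain w where w: "w \<in> H01 \<Omega>" "Gn w \<le> 1" "(\<lambda>n. Mn (\<lambda>x. v (r n) x - w x)) \<longlonglongrightarrow> 0"
    by (rule H01_weak_limit[of "\<lambda>n. v (r n)" 1, OF v(1) v1 CM])
  have "(\<lambda>n. l * (Mn (v (r n)))\<^sup>2) \<longlonglongrightarrow> l * (Mn w)\<^sup>2"
    by (intro tendsto_intros LIMSEQ_Lnorm_2[OF H01_L2(1)[OF v(1)] H01_L2(1)[OF w(1)] w(3)])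
  then have bM: "b \<le> l * (Mn w)\<^sup>2" by (rule LIMSEQ_le_const) (use v(3) less_imp_le in blast)
  have L4: "(\<lambda>n. (Lnorm 4 \<Omega> (v (r n))) ^ 4) \<longlonglongrightarrow> (Lnorm 4 \<Omega> w) ^ 4"
  proof (rule LIM_zero_cancel, rule Lim_null_comparison)
    show "(\<lambda>n. 256 * Mn (\<lambda>x. v (r n) x - w x) * (1 + (Gn w) ^ 3)) \<longlonglongrightarrow> 0"
      by (intro tendsto_mult_left_zero tendsto_mult_right_zero w(3))
    show "\<forall>\<^sub>F n in sequentially. norm ((Lnorm 4 \<Omega> (v (r n))) ^ 4 - (Lnorm 4 \<Omega> w) ^ 4) \<le> 256 * Mn (\<lambda>x. v (r n) x - w x) * (1 + (Gn w) ^ 3)"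
      using L4_diff_le[OF v(1) w(1)] v(2) by simp
  qed
  have "(\<lambda>n. a - inverse (real (Suc (r n)))) \<longlonglongrightarrow> a - 0"
    by (intro tendsto_diff tendsto_const LIMSEQ_subseq_LIMSEQ[OF LIMSEQ_inverse_real_of_nat r, unfolded o_def])
  then have "a - 0 \<le> (Lnorm 4 \<Omega> w) ^ 4"
    by (rule LIMSEQ_le[OF _ L4]) (use v(4) less_imp_le in blast)
  then have a4: "a \<le> (Lnorm 4 \<Omega> w) ^ 4" by simp
  \<comment> \<open>\<open>b > 0\<close> keeps the limit away from zero, and this makes the
    inequality strict when \<open>l\<close> is raised to \<open>l'\<close>.\<close>
  have "0 < (Mn w)\<^sup>2" using bM ab l by (simp add: zero_less_mult_iff) (use bM ab l in \<open>auto simp: zero_less_mult_iff\<close>)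
  then have "l * (Mn w)\<^sup>2 < l' * (Mn w)\<^sup>2" using l(2) by simp
  moreover have "b * (Gn w)\<^sup>2 \<le> b"
    using w(2) ab(2) by (simp add: mult_left_le power_le_one Lnorm_nonneg)
  ultimately have "w \<in> L_minus \<Omega> b l'" using bM w(1) by (simp add: L_minus_def)
  then have "(Lnorm 4 \<Omega> w) ^ 4 - a * (Gn w) ^ 4 < 0" by (rule neg)
  moreover have "a * (Gn w) ^ 4 \<le> a" using w(2) ab(1) by (simp add: mult_left_le power_le_one Lnorm_nonneg)
  ultimately show False using a4 by linarith
qed

lemma Nehari_cubic_above_eigenvalue:
  assumes ab: "0 < a" "0 < b" and a: "a < 1 / Lambda_const \<Omega>"
    and \<psi>: "dirichlet_eigenfunction \<Omega> lam1 \<psi>"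
    and \<delta>: "delta_admissible \<Omega> a b \<delta>" and l: "b * lam1 < l" "l < b * lam1 + \<delta>"
  shows "N_set \<Omega> a b l 3 \<inter> L_zero \<Omega> b l = {}"
    "N_set \<Omega> a b l 3 \<inter> L_plus \<Omega> b l \<noteq> {}" "N_set \<Omega> a b l 3 \<inter> L_minus \<Omega> b l \<noteq> {}"
    "\<forall>u\<in>S_set \<Omega> a. sigma_coeff \<Omega> a b l u > 0 \<and>
          rescale (sigma_coeff \<Omega> a b l u) u \<in> N_set \<Omega> a b l 3 \<inter> L_plus \<Omega> b l \<and>
          (\<forall>t. 0 < t \<and> t < sigma_coeff \<Omega> a b l u \<longrightarrow> rescale t u \<in> N_plus \<Omega> a b l 3) \<and>
          (\<forall>t>sigma_coeff \<Omega> a b l u. rescale t u \<in> N_minus \<Omega> a b l 3)"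
    "\<forall>u\<in>L_minus \<Omega> b l. sigma_coeff \<Omega> a b l u > 0 \<and>
          rescale (sigma_coeff \<Omega> a b l u) u \<in> N_set \<Omega> a b l 3 \<inter> L_minus \<Omega> b l \<and>
          (\<forall>t. 0 < t \<and> t < sigma_coeff \<Omega> a b l u \<longrightarrow> rescale t u \<in> N_minus \<Omega> a b l 3) \<and>
          (\<forall>t>sigma_coeff \<Omega> a b l u. rescale t u \<in> N_plus \<Omega> a b l 3)"
    "bdd_below (J_fun \<Omega> a b l 3 ` (N_set \<Omega> a b l 3 \<inter> L_minus \<Omega> b l))"
    "(INF u\<in>N_set \<Omega> a b l 3 \<inter> L_minus \<Omega> b l. J_fun \<Omega> a b l 3 u) < 0"
proof -
  let ?D = "\<lambda>u. (Lnorm 4 \<Omega> u) ^ 4 - a * (Gn u) ^ 4"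
  let ?B = "\<lambda>u. b * (Gn u)\<^sup>2 - l * (Mn u)\<^sup>2"
  let ?s = "sigma_coeff \<Omega> a b l"
  have l0: "0 < l" using l(1) ab(2) lam1_pos by (smt (verit) mult_pos_pos)
  have Lnz: "u \<in> H01 \<Omega>" "u \<notin> zero_H01 \<Omega>" if "u \<in> L_minus \<Omega> b m" for u m
  proof -
    show u: "u \<in> H01 \<Omega>" using that by (simp add: L_minus_def)
    show "u \<notin> zero_H01 \<Omega>"
      using that zero_H01_iff[OF u] ab(2) by (auto simp: L_minus_def mult_less_0_iff)
  qed
  have SH: "S_set \<Omega> a \<subseteq> H1 \<Omega>" and LH: "L_minus \<Omega> b m \<subseteq> H1 \<Omega>" for m
    using H01_H1 by (auto simp: S_set_def L_minus_def)
  have disj: "u \<notin> L_minus \<Omega> b m" if "u \<in> S_set \<Omega> a" "b * lam1 < m" "m < b * lam1 + \<delta>" for u m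
  proof
    assume "u \<in> L_minus \<Omega> b m"
    then have "u \<in> H1_closure \<Omega> (L_minus \<Omega> b m) \<inter> H1_closure \<Omega> (S_set \<Omega> a)"
      using subset_H1_closure[OF SH] subset_H1_closure[OF LH] that(1) by blast
    then have "u \<in> zero_H01 \<Omega>" using \<delta> that(2,3) unfolding delta_admissible_def by blast
    then show False using S_set_nonzero[OF ab(1) that(1)] by blast
  qed
  \<comment> \<open>Disjointness from \<open>S_set\<close> gives \<open>?D u \<le> 0\<close>; the
    second condition of \<open>delta_admissible\<close> excludes equality.\<close>
  have neg: "?D u < 0" if "u \<in> L_minus \<Omega> b m" "b * lam1 < m" "m < b * lam1 + \<delta>" for u m
  proof -
    have "?D u \<noteq> 0" using \<delta> that unfolding delta_admissible_def by blast
    moreover have "\<not> 0 < ?D u" using disj[OF _ that(2,3), of u] that(1) Lnz(1)[OF that(1)] by (auto simp: S_set_def)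
    ultimately show ?thesis by linarith
  qed
  \<comment> \<open>The midpoint between \<open>l\<close> and the upper end of the admissible
    interval, so \<open>disj\<close> and \<open>neg\<close> are available for \<open>l'\<close> as
    well.\<close>
  define l' where "l' = (l + b * lam1 + \<delta>) / 2"
  have l': "l < l'" "b * lam1 < l'" "l' < b * lam1 + \<delta>" using l by (auto simp: l'_def)
  have enlarge: "u \<in> L_minus \<Omega> b l'" if "u \<in> H01 \<Omega>" "u \<notin> zero_H01 \<Omega>" "?B u \<le> 0" for u
  proof -
    have "l * (Mn u)\<^sup>2 < l' * (Mn u)\<^sup>2" using nonzero_pos(1)[OF that(1,2)] l'(1) by simp
    then show ?thesis using that by (simp add: L_minus_def)
  qed
  show L0: "N_set \<Omega> a b l 3 \<inter> L_zero \<Omega> b l = {}"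
  proof (rule equals0I)
    fix u assume "u \<in> N_set \<Omega> a b l 3 \<inter> L_zero \<Omega> b l"
    then have u: "u \<in> H01 \<Omega>" "u \<notin> zero_H01 \<Omega>" "I_fun \<Omega> a b l 3 u = 0" "?B u = 0"
      by (auto simp: N_set_def L_zero_def)
    then show False using neg[OF enlarge[OF u(1,2)] l'(2,3)] by (simp add: I_fun_3)
  qed
  have vS: "?s u > 0 \<and> rescale (?s u) u \<in> N_set \<Omega> a b l 3 \<inter> L_plus \<Omega> b l \<and>
          (\<forall>t. 0 < t \<and> t < ?s u \<longrightarrow> rescale t u \<in> N_plus \<Omega> a b l 3) \<and>
          (\<forall>t>?s u. rescale t u \<in> N_minus \<Omega> a b l 3)" if uS: "u \<in> S_set \<Omega> a" for u
  proof -
    note u = S_set_nonzero[OF ab(1) uS]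
    \<comment> \<open>An element of S with nonpositive quadratic form would lie in
      \<open>L_minus\<close> for \<open>l'\<close>, which \<open>disj\<close> forbids.\<close>
    have B: "0 < ?B u" using enlarge[OF u(1,2)] disj[OF uS l'(2,3)] by force
    have "0 < ?B u / ?D u" using B u(3) by simp
    note r = ray_3[OF u(1) refl refl this]
    have "I_fun \<Omega> a b l 3 (rescale (?s u) u) = 0" using r(1) r(3)[of "?s u"] by simp
    moreover have "0 < I_fun \<Omega> a b l 3 (rescale t u)" if "0 < t" "t < ?s u" for t
      using r(3)[of t] u(3) that by (simp add: power_strict_mono)
    moreover have "I_fun \<Omega> a b l 3 (rescale t u) < 0" if "?s u < t" for t
      using r(1) r(3)[of t] u(3) that by (simp add: mult_pos_neg power_strict_mono)
    moreover have "0 < (?s u)\<^sup>2 * ?B u" using r(1) B by (intro mult_pos_pos) auto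
    ultimately show ?thesis
      using r(1) rescale_H01(1)[OF u(1)] rescale_zero_iff[OF u(1)] u(2) quadratic_form_scale[OF u(1), of b "?s u" l]
      by (simp add: N_set_def N_plus_def N_minus_def L_plus_def)
  qed
  have vL: "?s u > 0 \<and> rescale (?s u) u \<in> N_set \<Omega> a b l 3 \<inter> L_minus \<Omega> b l \<and>
          (\<forall>t. 0 < t \<and> t < ?s u \<longrightarrow> rescale t u \<in> N_minus \<Omega> a b l 3) \<and>
          (\<forall>t>?s u. rescale t u \<in> N_plus \<Omega> a b l 3)" if uL: "u \<in> L_minus \<Omega> b l" for u
  proof -
    note u = Lnz[OF uL]
    have B: "?B u < 0" using uL by (simp add: L_minus_def)
    have D: "?D u < 0" by (rule neg[OF uL l])
    have "0 < ?B u / ?D u" using B D by (rule divide_neg_neg)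
    note r = ray_3[OF u(1) refl refl this]
    have "I_fun \<Omega> a b l 3 (rescale (?s u) u) = 0" using r(1) r(3)[of "?s u"] by simp
    moreover have "I_fun \<Omega> a b l 3 (rescale t u) < 0" if t: "0 < t" "t < ?s u" for t
    proof -
      have "t\<^sup>2 * ?D u < 0" using D t by (intro mult_pos_neg) auto
      moreover have "t\<^sup>2 < (?s u)\<^sup>2" using t by (intro power_strict_mono) auto
      ultimately show ?thesis using r(3)[of t] t by (simp add: mult_neg_pos)
    qed
    moreover have "0 < I_fun \<Omega> a b l 3 (rescale t u)" if t: "?s u < t" for t
    proof -
      have "t\<^sup>2 * ?D u < 0" using D t r(1) by (intro mult_pos_neg) auto
      moreover have "(?s u)\<^sup>2 < t\<^sup>2" using t r(1) by (intro power_strict_mono) auto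
      ultimately show ?thesis using r(1) r(3)[of t] t by (simp add: mult_neg_neg)
    qed
    moreover have "(?s u)\<^sup>2 * ?B u < 0" using B r(1) by (intro mult_pos_neg) auto
    ultimately show ?thesis
      using r(1) rescale_H01(1)[OF u(1)] rescale_zero_iff[OF u(1)] u(2) quadratic_form_scale[OF u(1), of b "?s u" l]
      by (simp add: N_set_def N_plus_def N_minus_def L_minus_def)
  qed
  from vS show "\<forall>u\<in>S_set \<Omega> a. ?s u > 0 \<and> rescale (?s u) u \<in> N_set \<Omega> a b l 3 \<inter> L_plus \<Omega> b l \<and>
          (\<forall>t. 0 < t \<and> t < ?s u \<longrightarrow> rescale t u \<in> N_plus \<Omega> a b l 3) \<and>
          (\<forall>t>?s u. rescale t u \<in> N_minus \<Omega> a b l 3)" by (rule ballI)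
  from vL show "\<forall>u\<in>L_minus \<Omega> b l. ?s u > 0 \<and> rescale (?s u) u \<in> N_set \<Omega> a b l 3 \<inter> L_minus \<Omega> b l \<and>
          (\<forall>t. 0 < t \<and> t < ?s u \<longrightarrow> rescale t u \<in> N_minus \<Omega> a b l 3) \<and>
          (\<forall>t>?s u. rescale t u \<in> N_plus \<Omega> a b l 3)" by (rule ballI)
  show "N_set \<Omega> a b l 3 \<inter> L_plus \<Omega> b l \<noteq> {}"
    using vS Lambda_props(3)[OF ab(1) a] by blast
  note e = eigenfunction_Rayleigh[OF \<psi>]
  \<comment> \<open>The eigenfunction has Rayleigh quotient \<open>lam1\<close>, so its quadratic
    form is negative as soon as \<open>l\<close> exceeds \<open>b * lam1\<close>.\<close>
  have "?B \<psi> = - ((l - b * lam1) * (Mn \<psi>)\<^sup>2)" unfolding e(3) by (simp add: algebra_simps)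
  moreover have "0 < (l - b * lam1) * (Mn \<psi>)\<^sup>2" using nonzero_pos(1)[OF e(1,2)] l(1) by simp
  ultimately have "\<psi> \<in> L_minus \<Omega> b l" using e(1) by (simp add: L_minus_def)
  then show ne: "N_set \<Omega> a b l 3 \<inter> L_minus \<Omega> b l \<noteq> {}" using vL by blast
  obtain c where c: "0 < c" "\<And>u. u \<in> L_minus \<Omega> b l \<Longrightarrow> ?D u \<le> - c * (Gn u) ^ 4"
    using L_minus_uniform_gap[OF ab l0 l'(1) neg[OF _ l'(2,3)]] by blast
  \<comment> \<open>On the set considered \<open>?B u = ?D u\<close>, with
    \<open>?D u \<le> - c * (Gn u) ^ 4\<close> from the uniform gap and
    \<open>?B u \<ge> - k * (Gn u)\<^sup>2\<close> from the Rayleigh bound. Hence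
    \<open>(Gn u)\<^sup>2 \<le> k / c\<close>, and \<open>J_fun\<close>, a quarter of
    \<open>?B u\<close>, is bounded below.\<close>
  define k where "k = l / lam1"
  have k: "0 < k" using l0 lam1_pos by (simp add: k_def)
  have J: "J_fun \<Omega> a b l 3 u = ?B u / 4" "?B u = ?D u" if "u \<in> N_set \<Omega> a b l 3" for u
    using that by (auto simp: N_set_def I_fun_3 J_fun_3)
  have lower: "- (k * (k / c)) / 4 \<le> J_fun \<Omega> a b l 3 u" if u: "u \<in> N_set \<Omega> a b l 3 \<inter> L_minus \<Omega> b l" for u
  proof -
    have uL: "u \<in> L_minus \<Omega> b l" and uN: "u \<in> N_set \<Omega> a b l 3" using u by auto
    note uH = Lnz[OF uL]
    have "k * (lam1 * (Mn u)\<^sup>2) \<le> k * (Gn u)\<^sup>2" using lam1_le[OF uH(1)] k by (intro mult_left_mono) auto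
    then have "l * (Mn u)\<^sup>2 \<le> k * (Gn u)\<^sup>2" using lam1_pos by (simp add: k_def)
    moreover have "0 \<le> b * (Gn u)\<^sup>2" using ab(2) by simp
    ultimately have B: "- (k * (Gn u)\<^sup>2) \<le> ?B u" by linarith
    moreover have "(c * (Gn u)\<^sup>2) * (Gn u)\<^sup>2 = c * (Gn u) ^ 4" by (simp add: eval_nat_numeral)
    ultimately have "(c * (Gn u)\<^sup>2) * (Gn u)\<^sup>2 \<le> k * (Gn u)\<^sup>2"
      using c(2)[OF uL] J(2)[OF uN] by linarith
    then have "c * (Gn u)\<^sup>2 \<le> k" using nonzero_pos(2)[OF uH] by simp
    then have "(Gn u)\<^sup>2 \<le> k / c" using c(1) by (simp add: pos_le_divide_eq mult.commute)
    then have "- (k * (k / c)) \<le> - (k * (Gn u)\<^sup>2)"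
      unfolding neg_le_iff_le using k by (intro mult_left_mono) auto
    also note B
    finally show ?thesis unfolding J(1)[OF uN] by (rule divide_right_mono) simp
  qed
  show bdd: "bdd_below (J_fun \<Omega> a b l 3 ` (N_set \<Omega> a b l 3 \<inter> L_minus \<Omega> b l))"
    using lower by (intro bdd_belowI2)
  obtain u where u: "u \<in> N_set \<Omega> a b l 3 \<inter> L_minus \<Omega> b l" using ne by blast
  have "(INF u\<in>N_set \<Omega> a b l 3 \<inter> L_minus \<Omega> b l. J_fun \<Omega> a b l 3 u) \<le> J_fun \<Omega> a b l 3 u"
    by (rule cINF_lower[OF bdd u])
  also have "\<dots> < 0" using u J(1)[of u] by (simp add: L_minus_def)
  finally show "(INF u\<in>N_set \<Omega> a b l 3 \<inter> L_minus \<Omega> b l. J_fun \<Omega> a b l 3 u) < 0" .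
qed

text \<open>At \<open>l = b * lam1\<close> the quadratic form is only nonnegative, so the lower
  bounds rest on the quartic term: the power p + 1 > 4 forces the gradient norm on
  \<open>N_set\<close> to stay away from 0.\<close>

lemma Nehari_supercubic:
  assumes ab: "0 < a" "0 < b" and p: "3 < p" "p < 5" and l: "l \<le> b * lam1"
  shows "N_set \<Omega> a b l p \<noteq> {}" "W_plus \<Omega> a b l p \<noteq> {}" "W_minus \<Omega> a b l p \<noteq> {}"
    "\<forall>u\<in>H01 \<Omega> - zero_H01 \<Omega>. \<exists>!t. fibering_max \<Omega> a b l p u t"
    "bdd_below (J_fun \<Omega> a b l p ` N_set \<Omega> a b l p)" "0 < d_const \<Omega> a b l p"
proof -
  let ?B = "\<lambda>u. b * (Gn u)\<^sup>2 - l * (Mn u)\<^sup>2" and ?D = "\<lambda>u. Lnorm (p + 1) \<Omega> u powr (p + 1)"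
  have p0: "0 < p" and q: "4 \<le> p + 1" "p + 1 \<le> 6" using p by auto
  have B: "0 \<le> ?B u" if "u \<in> H01 \<Omega>" for u
  proof -
    have "l * (Mn u)\<^sup>2 \<le> b * lam1 * (Mn u)\<^sup>2" using l by (intro mult_right_mono) auto
    also have "\<dots> \<le> b * (Gn u)\<^sup>2" using lam1_le[OF that] ab(2) by (simp add: mult.assoc)
    finally show ?thesis by simp
  qed
  have fib: "\<exists>s. fibering_max \<Omega> a b l p u s" if u: "u \<in> H01 \<Omega>" "u \<notin> zero_H01 \<Omega>" for u
  proof -
    have A: "0 < a * (Gn u) ^ 4" using nonzero_pos(2)[OF u] ab by simp
    have D: "0 < ?D u" using Lnorm_pos[OF u q] by simp
    \<comment> \<open>With \<open>t ^ 4\<close> taken out the quartic term is constant, the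
      quadratic one nonincreasing because \<open>?B u \<ge> 0\<close>, and the subtracted power
      increasing because \<open>p > 3\<close>; this is the form treated by
      \<open>fibering_root\<close>.\<close>
    have I: "I_fun \<Omega> a b l p (rescale t u) = t ^ 4 * (a * (Gn u) ^ 4 + ?B u / t\<^sup>2 - ?D u * t powr (p - 3))" if t: "0 < t" for t
    proof -
      have "t ^ 4 = t powr 4" using t by simp
      then have "t ^ 4 * t powr (p - 3) = t powr (p + 1)" by (simp flip: powr_add add: algebra_simps)
      then have e1: "t ^ 4 * (?D u * t powr (p - 3)) = ?D u * t powr (p + 1)" by (simp add: mult.left_commute)
      have e2: "t ^ 4 * (?B u / t\<^sup>2) = ?B u * t\<^sup>2" using t by (simp add: eval_nat_numeral)
      show ?thesis
        unfolding ray(1)[OF u(1) t p0] right_diff_distrib[of "t ^ 4"] distrib_left[of "t ^ 4"] e1 e2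
        by (simp only: mult.commute)
    qed
    obtain s where s: "0 < s" "\<And>t. 0 < t \<Longrightarrow> t < s \<Longrightarrow> 0 < a * (Gn u) ^ 4 + ?B u / t\<^sup>2 - ?D u * t powr (p - 3)"
      "a * (Gn u) ^ 4 + ?B u / s\<^sup>2 - ?D u * s powr (p - 3) = 0" "\<And>t. s < t \<Longrightarrow> a * (Gn u) ^ 4 + ?B u / t\<^sup>2 - ?D u * t powr (p - 3) < 0"
      using fibering_root[OF A B[OF u(1)] D, of "p - 3"] p by auto
    have "fibering_max \<Omega> a b l p u s"
    proof (rule fibering_maxI[OF u p0 s(1)])
      show "I_fun \<Omega> a b l p (rescale s u) = 0" using s(3) by (simp add: I[OF s(1)])
      show "0 < I_fun \<Omega> a b l p (rescale t u)" if "0 < t" "t < s" for t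
        using s(2)[OF that] that by (simp add: I)
      show "I_fun \<Omega> a b l p (rescale t u) < 0" if "s < t" for t
        using s(4)[OF that] s(1) that by (simp add: I mult_pos_neg)
    qed
    then show ?thesis by blast
  qed
  then show "\<forall>u\<in>H01 \<Omega> - zero_H01 \<Omega>. \<exists>!t. fibering_max \<Omega> a b l p u t"
    using fibering_max_unique by blast
  obtain u where u: "u \<in> H01 \<Omega>" "u \<notin> zero_H01 \<Omega>" by (rule exists_nonzero[OF nonempty])
  obtain s where s: "fibering_max \<Omega> a b l p u s" using fib[OF u] by blast
  then show ne: "N_set \<Omega> a b l p \<noteq> {}" by (auto simp: fibering_max_def)
  obtain C where C: "0 < C" "\<And>u. u \<in> H01 \<Omega> \<Longrightarrow> ?D u \<le> C * Gn u powr (p + 1)"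
    by (rule Sobolev_between[OF q]) blast
  \<comment> \<open>On \<open>N_set\<close>,
    \<open>a * (Gn u) ^ 4 \<le> ?D u \<le> C * Gn u powr (p + 1)\<close>; cancelling the fourth
    power gives \<open>k \<le> Gn u\<close>.\<close>
  define k where "k = (a / C) powr (1 / (p - 3))"
  have k: "0 < k" using ab(1) C(1) by (simp add: k_def)
  \<comment> \<open>Eliminating the power term on \<open>N_set\<close> turns \<open>J_fun\<close>
    into \<open>m * (a * (Gn u) ^ 4)\<close> plus a nonnegative multiple of
    \<open>?B u\<close>.\<close>
  define m where "m = 1 / 4 - 1 / (p + 1)"
  have m: "0 < m" using p by (simp add: m_def field_simps)
  have lower: "m * (a * k ^ 4) \<le> J_fun \<Omega> a b l p u" if "u \<in> N_set \<Omega> a b l p" for u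
  proof -
    have u: "u \<in> H01 \<Omega>" "u \<notin> zero_H01 \<Omega>" "I_fun \<Omega> a b l p u = 0" using that by (auto simp: N_set_def)
    note g = nonzero_pos(2)[OF u(1,2)]
    have D: "?D u = a * (Gn u) ^ 4 + ?B u" using u(3) by (simp add: I_fun_def)
    have "Gn u ^ 4 * Gn u powr (p - 3) = Gn u powr (p + 1)"
    proof -
      have "Gn u ^ 4 = Gn u powr 4" using g by simp
      then show ?thesis by (simp flip: powr_add add: algebra_simps)
    qed
    then have "(Gn u) ^ 4 * a \<le> (Gn u) ^ 4 * (C * Gn u powr (p - 3))"
      using C(2)[OF u(1)] D B[OF u(1)] by (simp add: mult_ac)
    then have "a \<le> C * Gn u powr (p - 3)" using g by simp
    then have "a / C \<le> Gn u powr (p - 3)" using C(1) by (simp add: pos_divide_le_eq mult.commute)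
    then have "k \<le> (Gn u powr (p - 3)) powr (1 / (p - 3))"
      unfolding k_def using p ab(1) C(1) by (intro powr_mono2) auto
    also have "\<dots> = Gn u" using p g by (simp add: powr_powr)
    finally have "k ^ 4 \<le> (Gn u) ^ 4" using k by (intro power_mono) auto
    then have "m * (a * k ^ 4) \<le> m * (a * (Gn u) ^ 4)" using m ab(1) by (intro mult_left_mono) auto
    also have "\<dots> \<le> m * (a * (Gn u) ^ 4) + (1 / 2 - 1 / (p + 1)) * ?B u"
    proof -
      have "0 \<le> 1 / 2 - 1 / (p + 1)" using p by (simp add: field_simps)
      then have "0 \<le> (1 / 2 - 1 / (p + 1)) * ?B u" using B[OF u(1)] by (rule mult_nonneg_nonneg)
      then show ?thesis by (simp only: le_add_same_cancel1)
    qed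
    also have "\<dots> = J_fun \<Omega> a b l p u"
      unfolding J_fun_def D m_def by (simp add: algebra_simps add_divide_distrib diff_divide_distrib)
    finally show ?thesis .
  qed
  show "bdd_below (J_fun \<Omega> a b l p ` N_set \<Omega> a b l p)" using lower by (intro bdd_belowI2)
  have "0 < m * (a * k ^ 4)" using m ab(1) k by simp
  also have "\<dots> \<le> d_const \<Omega> a b l p" unfolding d_const_def using lower by (intro cINF_greatest ne)
  finally show d: "0 < d_const \<Omega> a b l p" .
  show "W_plus \<Omega> a b l p \<noteq> {}" by (rule W_plus_nonempty[OF d p0])
  have D: "0 < ?D u" using Lnorm_pos[OF u q] by simp
  \<comment> \<open>Beyond \<open>s\<close> the functional \<open>I_fun\<close> is negative,
    \<open>1 \<le> t\<close> gives \<open>t\<^sup>2 \<le> t ^ 4\<close>, and the third bound lets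
    the power term outweigh the other two in \<open>J_fun\<close>.\<close>
  obtain t where t: "s < t" "1 \<le> t" "(a * (Gn u) ^ 4 / 4 + ?B u / 2) * (p + 1) / ?D u < t powr (p - 3)"
    by (rule powr_unbounded[of "p - 3"]) (use p in simp)
  have t0: "0 < t" using t(2) by simp
  show "W_minus \<Omega> a b l p \<noteq> {}"
  proof (rule W_minus_nonempty[OF d rescale_H01(1)[OF u(1), of t]])
    show "I_fun \<Omega> a b l p (rescale t u) < 0" using s t(1) by (auto simp: fibering_max_def N_minus_def)
    have "t ^ 4 * t powr (p - 3) = t powr (p + 1)"
    proof -
      have "t ^ 4 = t powr 4" using t0 by simp
      then show ?thesis by (simp flip: powr_add add: algebra_simps)
    qed
    then have eq: "?D u / (p + 1) * t powr (p + 1) = t ^ 4 * (?D u / (p + 1) * t powr (p - 3))" by (simp add: mult_ac)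
    have "t\<^sup>2 \<le> t ^ 4" using t(2) by (intro power_increasing) auto
    then have "?B u / 2 * t\<^sup>2 \<le> ?B u / 2 * t ^ 4" using B[OF u(1)] by (intro mult_left_mono) auto
    moreover have "a * (Gn u) ^ 4 / 4 + ?B u / 2 \<le> ?D u / (p + 1) * t powr (p - 3)"
      using t(3) D p0 by (simp add: field_simps)
    then have "t ^ 4 * (a * (Gn u) ^ 4 / 4 + ?B u / 2) \<le> t ^ 4 * (?D u / (p + 1) * t powr (p - 3))"
      by (rule mult_left_mono) simp
    moreover have "t ^ 4 * (a * (Gn u) ^ 4 / 4 + ?B u / 2) = a * (Gn u) ^ 4 / 4 * t ^ 4 + ?B u / 2 * t ^ 4"
      by (simp only: distrib_left mult.commute)
    ultimately show "J_fun \<Omega> a b l p (rescale t u) \<le> 0"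
      unfolding ray(2)[OF u(1) t0 p0] eq by linarith
  qed
qed

end

theorem proposition1p1:
  fixes \<Omega> :: "(real ^ 3) set" and a b l p :: real
  assumes "open \<Omega>" and "bounded \<Omega>" and "\<Omega> \<noteq> {}" and "smooth_boundary \<Omega>"
    and "0 < a" and "0 < b"
  shows
    "(a < 1 / Lambda_const \<Omega> \<and> l < b * principal_eigenvalue \<Omega> \<longrightarrow>
       N_set \<Omega> a b l 3 \<noteq> {} \<and> W_plus \<Omega> a b l 3 \<noteq> {} \<and> W_minus \<Omega> a b l 3 \<noteq> {} \<and>
       (\<forall>u\<in>S_set \<Omega> a. fibering_max \<Omega> a b l 3 u (sigma_coeff \<Omega> a b l u) \<and>
                     (\<exists>!s. fibering_max \<Omega> a b l 3 u s)) \<and>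
       (\<forall>u\<in>H01 \<Omega> - S_set \<Omega> a. \<forall>t>0. rescale t u \<in> N_plus \<Omega> a b l 3) \<and>
       bdd_below (J_fun \<Omega> a b l 3 ` N_set \<Omega> a b l 3) \<and> d_const \<Omega> a b l 3 > 0) \<and>
     (\<forall>\<psi> \<delta>. a < 1 / Lambda_const \<Omega> \<and>
       dirichlet_eigenfunction \<Omega> (principal_eigenvalue \<Omega>) \<psi> \<and>
       (AE x in lebesgue_on \<Omega>. \<psi> x > 0) \<and>
       (Lnorm 4 \<Omega> \<psi>) ^ 4 - a * (Lnorm 2 \<Omega> (grad \<Omega> \<psi>)) ^ 4 < 0 \<and>
       delta_admissible \<Omega> a b \<delta> \<and>
       b * principal_eigenvalue \<Omega> < l \<and> l < b * principal_eigenvalue \<Omega> + \<delta>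
     \<longrightarrow>
       (N_set \<Omega> a b l 3 \<inter> L_zero \<Omega> b l = {} \<and>
        N_set \<Omega> a b l 3 \<inter> L_plus \<Omega> b l \<noteq> {} \<and> N_set \<Omega> a b l 3 \<inter> L_minus \<Omega> b l \<noteq> {}) \<and>
       (\<forall>u\<in>S_set \<Omega> a. sigma_coeff \<Omega> a b l u > 0 \<and>
          rescale (sigma_coeff \<Omega> a b l u) u \<in> N_set \<Omega> a b l 3 \<inter> L_plus \<Omega> b l \<and>
          (\<forall>t. 0 < t \<and> t < sigma_coeff \<Omega> a b l u \<longrightarrow> rescale t u \<in> N_plus \<Omega> a b l 3) \<and>
          (\<forall>t>sigma_coeff \<Omega> a b l u. rescale t u \<in> N_minus \<Omega> a b l 3)) \<and>
       (\<forall>u\<in>L_minus \<Omega> b l. sigma_coeff \<Omega> a b l u > 0 \<and>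
          rescale (sigma_coeff \<Omega> a b l u) u \<in> N_set \<Omega> a b l 3 \<inter> L_minus \<Omega> b l \<and>
          (\<forall>t. 0 < t \<and> t < sigma_coeff \<Omega> a b l u \<longrightarrow> rescale t u \<in> N_minus \<Omega> a b l 3) \<and>
          (\<forall>t>sigma_coeff \<Omega> a b l u. rescale t u \<in> N_plus \<Omega> a b l 3)) \<and>
       bdd_below (J_fun \<Omega> a b l 3 ` (N_set \<Omega> a b l 3 \<inter> L_minus \<Omega> b l)) \<and>
       (INF u\<in>N_set \<Omega> a b l 3 \<inter> L_minus \<Omega> b l. J_fun \<Omega> a b l 3 u) < 0) \<and>
     (3 < p \<and> p < 5 \<and> l \<le> b * principal_eigenvalue \<Omega> \<longrightarrow>
       N_set \<Omega> a b l p \<noteq> {} \<and> W_plus \<Omega> a b l p \<noteq> {} \<and> W_minus \<Omega> a b l p \<noteq> {} \<and>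
       (\<forall>u\<in>H01 \<Omega> - zero_H01 \<Omega>. \<exists>!t. fibering_max \<Omega> a b l p u t) \<and>
       bdd_below (J_fun \<Omega> a b l p ` N_set \<Omega> a b l p) \<and> d_const \<Omega> a b l p > 0)"
proof -
  interpret bounded_domain \<Omega>
    using assms by unfold_locales
  show ?thesis (is "?P1 \<and> ?P2 \<and> ?P3")
  proof (rule conjI[OF _ conjI])
    show ?P1
      by (intro impI; elim conjE; intro conjI Nehari_cubic_below_eigenvalue[OF assms(5,6)]; assumption)
    show ?P2
      by (intro allI impI; elim conjE; intro conjI Nehari_cubic_above_eigenvalue[OF assms(5,6)]; assumption)
    show ?P3
      by (intro impI; elim conjE; intro conjI Nehari_supercubic[OF assms(5,6)]; assumption)
  qed
qed

end
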